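(* Let $f$ be a continuous quaternionic plurisubharmonic function on a domain $\Omega\subset\mathbb{H}^n$. Let $\{f_N\}$ be a sequence of twice continuously differentiable quaternionic plurisubharmonic functions on $\Omega$ converging to $f$ uniformly on compact subsets of $\Omega$. Then $\det\left(\frac{\partial^2 f_N}{\partial\bar q_i\partial q_j}\right)$ weakly converges to a non-negative measure on $\Omega$. This measure depends only on $f$ and not on the choice of an approximating sequence $\{f_N\}$.
   Context: $\mathbb{H}$ is the skew field of quaternions, $q=t+ix+jy+kz$; $\mathbb{H}^n$ is a right $\mathbb{H}$-vector space with coordinates $q_m=t_m+ix_m+jy_m+kz_m$. Set $$\frac{\partial f}{\partial\bar q_m}=\frac{\partial f}{\partial t_m}+i\frac{\partial f}{\partial x_m}+j\frac{\partial f}{\partial y_m}+k\frac{\partial f}{\partial z_m},\qquad \frac{\partial f}{\partial q_m}=\overline{\frac{\partial\bar f}{\partial\bar q_m}}=\frac{\partial f}{\partial t_m}-\frac{\partial f}{\partial x_m}i-\frac{\partial f}{\partial y_m}j-\frac{\partial f}{\partial z_m}k .$$ For real valued $f\in C^2$ the matrix $\left(\frac{\partial^2 f}{\partial\bar q_i\partial q_j}\right)$ is hyperhermitian (equal to its conjugate transpose). Moore determinant: for a hyperhermitian $n\times n$ matrix $A=(a_{ij})$ let ${}^{\mathbb R}A$ be the real $4n\times 4n$ matrix of the symmetric bilinear form $(x,y)\mapsto \mathrm{Re}\sum_{i,j}\bar x_i a_{ij}y_j$ on $\mathbb{H}^n\cong\mathbb{R}^{4n}$. There is a unique polynomial $P$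 on the real vector space of hyperhermitian $n\times n$ matrices with $\det({}^{\mathbb R}A)=P(A)^4$ for all $A$ and $P(\mathrm{Id})=1$; the Moore determinant is $\det A:=P(A)\in\mathbb{R}$. A real valued function $f$ on an open subset of $\mathbb{R}^m$ is subharmonic if it is upper semi-continuous and for every point $x_0$ and all sufficiently small $r>0$ one has $f(x_0)\le\int_{S(x_0,r)}f\,d\sigma$, where $\sigma$ is the normalized Lebesgue measure on the sphere $S(x_0,r)$. A function $f:\Omega\to\mathbb{R}$ is quaternionic plurisubharmonic if it is upper semi-continuous and its restriction to (the intersection of $\Omega$ with) any affine right quaternionic line $\{a+v\lambda:\lambda\in\mathbb{H}\}$, $v\ne0$, is subharmonic. For $f\in C^2$ the function $\det\left(\frac{\partial^2 f}{\partial\bar q_i\partial q_j}\right)$ (Moore determinant) is identified with the measure having it as density with respect to Lebesgue measure. Weak convergence of measures on $\Omega$ means convergence of integrals against every continuous function with compact support in $\Omega$. *)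

theory Defs
  imports "HOL-Analysis.Analysis"
begin

codatatype quat = Quat (QRe: real) (QIm1: real) (QIm2: real) (QIm3: real)

lemma quat_eq_iff:
  "p = q \<longleftrightarrow> QRe p = QRe q \<and> QIm1 p = QIm1 q \<and> QIm2 p = QIm2 q \<and> QIm3 p = QIm3 q"
  by (auto intro: quat.expand)

lemma quat_eqI [intro?]:
  "\<lbrakk>QRe p = QRe q; QIm1 p = QIm1 q; QIm2 p = QIm2 q; QIm3 p = QIm3 q\<rbrakk> \<Longrightarrow> p = q"
  by (simp add: quat_eq_iff)

instantiation quat :: ab_group_add
begin

primcorec zero_quat where
  "QRe 0 = 0" | "QIm1 0 = 0" | "QIm2 0 = 0" | "QIm3 0 = 0"

primcorec plus_quat where
  "QRe (p + q) = QRe p + QRe q"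
| "QIm1 (p + q) = QIm1 p + QIm1 q"
| "QIm2 (p + q) = QIm2 p + QIm2 q"
| "QIm3 (p + q) = QIm3 p + QIm3 q"

primcorec uminus_quat where
  "QRe (- q) = - QRe q"
| "QIm1 (- q) = - QIm1 q"
| "QIm2 (- q) = - QIm2 q"
| "QIm3 (- q) = - QIm3 q"

primcorec minus_quat where
  "QRe (p - q) = QRe p - QRe q"
| "QIm1 (p - q) = QIm1 p - QIm1 q"
| "QIm2 (p - q) = QIm2 p - QIm2 q"
| "QIm3 (p - q) = QIm3 p - QIm3 q"

instance
  by standard (simp_all add: quat_eq_iff)

end

primcorec qcnj :: "quat \<Rightarrow> quat" where
  "QRe (qcnj q) = QRe q"
| "QIm1 (qcnj q) = - QIm1 q"
| "QIm2 (qcnj q) = - QIm2 q"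
| "QIm3 (qcnj q) = - QIm3 q"

primcorec quat_i :: quat where
  "QRe quat_i = 0" | "QIm1 quat_i = 1" | "QIm2 quat_i = 0" | "QIm3 quat_i = 0"

primcorec quat_j :: quat where
  "QRe quat_j = 0" | "QIm1 quat_j = 0" | "QIm2 quat_j = 1" | "QIm3 quat_j = 0"

primcorec quat_k :: quat where
  "QRe quat_k = 0" | "QIm1 quat_k = 0" | "QIm2 quat_k = 0" | "QIm3 quat_k = 1"

instantiation quat :: ring_1
begin

primcorec one_quat where
  "QRe 1 = 1" | "QIm1 1 = 0" | "QIm2 1 = 0" | "QIm3 1 = 0"

primcorec times_quat where
  "QRe (p * q) = QRe p * QRe q - QIm1 p * QIm1 q - QIm2 p * QIm2 q - QIm3 p * QIm3 q"
| "QIm1 (p * q) = QRe p * QIm1 q + QIm1 p * QRe q + QIm2 p * QIm3 q - QIm3 p * QIm2 q"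
| "QIm2 (p * q) = QRe p * QIm2 q - QIm1 p * QIm3 q + QIm2 p * QRe q + QIm3 p * QIm1 q"
| "QIm3 (p * q) = QRe p * QIm3 q + QIm1 p * QIm2 q - QIm2 p * QIm1 q + QIm3 p * QRe q"

instance
  by standard (simp_all add: quat_eq_iff algebra_simps)

end

lemma quat_unit_products:
  "quat_i * quat_i = -1" "quat_j * quat_j = -1" "quat_k * quat_k = -1"
  "quat_i * quat_j = quat_k" "quat_j * quat_k = quat_i" "quat_k * quat_i = quat_j"
  "quat_j * quat_i = - quat_k" "quat_k * quat_j = - quat_i" "quat_i * quat_k = - quat_j"
  by (simp_all add: quat_eq_iff)

instantiation quat :: real_algebra_1
begin

primcorec scaleR_quat where
  "QRe (r *\<^sub>R q) = r * QRe q"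
| "QIm1 (r *\<^sub>R q) = r * QIm1 q"
| "QIm2 (r *\<^sub>R q) = r * QIm2 q"
| "QIm3 (r *\<^sub>R q) = r * QIm3 q"

instance
  by standard (simp_all add: quat_eq_iff algebra_simps)

end

instantiation quat :: real_inner
begin

definition inner_quat :: "quat \<Rightarrow> quat \<Rightarrow> real" where
  "inner_quat p q = QRe p * QRe q + QIm1 p * QIm1 q + QIm2 p * QIm2 q + QIm3 p * QIm3 q"

definition norm_quat :: "quat \<Rightarrow> real" where
  "norm_quat q = sqrt (inner q q)"

definition sgn_quat :: "quat \<Rightarrow> quat" where
  "sgn_quat q = q /\<^sub>R norm q"

definition dist_quat :: "quat \<Rightarrow> quat \<Rightarrow> real" where
  "dist_quat p q = norm (p - q)"

definition uniformity_quat :: "(quat \<times> quat) filter" where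
  "uniformity_quat = (INF e\<in>{0<..}. principal {(x, y). dist x y < e})"

definition open_quat :: "quat set \<Rightarrow> bool" where
  "open_quat U \<longleftrightarrow> (\<forall>x\<in>U. eventually (\<lambda>(x', y). x' = x \<longrightarrow> y \<in> U) uniformity)"

instance
proof
  fix p q r :: quat and a :: real
  show "0 \<le> inner p p"
    by (simp add: inner_quat_def)
  show "inner p p = 0 \<longleftrightarrow> p = 0"
  proof
    assume "inner p p = 0"
    then have "(QRe p)\<^sup>2 + (QIm1 p)\<^sup>2 + (QIm2 p)\<^sup>2 + (QIm3 p)\<^sup>2 = 0"
      by (simp add: inner_quat_def power2_eq_square)
    then have "(QRe p)\<^sup>2 = 0 \<and> (QIm1 p)\<^sup>2 = 0 \<and> (QIm2 p)\<^sup>2 = 0 \<and> (QIm3 p)\<^sup>2 = 0"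
      by (smt (verit) zero_le_power2)
    then show "p = 0"
      by (simp add: quat_eq_iff)
  qed (simp add: inner_quat_def)
qed (simp_all add: inner_quat_def norm_quat_def sgn_quat_def dist_quat_def
      uniformity_quat_def open_quat_def algebra_simps)

end

instantiation quat :: inverse
begin

definition inverse_quat :: "quat \<Rightarrow> quat" where
  "inverse_quat q = qcnj q /\<^sub>R inner q q"

definition divide_quat :: "quat \<Rightarrow> quat \<Rightarrow> quat" where
  "divide_quat p q = p * inverse q"

instance ..

end

instance quat :: real_normed_div_algebra
proof
  fix p q :: quat
  have cnj: "q * qcnj q = inner q q *\<^sub>R 1" "qcnj q * q = inner q q *\<^sub>R 1"
    by (simp_all add: quat_eq_iff inner_quat_def)
  show "p / q = p * inverse q"
    by (simp add: divide_quat_def)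
  show "inverse (0::quat) = 0"
    by (simp add: inverse_quat_def)
  show "q \<noteq> 0 \<Longrightarrow> q * inverse q = 1" "q \<noteq> 0 \<Longrightarrow> inverse q * q = 1"
    by (simp_all add: inverse_quat_def cnj)
  have "inner (p * q) (p * q) = inner p p * inner q q"
    by (simp add: inner_quat_def algebra_simps)
  then show "norm (p * q) = norm p * norm q"
    by (simp add: norm_quat_def real_sqrt_mult)
qed

instantiation quat :: euclidean_space
begin

definition Basis_quat :: "quat set" where
  "Basis_quat = {1, quat_i, quat_j, quat_k}"

instance
proof
  fix u v x :: quat
  show "(Basis :: quat set) \<noteq> {}" "finite (Basis :: quat set)"
    by (simp_all add: Basis_quat_def)
  show "inner u v = (if u = v then 1 else 0)" if "u \<in> Basis" "v \<in> Basis"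
    using that by (auto simp: Basis_quat_def inner_quat_def quat_eq_iff)
  show "(\<forall>u\<in>Basis. inner x u = 0) \<longleftrightarrow> x = 0"
    unfolding Basis_quat_def ball_simps by (auto simp: inner_quat_def quat_eq_iff)
qed

end

text \<open>The type \<^typ>\<open>quat ^ 'n\<close> is the space of $n$-tuples of quaternions; its inner product, norm and
  Lebesgue measure are those of $4n$-dimensional Euclidean space.\<close>

definition partial_deriv ::
  "quat ^ 'n::finite \<Rightarrow> (quat ^ 'n \<Rightarrow> 'b::real_normed_vector) \<Rightarrow> quat ^ 'n \<Rightarrow> 'b" where
  "partial_deriv v f x = vector_derivative (\<lambda>s. f (x + s *\<^sub>R v)) (at 0)"

definition d_qbar :: "'n::finite \<Rightarrow> (quat ^ 'n \<Rightarrow> quat) \<Rightarrow> quat ^ 'n \<Rightarrow> quat" where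
  "d_qbar m f x =
     partial_deriv (axis m 1) f x
     + quat_i * partial_deriv (axis m quat_i) f x
     + quat_j * partial_deriv (axis m quat_j) f x
     + quat_k * partial_deriv (axis m quat_k) f x"

definition d_q :: "'n::finite \<Rightarrow> (quat ^ 'n \<Rightarrow> quat) \<Rightarrow> quat ^ 'n \<Rightarrow> quat" where
  "d_q m f x =
     partial_deriv (axis m 1) f x
     - partial_deriv (axis m quat_i) f x * quat_i
     - partial_deriv (axis m quat_j) f x * quat_j
     - partial_deriv (axis m quat_k) f x * quat_k"

definition quat_hessian :: "(quat ^ 'n::finite \<Rightarrow> real) \<Rightarrow> quat ^ 'n \<Rightarrow> quat ^ 'n ^ 'n" where
  "quat_hessian f x = (\<chi> i j. d_qbar i (d_q j (\<lambda>y. of_real (f y))) x)"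

definition C2_on :: "'a::euclidean_space set \<Rightarrow> ('a \<Rightarrow> real) \<Rightarrow> bool" where
  "C2_on \<Omega> f \<longleftrightarrow>
     (\<exists>(f' :: 'a \<Rightarrow> 'a \<Rightarrow>\<^sub>L real) (f'' :: 'a \<Rightarrow> 'a \<Rightarrow>\<^sub>L 'a \<Rightarrow>\<^sub>L real).
        (\<forall>x\<in>\<Omega>. (f has_derivative blinfun_apply (f' x)) (at x)) \<and>
        (\<forall>x\<in>\<Omega>. (f' has_derivative blinfun_apply (f'' x)) (at x)) \<and>
        continuous_on \<Omega> f'')"

definition hyperhermitian :: "quat ^ 'n ^ 'n::finite \<Rightarrow> bool" where
  "hyperhermitian A \<longleftrightarrow> (\<forall>i j. A $ i $ j = qcnj (A $ j $ i))"

definition real_form :: "quat ^ 'n ^ 'n::finite \<Rightarrow> quat ^ 'n \<Rightarrow> quat ^ 'n \<Rightarrow> real" where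
  "real_form A x y = QRe (\<Sum>i\<in>UNIV. \<Sum>j\<in>UNIV. qcnj (x $ i) * A $ i $ j * y $ j)"

definition quat_unit :: "4 \<Rightarrow> quat" where
  "quat_unit a = (if a = 0 then 1 else if a = 1 then quat_i else if a = 2 then quat_j else quat_k)"

text \<open>The Gram matrix of \<^const>\<open>real_form\<close> in the standard real basis of $n$-tuples of quaternions; the
  index set has $4n$ elements.\<close>

definition realification :: "quat ^ 'n ^ 'n::finite \<Rightarrow> real ^ ('n \<times> 4) ^ ('n \<times> 4)" where
  "realification A =
     (\<chi> r s. real_form A (axis (fst r) (quat_unit (snd r))) (axis (fst s) (quat_unit (snd s))))"

text \<open>A polynomial on the subspace of hyperhermitian matrices is the restriction of a polynomial
  function on all quaternionic matrices.  Only the values on hyperhermitian matrices matter; the value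
  0 elsewhere merely makes the function unique.\<close>

definition moore_polynomial :: "(quat ^ 'n ^ 'n::finite \<Rightarrow> real) \<Rightarrow> bool" where
  "moore_polynomial P \<longleftrightarrow>
     (\<exists>p. real_polynomial_function p \<and> (\<forall>A. hyperhermitian A \<longrightarrow> P A = p A)) \<and>
     (\<forall>A. hyperhermitian A \<longrightarrow> det (realification A) = P A ^ 4) \<and>
     P (mat 1) = 1 \<and>
     (\<forall>A. \<not> hyperhermitian A \<longrightarrow> P A = 0)"

definition moore_det :: "quat ^ 'n ^ 'n::finite \<Rightarrow> real" where
  "moore_det = (THE P. moore_polynomial P)"

definition usc_on :: "'a::topological_space set \<Rightarrow> ('a \<Rightarrow> real) \<Rightarrow> bool" where
  "usc_on U f \<longleftrightarrow> (\<forall>x\<in>U. \<forall>c > f x. eventually (\<lambda>y. f y < c) (at x within U))"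

text \<open>Normalized Lebesgue measure on \<^term>\<open>sphere x r\<close> as cone measure: the radial projection of the
  uniform distribution on the unit ball.\<close>

definition sphere_measure :: "'a::euclidean_space \<Rightarrow> real \<Rightarrow> 'a measure" where
  "sphere_measure x r =
     distr (uniform_measure lborel (ball 0 1)) borel (\<lambda>y. x + (r / norm y) *\<^sub>R y)"

text \<open>An upper semicontinuous function is bounded above on spheres, so its spherical mean always exists
  in $[-\infty, \infty)$ and dominates a real number only if it is finite.  Integrability is
  required explicitly because the Bochner integral of a non-integrable function is 0.\<close>

definition subharmonic_on :: "'a::euclidean_space set \<Rightarrow> ('a \<Rightarrow> real) \<Rightarrow> bool" where
  "subharmonic_on U f \<longleftrightarrow>
     usc_on U f \<and>
     (\<forall>x\<in>U. \<forall>\<^sub>F r in at_right 0.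
        sphere x r \<subseteq> U \<and>
        set_integrable (sphere_measure x r) (sphere x r) f \<and>
        f x \<le> (LINT y : sphere x r | sphere_measure x r. f y))"

definition right_mult :: "quat ^ 'n::finite \<Rightarrow> quat \<Rightarrow> quat ^ 'n" where
  "right_mult v l = (\<chi> i. v $ i * l)"

text \<open>The affine right quaternionic line through \<open>a\<close> in direction \<open>v\<close> is identified with the
  quaternions by the similarity sending \<open>l\<close> to \<open>a + v l\<close>, which maps spheres to spheres and
  preserves their normalized measures.\<close>

definition quat_psh_on :: "(quat ^ 'n::finite) set \<Rightarrow> (quat ^ 'n \<Rightarrow> real) \<Rightarrow> bool" where
  "quat_psh_on \<Omega> f \<longleftrightarrow>
     usc_on \<Omega> f \<and>
     (\<forall>a v. v \<noteq> 0 \<longrightarrow>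
        subharmonic_on {l. a + right_mult v l \<in> \<Omega>} (\<lambda>l. f (a + right_mult v l)))"

text \<open>Finiteness on compact sets makes every compactly supported continuous function integrable.\<close>

definition locally_finite_borel_measure_on :: "'a::euclidean_space set \<Rightarrow> 'a measure \<Rightarrow> bool" where
  "locally_finite_borel_measure_on \<Omega> \<mu> \<longleftrightarrow>
     sets \<mu> = sets (restrict_space borel \<Omega>) \<and>
     (\<forall>K. compact K \<and> K \<subseteq> \<Omega> \<longrightarrow> emeasure \<mu> K < \<infinity>)"

definition test_function_on :: "'a::euclidean_space set \<Rightarrow> ('a \<Rightarrow> real) \<Rightarrow> bool" where
  "test_function_on \<Omega> \<phi> \<longleftrightarrow>
     continuous_on UNIV \<phi> \<and>
     compact (closure {x. \<phi> x \<noteq> 0}) \<and> closure {x. \<phi> x \<noteq> 0} \<subseteq> \<Omega>"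

text \<open>Weak convergence of the measures with densities \<open>g N\<close> with respect to Lebesgue measure.  The
  densities are real valued, and no sign condition is imposed on them.\<close>

definition densities_converge_weakly ::
  "'a::euclidean_space set \<Rightarrow> (nat \<Rightarrow> 'a \<Rightarrow> real) \<Rightarrow> 'a measure \<Rightarrow> bool" where
  "densities_converge_weakly \<Omega> g \<mu> \<longleftrightarrow>
     (\<forall>\<phi>. test_function_on \<Omega> \<phi> \<longrightarrow>
        (\<lambda>N. LINT x : \<Omega> | lborel. \<phi> x * g N x) \<longlonglongrightarrow> (LINT x | \<mu>. \<phi> x))"

definition C2_psh_approximation ::
  "(quat ^ 'n::finite) set \<Rightarrow> (quat ^ 'n \<Rightarrow> real) \<Rightarrow> (nat \<Rightarrow> quat ^ 'n \<Rightarrow> real) \<Rightarrow> bool" where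
  "C2_psh_approximation \<Omega> f F \<longleftrightarrow>
     (\<forall>N. C2_on \<Omega> (F N) \<and> quat_psh_on \<Omega> (F N)) \<and>
     (\<forall>K. compact K \<and> K \<subseteq> \<Omega> \<longrightarrow> uniform_limit K F f sequentially)"

end

theory Submission
  imports Defs
begin

text \<open>
  The Moore determinant is a Pfaffian.  A hyperhermitian matrix \<open>A\<close> of size $n$ gives an alternating
  complex form of size $2n$ (\<open>bform\<close>), and the polarisation \<open>pmix\<close> of the Pfaffian of this form is
  the quaternionic mixed discriminant.  It is nonnegative on positive semidefinite matrices:
  Gaussian elimination by congruences writes them as \<open>V ** qadj V\<close> (\<open>psd_cholesky\<close>), whose Pfaffian is
  the complex determinant of \<open>V\<close> (\<open>pmix_mult_qadj\<close>), while the real determinant of \<open>V\<close> is the square of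
  that number.  The last fact also gives the fourth power identity that defines the Moore
  determinant, first for positive semidefinite matrices and then for all, by following the segment
  from the identity matrix.

  Expanded in the real second derivatives of the functions (\<open>mform\<close>), the mixed discriminant of $n$
  Hessians has coefficients that are antisymmetric in the directions of the first derivatives and
  in those of the second derivatives.  Third derivatives are symmetric, so the cofactors of each
  Hessian are divergence free (\<open>divergence_free_left\<close>, \<open>divergence_free_right\<close>).  Hence both derivatives can be
  moved from one of the functions to a test function (\<open>mixed_by_parts\<close>).  This is the engine of the
  proof: a function whose derivatives have been moved enters an estimate only through its supremum.

  Two estimates follow, in which the Hessian of the test function is dominated by that of the
  squared norm.  The masses of the Monge-Ampere measures on a compact set are bounded in terms of
  the suprema of the functions on a larger one (\<open>Chern_Levine_Nirenberg\<close>), and the integral of a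
  fixed test function of class $C^2$ depends on the functions in a Lipschitz continuous way
  (\<open>mixed_difference_bound\<close>).  Both need that plurisubharmonic functions of class $C^2$ have positive
  semidefinite quaternionic Hessians (\<open>quat_psh_imp_line_trace\<close>), which comes from averaging Taylor's
  formula over the eight units that rotate a sphere in a quaternionic line.

  So for a locally uniformly convergent sequence the integrals of a test function of class $C^2$
  are a Cauchy sequence, and by the bound on the masses the same holds for continuous test functions
  (\<open>ma_integral_convergent\<close>).  The limit is a positive linear functional, and the Riesz representation
  theorem provides the measure.  It does not depend on the sequence: two approximating sequences can
  be interleaved to a third one, whose integrals converge as well, and a locally finite measure is
  determined by its integrals of test functions.
\<close>

section \<open>Quaternionic matrices as complex and as real matrices\<close>

text \<open>Left multiplication by a quaternion is linear for the complex numbers \<open>t + i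
  x\<close> acting from the right. These are the entries of its matrix in the basis
  \<open>1\<close>, \<open>j\<close>, with row index \<open>s\<close> and column index
  \<open>t\<close>; \<^term>\<open>False\<close> stands for \<open>1\<close> and
  \<^term>\<open>True\<close> for \<open>j\<close>.\<close>

definition cq :: "quat \<Rightarrow> bool \<Rightarrow> bool \<Rightarrow> complex" where
  "cq p s t =
     (let a = Complex (QRe p) (QIm1 p); b = Complex (QIm2 p) (- QIm3 p)
      in if t then (if s then cnj a else - cnj b) else (if s then b else a))"

lemma cq_mult: "cq (p * q) s t = (\<Sum>r\<in>UNIV. cq p s r * cq q r t)"
  by (cases s; cases t; simp add: cq_def Let_def UNIV_bool complex_eq_iff algebra_simps)

lemma cq_1: "cq 1 s t = (if s = t then 1 else 0)"
  by (simp add: cq_def Let_def complex_eq_iff)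

lemma cq_0 [simp]: "cq 0 s t = 0"
  by (simp add: cq_def Let_def complex_eq_iff)

lemma cq_add: "cq (p + q) s t = cq p s t + cq q s t"
  by (simp add: cq_def Let_def complex_eq_iff)

lemma cq_scaleR: "cq (c *\<^sub>R p) s t = of_real c * cq p s t"
  by (simp add: cq_def Let_def complex_eq_iff)

lemma cq_sum: "cq (sum f I) s t = (\<Sum>i\<in>I. cq (f i) s t)"
  by (induction I rule: infinite_finite_induct) (simp_all add: cq_add)

lemma cq_of_real: "cq (of_real c) s t = (if s = t then of_real c else 0)"
  by (simp add: of_real_def cq_scaleR cq_1)

definition cmat :: "quat ^ 'n ^ 'n \<Rightarrow> complex ^ ('n \<times> bool) ^ ('n \<times> bool)" where
  "cmat V = (\<chi> x y. cq (V $ fst x $ fst y) (snd x) (snd y))"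

definition qadj :: "quat ^ 'n ^ 'n \<Rightarrow> quat ^ 'n ^ 'n" where
  "qadj V = (\<chi> i j. qcnj (V $ j $ i))"

lemma qadj_nth: "qadj V $ i $ j = qcnj (V $ j $ i)"
  by (simp add: qadj_def)

lemma sum_UNIV_prod: "(\<Sum>x\<in>UNIV. f (x :: 'a::finite \<times> 'b::finite)) = (\<Sum>i\<in>UNIV. \<Sum>s\<in>UNIV. f (i, s))"
  by (simp add: sum.cartesian_product flip: UNIV_Times_UNIV)

lemma prod_UNIV_prod: "(\<Prod>x\<in>UNIV. f (x :: 'a::finite \<times> 'b::finite)) = (\<Prod>i\<in>UNIV. \<Prod>s\<in>UNIV. f (i, s))"
  by (simp add: prod.cartesian_product flip: UNIV_Times_UNIV)

lemma cmat_mult: "cmat (V ** W) = cmat V ** cmat W"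
  by (simp add: vec_eq_iff cmat_def matrix_matrix_mult_def sum_UNIV_prod cq_sum cq_mult)

lemma cmat_1: "cmat (mat 1) = mat 1"
  by (auto simp: vec_eq_iff cmat_def mat_def cq_1 prod_eq_iff)

lemma qcnj_add: "qcnj (p + q) = qcnj p + qcnj q"
  by (simp add: quat_eq_iff)

lemma qcnj_0 [simp]: "qcnj 0 = 0"
  by (simp add: quat_eq_iff)

lemma qcnj_sum: "qcnj (sum f I) = (\<Sum>i\<in>I. qcnj (f i))"
  by (induction I rule: infinite_finite_induct) (simp_all add: qcnj_add)

lemma qcnj_mult: "qcnj (p * q) = qcnj q * qcnj p"
  by (simp add: quat_eq_iff algebra_simps)

lemma qcnj_qcnj [simp]: "qcnj (qcnj p) = p"
  by (simp add: quat_eq_iff)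

lemma qcnj_scaleR: "qcnj (c *\<^sub>R p) = c *\<^sub>R qcnj p"
  by (simp add: quat_eq_iff)

lemma qcnj_of_real [simp]: "qcnj (of_real c) = of_real c"
  by (simp add: quat_eq_iff of_real_def)

lemma qcnj_1 [simp]: "qcnj 1 = 1"
  by (simp add: quat_eq_iff)

lemma qcnj_minus [simp]: "qcnj (- q) = - qcnj q"
  by (simp add: quat_eq_iff)

lemma QRe_sum: "QRe (sum f I) = (\<Sum>i\<in>I. QRe (f i))"
  by (induction I rule: infinite_finite_induct) simp_all

lemma QRe_mult_commute: "QRe (p * q) = QRe (q * p)"
  by simp

lemma inner_quat_QRe: "inner p q = QRe (qcnj p * q)"
  by (simp add: inner_quat_def)

lemma qadj_mult: "qadj (V ** W) = qadj W ** qadj V"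
  by (simp add: vec_eq_iff qadj_def matrix_matrix_mult_def qcnj_sum qcnj_mult)

lemma qadj_qadj [simp]: "qadj (qadj V) = V"
  by (simp add: vec_eq_iff qadj_def)

lemma qadj_1 [simp]: "qadj (mat 1) = mat 1"
  by (auto simp: vec_eq_iff qadj_def mat_def)

lemma hyperhermitian_iff: "hyperhermitian A \<longleftrightarrow> qadj A = A"
  unfolding vec_eq_iff qadj_def hyperhermitian_def vec_lambda_beta by metis

lemma real_form_axis: "real_form A (axis i p) (axis j q) = QRe (qcnj p * A $ i $ j * q)"
proof -
  have "(\<Sum>k\<in>UNIV. \<Sum>l\<in>UNIV. qcnj (axis i p $ k) * A $ k $ l * axis j q $ l)
      = (\<Sum>k\<in>UNIV. if k = i then qcnj p * A $ k $ j * q else 0)"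
    by (intro sum.cong refl) (auto simp: axis_def if_distrib[of qcnj] if_distrib cong: if_cong)
  then show ?thesis by (simp add: real_form_def)
qed

lemma realification_nth:
  "realification A $ (i, a) $ (j, b) = QRe (qcnj (quat_unit a) * A $ i $ j * quat_unit b)"
  by (simp add: realification_def real_form_axis)

lemma quat_unit_simps [simp]:
  "quat_unit 4 = 1" "quat_unit 0 = 1" "quat_unit 1 = quat_i" "quat_unit 2 = quat_j" "quat_unit 3 = quat_k"
  by (simp_all add: quat_unit_def)

lemma quat_unit_parseval:
  "(\<Sum>c\<in>UNIV. QRe (p * quat_unit c) * QRe (qcnj (quat_unit c) * q)) = QRe (p * q)"
  by (simp add: sum_4)

lemma realification_mult: "realification (A ** B) = realification A ** realification B"
proof -
  have "realification (A ** B) $ (i, a) $ (j, b) = (realification A ** realification B) $ (i, a) $ (j, b)"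
    for i a j b
  proof -
    have "(realification A ** realification B) $ (i, a) $ (j, b)
      = (\<Sum>k\<in>UNIV. \<Sum>c\<in>UNIV. QRe (qcnj (quat_unit a) * A $ i $ k * quat_unit c) *
            QRe (qcnj (quat_unit c) * (B $ k $ j * quat_unit b)))"
      by (simp add: matrix_matrix_mult_def sum_UNIV_prod realification_nth mult.assoc)
    also have "\<dots> = (\<Sum>k\<in>UNIV. QRe (qcnj (quat_unit a) * A $ i $ k * (B $ k $ j * quat_unit b)))"
      by (simp only: quat_unit_parseval)
    also have "\<dots> = realification (A ** B) $ (i, a) $ (j, b)"
      by (simp only: realification_nth matrix_matrix_mult_def vec_lambda_beta sum_distrib_left
          sum_distrib_right QRe_sum mult.assoc)
    finally show ?thesis by simp
  qed
  then show ?thesis by (auto simp: vec_eq_iff)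
qed

lemma realification_1: "realification (mat 1) = mat 1"
proof -
  have "realification (mat 1 :: quat ^ 'n ^ 'n) $ (i, a) $ (j, b) = mat 1 $ (i, a) $ (j, b)" for i a j b
    using exhaust_4[of a] exhaust_4[of b] by (auto simp: realification_nth mat_def)
  then show ?thesis by (auto simp: vec_eq_iff)
qed

lemma realification_qadj: "realification (qadj A) = transpose (realification A)"
proof -
  have "realification (qadj A) $ (i, a) $ (j, b) = transpose (realification A) $ (i, a) $ (j, b)" for i a j b
  proof -
    have "qcnj (quat_unit a) * qcnj (A $ j $ i) * quat_unit b = qcnj (qcnj (quat_unit b) * A $ j $ i * quat_unit a)"
      by (simp only: qcnj_mult qcnj_qcnj mult.assoc)
    then show ?thesis
      by (simp only: realification_nth transpose_def qadj_def vec_lambda_beta qcnj.sel(1))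
  qed
  then show ?thesis by (auto simp: vec_eq_iff)
qed

definition qdiag :: "('n \<Rightarrow> real) \<Rightarrow> quat ^ 'n ^ 'n" where
  "qdiag d = (\<chi> i j. if i = j then of_real (d i) else 0)"

lemma qdiag_nth: "qdiag d $ i $ j = (if i = j then of_real (d i) else 0)"
  by (simp add: qdiag_def)

lemma cmat_qdiag: "cmat (qdiag d) = (\<chi> x y. if x = y then of_real (d (fst x)) else 0)"
  by (auto simp: vec_eq_iff cmat_def qdiag_def cq_of_real prod_eq_iff)

lemma det_cmat_qdiag: "det (cmat (qdiag (d :: 'n::finite \<Rightarrow> real))) = of_real ((\<Prod>i\<in>UNIV. d i)\<^sup>2)"
  by (subst det_diagonal)
     (simp_all add: cmat_qdiag prod_UNIV_prod UNIV_bool power2_eq_square prod.distrib)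

lemma realification_qdiag: "realification (qdiag d) = (\<chi> x y. if x = y then d (fst x) else 0)"
proof -
  have "realification (qdiag d) $ (i, a) $ (j, b) = (if (i, a) = (j, b) then d i else 0)" for i a j b
    using exhaust_4[of a] exhaust_4[of b]
    by (auto simp: realification_nth qdiag_def of_real_def)
  then show ?thesis by (auto simp: vec_eq_iff)
qed

lemma det_realification_qdiag:
  "det (realification (qdiag (d :: 'n::finite \<Rightarrow> real))) = (\<Prod>i\<in>UNIV. d i) ^ 4"
  by (subst det_diagonal)
     (simp_all add: realification_qdiag prod_UNIV_prod prod_constant flip: prod_power_distrib)

text \<open>Multiplying by a shear from the left adds multiples of row \<open>k\<close> to all other
  rows at once, so that one shear does a whole step of Gaussian elimination.\<close>

definition shear :: "'n \<Rightarrow> ('n \<Rightarrow> quat) \<Rightarrow> quat ^ 'n ^ 'n" where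
  "shear k w = (\<chi> i j. (if i = j then 1 else 0) + (if j = k \<and> i \<noteq> k then w i else 0))"

lemma shear_nth: "shear k w $ i $ j = (if i = j then 1 else if j = k then w i else 0)"
  by (simp add: shear_def)

lemma shear_mult_nth:
  "(shear k w ** A) $ i $ j = A $ i $ j + (if i = k then 0 else w i * A $ k $ j)"
proof -
  have "(shear k w ** A) $ i $ j =
      (\<Sum>l\<in>UNIV. (if l = i then A $ l $ j else 0) + (if l = k then (if i = k then 0 else w i * A $ l $ j) else 0))"
    by (auto simp: matrix_matrix_mult_def shear_nth intro!: sum.cong)
  then show ?thesis by (simp add: sum.distrib)
qed

lemma shear_add: "shear k v ** shear k w = shear k (\<lambda>i. v i + w i)"
  by (auto simp: vec_eq_iff shear_mult_nth shear_nth)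

lemma shear_0: "shear k (\<lambda>_. 0) = mat 1"
  by (auto simp: vec_eq_iff shear_nth mat_def)

lemma qdiag_mult_nth: "(qdiag d ** A) $ i $ j = d i *\<^sub>R A $ i $ j"
proof -
  have "(qdiag d ** A) $ i $ j = (\<Sum>l\<in>UNIV. if l = i then d l *\<^sub>R A $ l $ j else 0)"
    unfolding matrix_matrix_mult_def vec_lambda_beta
    by (rule sum.cong) (auto simp: qdiag_def scaleR_conv_of_real)
  then show ?thesis by simp
qed

lemma mult_qdiag_nth: "(A ** qdiag d) $ i $ j = d j *\<^sub>R A $ i $ j"
proof -
  have "(A ** qdiag d) $ i $ j = (\<Sum>l\<in>UNIV. if l = j then d l *\<^sub>R A $ i $ l else 0)"
    unfolding matrix_matrix_mult_def vec_lambda_beta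
    by (rule sum.cong) (auto simp: qdiag_def of_real_def)
  then show ?thesis by simp
qed

text \<open>Doubling the vector of a shear both squares the shear and conjugates it by a diagonal matrix;
  so a multiplicative function takes equal values at a shear and at its square.\<close>

lemma multiplicative_shear:
  fixes D :: "quat ^ 'n ^ 'n \<Rightarrow> 'a::field"
  assumes mult: "\<And>A B. D (A ** B) = D A * D B" and one: "D (mat 1) = 1"
  shows "D (shear k w) = 1"
proof -
  define G where "G = qdiag (\<lambda>i. if i = k then 2 else 1)"
  have "G ** shear k (\<lambda>i. w i + w i) = shear k w ** G"
    by (auto simp: vec_eq_iff G_def qdiag_mult_nth mult_qdiag_nth shear_nth scaleR_2)
  then have "D G * (D (shear k w) * D (shear k w)) = D (shear k w) * D G"
    by (metis mult shear_add)
  moreover have "D G \<noteq> 0"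
  proof -
    have "G ** qdiag (\<lambda>i. if i = k then 1/2 else 1) = mat 1"
      by (auto simp: vec_eq_iff G_def qdiag_mult_nth mat_def qdiag_nth scaleR_conv_of_real
          simp flip: of_real_mult)
    then show ?thesis by (metis mult one mult_zero_left zero_neq_one)
  qed
  moreover have "D (shear k w) \<noteq> 0"
    using mult[of "shear k w" "shear k (\<lambda>i. - w i)"] by (auto simp: shear_add shear_0 one)
  ultimately show ?thesis by simp
qed

lemma det_cmat_shear: "det (cmat (shear k w)) = 1"
  by (rule multiplicative_shear) (simp_all add: cmat_mult det_mul cmat_1)

lemma det_realification_shear: "det (realification (shear k w)) = 1"
  by (rule multiplicative_shear) (simp_all add: realification_mult det_mul realification_1)


section \<open>The polarised Pfaffian\<close>

text \<open>The matrix \<^term>\<open>cmat A\<close> times the standard symplectic matrix. For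
  hyperhermitian \<open>A\<close> it is antisymmetric, and its Pfaffian is the Moore determinant of
  \<open>A\<close>.\<close>

definition bform :: "quat ^ 'n ^ 'n \<Rightarrow> 'n \<times> bool \<Rightarrow> 'n \<times> bool \<Rightarrow> complex" where
  "bform A x y = (if snd y then cq (A $ fst x $ fst y) (snd x) False
                  else - cq (A $ fst x $ fst y) (snd x) True)"

text \<open>If all factors are the same antisymmetric form, this is the Pfaffian of that form up to
  the factor \<open>2 ^ n * n!\<close>; the pairs of indices matched by the identity are \<open>(k,
  False)\<close>, \<open>(k, True)\<close>.\<close>

definition asum :: "('n::finite \<Rightarrow> 'n \<times> bool \<Rightarrow> 'n \<times> bool \<Rightarrow> complex) \<Rightarrow> complex" where
  "asum X = (\<Sum>p | p permutes UNIV.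
     of_int (sign p) * (\<Prod>k\<in>UNIV. X k (p (k, False)) (p (k, True))))"

text \<open>The polarised Pfaffian: it is linear in each of the matrices, and for equal matrices it
  is the Pfaffian. It is the quaternionic mixed discriminant.\<close>

definition pmix :: "('n::finite \<Rightarrow> quat ^ 'n ^ 'n) \<Rightarrow> complex" where
  "pmix A = asum (\<lambda>k. bform (A k)) / (2 ^ CARD('n) * fact CARD('n))"

lemma asum_reindex:
  assumes "q permutes (UNIV :: ('n::finite \<times> bool) set)"
  shows "asum X = of_int (sign q) * (\<Sum>p | p permutes UNIV.
     of_int (sign p) * (\<Prod>k\<in>UNIV. X k (p (q (k, False))) (p (q (k :: 'n, True)))))"
proof -
  have "asum X = (\<Sum>p | p permutes UNIV.
     of_int (sign (p \<circ> q)) * (\<Prod>k\<in>UNIV. X k ((p \<circ> q) (k, False)) ((p \<circ> q) (k, True))))"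
    unfolding asum_def by (rule sum_permutations_compose_right[OF assms])
  also have "\<dots> = (\<Sum>p | p permutes UNIV.
     of_int (sign q) * (of_int (sign p) * (\<Prod>k\<in>UNIV. X k (p (q (k, False))) (p (q (k, True))))))"
    using assms by (intro sum.cong refl) (simp add: sign_compose permutes_imp_permutation[OF finite])
  finally show ?thesis by (simp add: sum_distrib_left)
qed

lemma asum_swap: "asum (X(k := \<lambda>x y. X k y x)) = - asum X"
proof -
  let ?q = "Transposition.transpose (k, False) (k, True)"
  have "asum X = of_int (sign ?q) * (\<Sum>p | p permutes UNIV.
     of_int (sign p) * (\<Prod>l\<in>UNIV. X l (p (?q (l, False))) (p (?q (l, True)))))"
    by (rule asum_reindex) (simp add: permutes_swap_id)
  also have "\<dots> = - asum (X(k := \<lambda>x y. X k y x))"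
    unfolding asum_def by (auto simp: sign_swap_id Transposition.transpose_def
        intro!: sum.cong prod.cong)
  finally show ?thesis by simp
qed

lemma asum_diff: "asum (X(k := \<lambda>x y. P x y - Q x y)) = asum (X(k := P)) - asum (X(k := Q))"
proof -
  have *: "(\<Prod>l\<in>UNIV. (X(k := R)) l (p (l, False)) (p (l, True)))
      = R (p (k, False)) (p (k, True)) * (\<Prod>l\<in>-{k}. X l (p (l, False)) (p (l, True)))" for R p
    by (subst prod.remove[of _ k]) (auto simp: Compl_eq_Diff_UNIV intro!: prod.cong)
  show ?thesis
    unfolding asum_def * by (simp add: algebra_simps flip: sum_subtractf)
qed

text \<open>Replacing one factor by its antisymmetrisation doubles the alternating sum, because the
  transposition of the two indices in that factor is odd.\<close>

lemma asum_antisym: "asum (\<lambda>k x y. X k x y - X k y x) = 2 ^ CARD('n) * asum (X :: 'n::finite \<Rightarrow> _)"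
proof -
  have "asum (\<lambda>k. if k \<in> S then (\<lambda>x y. X k x y - X k y x) else X k) = 2 ^ card S * asum X"
    if "finite S" for S
    using that
  proof (induction S)
    case empty
    then show ?case by simp
  next
    case (insert k S)
    let ?Y = "\<lambda>l. if l \<in> S then (\<lambda>x y. X l x y - X l y x) else X l"
    have *: "(\<lambda>l. if l \<in> insert k S then (\<lambda>x y. X l x y - X l y x) else X l)
        = ?Y(k := \<lambda>x y. X k x y - X k y x)"
      by auto
    have "?Y(k := X k) = ?Y"
      using insert by (auto simp: fun_eq_iff)
    moreover have "asum (?Y(k := \<lambda>x y. X k y x)) = - asum ?Y"
      using asum_swap[of ?Y k] insert by simp
    ultimately show ?case
      unfolding * asum_diff using insert by simp
  qed
  from this[of UNIV] show ?thesis by simp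
qed

definition pairp :: "('n \<Rightarrow> 'n) \<Rightarrow> 'n \<times> bool \<Rightarrow> 'n \<times> bool" where
  "pairp h x = (h (fst x), snd x)"

lemma pairp_permutes: "h permutes UNIV \<Longrightarrow> pairp h permutes UNIV"
  unfolding pairp_def permutes_univ by (metis prod.collapse fst_conv snd_conv)

text \<open>The permutation is the product of its restrictions to the two layers, which are conjugate
  to each other and so have the same sign.\<close>

lemma sign_pairp:
  assumes h: "h permutes (UNIV :: 'n::finite set)"
  shows "sign (pairp h) = 1"
proof -
  define layer where "layer b x = (if snd x = b then pairp h x else x)" for b and x :: "'n \<times> bool"
  define flip where "flip x = (fst x, \<not> snd x)" for x :: "'n \<times> bool"
  have inj: "h a = h b \<longleftrightarrow> a = b" for a b
    using permutes_inj[OF h] by (auto dest: injD)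
  have "inj (layer b)" "inj flip" "inj (pairp h)" for b
    by (auto simp: inj_on_def layer_def flip_def pairp_def prod_eq_iff inj split: if_splits)
  then have perm: "permutation (layer b)" "permutation flip" "permutation (pairp h)" for b
    by (auto simp: permutation finite_UNIV_inj_surj bij_def)
  have "layer True = flip \<circ> (layer False \<circ> flip)"
    by (auto simp: fun_eq_iff layer_def flip_def pairp_def)
  then have "sign (layer True) = sign flip * (sign (layer False) * sign flip)"
    using perm by (simp add: sign_compose permutation_compose)
  moreover have "pairp h = layer False \<circ> layer True"
    by (auto simp: fun_eq_iff layer_def pairp_def)
  then have "sign (pairp h) = sign (layer False) * sign (layer True)"
    using perm by (simp add: sign_compose)
  ultimately show ?thesis
    by (auto simp: sign_def split: if_splits)
qed

definition qouter :: "quat ^ 'n \<Rightarrow> quat ^ 'n ^ 'n" where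
  "qouter v = (\<chi> i j. v $ i * qcnj (v $ j))"

text \<open>The symplectic matrix turns the conjugate transpose of the second factor into its
  transpose; so a matrix of rank one gives a decomposable alternating form.\<close>

lemma cq_outer:
  "(if t then cq (p * qcnj q) s False else - cq (p * qcnj q) s True)
     = cq p s False * cq q t True - cq p s True * cq q t False"
  by (cases s; cases t; simp add: cq_def Let_def complex_eq_iff algebra_simps)

lemma bform_qouter:
  "bform (qouter v) x y = cq (v $ fst x) (snd x) False * cq (v $ fst y) (snd y) True
     - cq (v $ fst y) (snd y) False * cq (v $ fst x) (snd x) True"
  unfolding bform_def qouter_def vec_lambda_beta cq_outer by (simp only: mult.commute)

lemma bform_sum: "bform (sum A I) x y = (\<Sum>i\<in>I. bform (A i) x y)"
  by (simp add: bform_def cq_sum sum_negf)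

text \<open>All factors are antisymmetrised products of two columns. By \<open>asum_antisym\<close>
  the antisymmetrisation may be dropped, and what is left is the Leibniz formula of a
  determinant.\<close>

lemma pmix_qouter:
  "pmix (\<lambda>k. qouter (v k)) = det (cmat (\<chi> i k. v k $ i)) / fact CARD('n::finite)"
  for v :: "'n \<Rightarrow> quat ^ 'n"
proof -
  let ?V = "cmat (\<chi> i k. v k $ i)"
  have "asum (\<lambda>k. bform (qouter (v k)))
      = 2 ^ CARD('n) * asum (\<lambda>k x y. cq (v k $ fst x) (snd x) False * cq (v k $ fst y) (snd y) True)"
    unfolding asum_antisym[symmetric] bform_qouter ..
  also have "asum (\<lambda>k x y. cq (v k $ fst x) (snd x) False * cq (v k $ fst y) (snd y) True)
      = det (Finite_Cartesian_Product.transpose ?V)"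
    unfolding asum_def det_def
    by (intro sum.cong refl)
      (simp add: prod_UNIV_prod UNIV_bool Finite_Cartesian_Product.transpose_def cmat_def mult.commute)
  finally show ?thesis by (simp add: pmix_def det_transpose)
qed

lemma pmix_sum:
  "pmix (\<lambda>k. \<Sum>i\<in>UNIV. A k i) = (\<Sum>h\<in>UNIV. pmix (\<lambda>k. A k (h k)))"
  for A :: "'n::finite \<Rightarrow> 'i::finite \<Rightarrow> quat ^ 'n ^ 'n"
proof -
  have "asum (\<lambda>k. bform (\<Sum>i\<in>UNIV. A k i)) = (\<Sum>h\<in>UNIV. asum (\<lambda>k. bform (A k (h k))))"
    unfolding asum_def bform_sum prod_sum_PiE[OF finite finite]
    by (simp add: PiE_UNIV_domain sum_distrib_left) (rule sum.swap)
  then show ?thesis by (simp add: pmix_def sum_divide_distrib)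
qed

lemma mult_qadj_eq_sum_qouter: "V ** qadj V = (\<Sum>k\<in>UNIV. qouter (\<chi> i. V $ i $ k))"
  by (simp add: vec_eq_iff matrix_matrix_mult_def qadj_def qouter_def)

text \<open>Expanding \<open>V ** qadj V\<close> into the rank-one matrices of the columns of
  \<open>V\<close> turns the Pfaffian into a sum over choices of columns. A choice with a repetition
  contributes a determinant with two equal columns. A permutation of quaternionic columns is an even
  permutation of complex columns, so all permutations contribute the same determinant.\<close>

lemma pmix_mult_qadj: "pmix (\<lambda>_. V ** qadj V) = det (cmat V)" for V :: "quat ^ 'n::finite ^ 'n"
proof -
  let ?P = "{h :: 'n \<Rightarrow> 'n. h permutes UNIV}"
  have "pmix (\<lambda>_. V ** qadj V) = (\<Sum>h\<in>UNIV. det (cmat (\<chi> i k. V $ i $ h k)) / fact CARD('n))"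
    unfolding mult_qadj_eq_sum_qouter pmix_sum pmix_qouter by simp
  also have "\<dots> = (\<Sum>h\<in>?P. det (cmat (\<chi> i k. V $ i $ h k)) / fact CARD('n))"
  proof (rule sum.mono_neutral_right)
    show "\<forall>h\<in>UNIV - ?P. det (cmat (\<chi> i k. V $ i $ h k)) / fact CARD('n) = 0"
    proof (intro ballI)
      fix h :: "'n \<Rightarrow> 'n"
      assume "h \<in> UNIV - ?P"
      then have "\<not> inj h"
        using finite_UNIV_inj_surj[of h] bij_imp_permutes[of h UNIV] by (auto simp: bij_def)
      then obtain a b where "a \<noteq> b" "h a = h b" by (auto simp: inj_def)
      then have "det (cmat (\<chi> i k. V $ i $ h k)) = 0"
        by (intro det_identical_columns[of "(a, False)" "(b, False)"])
          (auto simp: column_def cmat_def vec_eq_iff)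
      then show "det (cmat (\<chi> i k. V $ i $ h k)) / fact CARD('n) = 0" by simp
    qed
  qed auto
  also have "\<dots> = (\<Sum>h\<in>?P. det (cmat V) / fact CARD('n))"
  proof (intro sum.cong refl)
    fix h assume "h \<in> ?P"
    then have "det (\<chi> x y. cmat V $ x $ pairp h y) = det (cmat V)"
      by (subst det_permute_columns) (auto simp: pairp_permutes sign_pairp)
    moreover have "(\<chi> x y. cmat V $ x $ pairp h y) = cmat (\<chi> i k. V $ i $ h k)"
      by (simp add: cmat_def pairp_def vec_eq_iff)
    ultimately show "det (cmat (\<chi> i k. V $ i $ h k)) / fact CARD('n) = det (cmat V) / fact CARD('n)" by simp
  qed
  also have "\<dots> = det (cmat V)"
    by (simp add: card_permutations[of UNIV "CARD('n)"])
  finally show ?thesis .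
qed


section \<open>Positive semidefinite matrices and the Moore determinant\<close>

definition psd :: "quat ^ 'n ^ 'n::finite \<Rightarrow> bool" where
  "psd A \<longleftrightarrow> hyperhermitian A \<and> (\<forall>v. 0 \<le> real_form A v v)"

lemma real_form_QRe_inner:
  "real_form A x y = (\<Sum>i\<in>UNIV. QRe (qcnj (x $ i) * (\<Sum>j\<in>UNIV. A $ i $ j * y $ j)))"
  by (simp only: real_form_def QRe_sum sum_distrib_left mult.assoc)

lemma real_form_add: "real_form (A + B) x y = real_form A x y + real_form B x y"
proof -
  have "(\<Sum>i\<in>UNIV. \<Sum>j\<in>UNIV. qcnj (x $ i) * (A + B) $ i $ j * y $ j)
    = (\<Sum>i\<in>UNIV. \<Sum>j\<in>UNIV. qcnj (x $ i) * A $ i $ j * y $ j) + (\<Sum>i\<in>UNIV. \<Sum>j\<in>UNIV. qcnj (x $ i) * B $ i $ j * y $ j)"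
    by (simp only: vector_add_component distrib_left distrib_right sum.distrib)
  then show ?thesis by (simp only: real_form_def plus_quat.sel)
qed

lemma real_form_scaleR: "real_form (c *\<^sub>R A) x y = c * real_form A x y"
proof -
  have "(\<Sum>i\<in>UNIV. \<Sum>j\<in>UNIV. qcnj (x $ i) * (c *\<^sub>R A) $ i $ j * y $ j)
    = c *\<^sub>R (\<Sum>i\<in>UNIV. \<Sum>j\<in>UNIV. qcnj (x $ i) * A $ i $ j * y $ j)"
    by (simp only: vector_scaleR_component mult_scaleR_left mult_scaleR_right scaleR_sum_right)
  then show ?thesis by (simp only: real_form_def scaleR_quat.sel)
qed

lemma real_form_mat1: "real_form (mat 1) v v = (norm v)\<^sup>2"
proof -
  have "real_form (mat 1) v v = (\<Sum>i\<in>UNIV. QRe (qcnj (v $ i) * (\<Sum>j\<in>UNIV. if i = j then v $ j else 0)))"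
    unfolding real_form_QRe_inner mat_def vec_lambda_beta by (intro sum.cong refl arg_cong[where f=QRe] arg_cong2[where f="(*)"]) auto
  also have "\<dots> = (\<Sum>i\<in>UNIV. inner (v $ i) (v $ i))"
    by (simp only: sum.delta' finite UNIV_I if_True inner_quat_QRe)
  finally show ?thesis by (simp only: power2_norm_eq_inner inner_vec_def)
qed

lemma real_form_congruence:
  fixes E A :: "quat ^ 'n::finite ^ 'n"
  shows "real_form (E ** A ** qadj E) v v = real_form A (qadj E *v v) (qadj E *v v)"
proof -
  define w where "w = qadj E *v v"
  have wl: "w $ l = (\<Sum>j\<in>UNIV. qadj E $ l $ j * v $ j)" for l
    by (simp only: w_def matrix_vector_mult_def vec_lambda_beta)
  have wk: "qcnj (w $ k) = (\<Sum>i\<in>UNIV. qcnj (v $ i) * E $ i $ k)" for k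
    unfolding wl by (simp only: qcnj_sum qcnj_mult qadj_def qcnj_qcnj vec_lambda_beta)
  have dist: "(\<Sum>i\<in>UNIV. f i) * a * (\<Sum>j\<in>UNIV. g j) = (\<Sum>i\<in>UNIV. \<Sum>j\<in>UNIV. f i * a * g j)"
    for f g :: "'n \<Rightarrow> quat" and a
  proof -
    have "(\<Sum>i\<in>UNIV. f i) * a = (\<Sum>i\<in>UNIV. f i * a)" by (rule sum_distrib_right)
    then show ?thesis by (simp only: sum_product)
  qed
  have rot: "(\<Sum>k\<in>UNIV. \<Sum>l\<in>UNIV. \<Sum>i\<in>UNIV. \<Sum>j\<in>UNIV. f k l i j) = (\<Sum>i\<in>UNIV. \<Sum>j\<in>UNIV. \<Sum>l\<in>UNIV. \<Sum>k\<in>UNIV. f k l i j)"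
    for f :: "'n \<Rightarrow> 'n \<Rightarrow> 'n \<Rightarrow> 'n \<Rightarrow> quat"
  proof -
    have "(\<Sum>k\<in>UNIV. \<Sum>l\<in>UNIV. \<Sum>i\<in>UNIV. \<Sum>j\<in>UNIV. f k l i j) = (\<Sum>l\<in>UNIV. \<Sum>k\<in>UNIV. \<Sum>i\<in>UNIV. \<Sum>j\<in>UNIV. f k l i j)"
      by (rule sum.swap)
    also have "\<dots> = (\<Sum>l\<in>UNIV. \<Sum>i\<in>UNIV. \<Sum>j\<in>UNIV. \<Sum>k\<in>UNIV. f k l i j)"
      by (rule sum.cong[OF refl], rule trans[OF sum.swap], rule sum.cong[OF refl], rule sum.swap)
    also have "\<dots> = (\<Sum>i\<in>UNIV. \<Sum>j\<in>UNIV. \<Sum>l\<in>UNIV. \<Sum>k\<in>UNIV. f k l i j)"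
      by (rule trans[OF sum.swap], rule sum.cong[OF refl], rule sum.swap)
    finally show ?thesis .
  qed
  have "(\<Sum>k\<in>UNIV. \<Sum>l\<in>UNIV. qcnj (w $ k) * A $ k $ l * w $ l) =
      (\<Sum>k\<in>UNIV. \<Sum>l\<in>UNIV. \<Sum>i\<in>UNIV. \<Sum>j\<in>UNIV. qcnj (v $ i) * E $ i $ k * A $ k $ l * (qadj E $ l $ j * v $ j))"
    unfolding wk unfolding wl dist ..
  also have "\<dots> = (\<Sum>i\<in>UNIV. \<Sum>j\<in>UNIV. \<Sum>l\<in>UNIV. \<Sum>k\<in>UNIV. qcnj (v $ i) * E $ i $ k * A $ k $ l * (qadj E $ l $ j * v $ j))"
    by (rule rot)
  also have "\<dots> = (\<Sum>i\<in>UNIV. \<Sum>j\<in>UNIV. qcnj (v $ i) * (E ** A ** qadj E) $ i $ j * v $ j)"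
    unfolding matrix_matrix_mult_def vec_lambda_beta sum_distrib_left sum_distrib_right
    by (simp only: mult.assoc)
  finally show ?thesis by (simp only: real_form_def w_def)
qed

lemma psd_congruence: "psd A \<Longrightarrow> psd (E ** A ** qadj E)"
  by (simp add: psd_def real_form_congruence hyperhermitian_iff qadj_mult matrix_mul_assoc)

lemma psd_mult_qadj: "psd (V ** qadj V)"
proof -
  have "psd (mat 1 :: quat ^ 'a ^ 'a)"
    unfolding psd_def real_form_mat1 by (auto simp: hyperhermitian_def mat_def)
  from psd_congruence[OF this, of V] show ?thesis by (simp add: matrix_mul_rid)
qed

lemma mult_qadj_shear_nth:
  "(A :: quat ^ 'n::finite ^ 'n) ** qadj (shear k w) = (\<chi> i j. A $ i $ j + (if j = k then 0 else A $ i $ k * qcnj (w j)))"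
proof -
  have "A ** qadj (shear k w) = qadj (shear k w ** qadj A)"
    by (simp only: qadj_mult qadj_qadj)
  then show ?thesis
    by (simp add: vec_eq_iff qadj_nth shear_mult_nth qcnj_add qcnj_mult)
qed

text \<open>On vectors supported on the coordinates \<open>k\<close> and \<open>j\<close>, with the
  coefficient at \<open>k\<close> proportional to the entry, the form is an affine function of the
  factor of proportionality. It is nonnegative only if its slope, a multiple of the squared norm of
  the entry, vanishes.\<close>

lemma psd_diag_zero:
  assumes "psd A" and 0: "A $ k $ k = 0"
  shows "A $ k $ j = 0"
proof (rule ccontr)
  assume nz: "A $ k $ j \<noteq> 0"
  with 0 have jk: "j \<noteq> k" by auto
  have herm: "A $ j $ k = qcnj (A $ k $ j)"
    using assms(1) by (metis psd_def hyperhermitian_def)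
  let ?q = "A $ k $ j" and ?c = "QRe (A $ j $ j)"
  have "0 \<le> ?c + 2 * t * inner ?q ?q" for t
  proof -
    define v where "v = (\<chi> l. if l = k then t *\<^sub>R ?q else if l = j then 1 else 0)"
    have S: "(\<Sum>l\<in>UNIV. g l * v $ l) = g k * (t *\<^sub>R ?q) + g j" for g :: "'a \<Rightarrow> quat"
    proof -
      have "(\<Sum>l\<in>UNIV. g l * v $ l) = (\<Sum>l\<in>UNIV. (if l = k then g k * (t *\<^sub>R ?q) else 0) + (if l = j then g j else 0))"
        using jk by (intro sum.cong refl) (auto simp: v_def)
      then show ?thesis by (simp add: sum.distrib)
    qed
    have "real_form A v v = (\<Sum>i\<in>UNIV. if i = k then QRe (qcnj (t *\<^sub>R ?q) * (A $ k $ k * (t *\<^sub>R ?q) + ?q))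
       else if i = j then QRe (A $ j $ k * (t *\<^sub>R ?q) + A $ j $ j) else 0)"
      unfolding real_form_QRe_inner S by (intro sum.cong refl) (auto simp: v_def)
    also have "\<dots> = (\<Sum>i\<in>UNIV. (if i = k then QRe (qcnj (t *\<^sub>R ?q) * (A $ k $ k * (t *\<^sub>R ?q) + ?q)) else 0)
       + (if i = j then QRe (A $ j $ k * (t *\<^sub>R ?q) + A $ j $ j) else 0))"
      using jk by (intro sum.cong refl) auto
    also have "\<dots> = ?c + 2 * t * inner ?q ?q"
      by (simp add: sum.distrib 0 herm inner_quat_def algebra_simps)
    finally show ?thesis using assms(1) by (metis psd_def)
  qed
  from this[of "- (?c + 1) / (2 * inner ?q ?q)"] nz show False by (simp add: field_simps)
qed

lemma shear_inverse: "shear k (\<lambda>i. - w i) ** shear k w = mat 1"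
  by (simp add: shear_add shear_0)

text \<open>One step of Gaussian elimination by a shear congruence clears a row with its column and keeps
  the cleared ones; a diagonal matrix with nonnegative entries is a square of a diagonal matrix.
  Shears have determinant one, both as complex and as real matrices, so the two determinants of the
  factor can be read off that diagonal matrix.\<close>

lemma psd_cholesky:
  fixes A :: "quat ^ 'n::finite ^ 'n"
  assumes "psd A"
  shows "\<exists>V \<delta>. A = V ** qadj V \<and> 0 \<le> \<delta> \<and> det (cmat V) = of_real \<delta> \<and> det (realification V) = \<delta>\<^sup>2"
  using assms
proof (induction "card {i. \<exists>j. j \<noteq> i \<and> A $ i $ j \<noteq> 0}" arbitrary: A rule: less_induct)
  case less
  note psd = less.prems
  then have herm: "A $ i $ j = qcnj (A $ j $ i)" for i j
    unfolding psd_def hyperhermitian_def by blast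
  have diag: "A $ i $ i = of_real (QRe (A $ i $ i))" for i
    using herm[of i i] by (simp add: quat_eq_iff of_real_def)
  have diag_nonneg: "0 \<le> QRe (A $ i $ i)" for i
    using psd real_form_axis[of A i 1 i 1] by (auto simp: psd_def dest: spec[of _ "axis i 1"])
  show ?case
  proof (cases "\<exists>k j. j \<noteq> k \<and> A $ k $ j \<noteq> 0")
    case False
    define d where "d i = sqrt (QRe (A $ i $ i))" for i
    have d2: "d i * d i = QRe (A $ i $ i)" for i
      using diag_nonneg by (simp add: d_def)
    have "qadj (qdiag d) = qdiag d"
      by (simp add: vec_eq_iff qadj_def qdiag_nth)
    moreover have "A = qdiag d ** qdiag d"
    proof -
      have "A $ i $ j = (qdiag d ** qdiag d) $ i $ j" for i j
      proof (cases "i = j")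
        case True
        then show ?thesis
          using diag[of j] by (simp only: qdiag_mult_nth qdiag_nth scaleR_conv_of_real d2 if_True simp_thms flip: of_real_mult)
      next
        case i: False
        with False have "A $ i $ j = 0" by metis
        with i show ?thesis by (simp add: qdiag_mult_nth qdiag_nth)
      qed
      then show ?thesis by (simp add: vec_eq_iff)
    qed
    moreover have "0 \<le> (\<Prod>i\<in>UNIV. d i)"
      by (intro prod_nonneg) (simp add: d_def diag_nonneg)
    ultimately show ?thesis
      by (intro exI[of _ "qdiag d"] exI[of _ "(\<Prod>i\<in>UNIV. d i)\<^sup>2"])
        (simp add: det_cmat_qdiag det_realification_qdiag flip: power_mult)
  next
    case True
    then obtain k j0 where k: "j0 \<noteq> k" "A $ k $ j0 \<noteq> 0" by blast
    with psd have "A $ k $ k \<noteq> 0" using psd_diag_zero by blast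
    define a where "a = QRe (A $ k $ k)"
    have a: "A $ k $ k = of_real a" "a \<noteq> 0"
      using diag[of k] \<open>A $ k $ k \<noteq> 0\<close> by (auto simp: a_def)
    define w where "w i = - A $ i $ k /\<^sub>R a" for i
    define B where "B = shear k w ** A ** qadj (shear k w)"
    have B_nth: "B $ i $ j = (shear k w ** A) $ i $ j
        + (if j = k then 0 else (shear k w ** A) $ i $ k * qcnj (w j))" for i j
      by (simp add: B_def mult_qadj_shear_nth)
    have B1: "B $ i $ j = A $ i $ j - (A $ i $ k * A $ k $ j) /\<^sub>R a" if "i \<noteq> k" for i j
    proof -
      have "A $ i $ k + w i * A $ k $ k = 0"
        using a by (simp add: w_def scaleR_conv_of_real[symmetric] of_real_def)
      then show ?thesis using that by (simp add: B_nth shear_mult_nth w_def)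
    qed
    have B2: "B $ k $ j = 0" if "j \<noteq> k" for j
    proof -
      have "qcnj (w j) = - A $ k $ j /\<^sub>R a"
        unfolding w_def qcnj_scaleR qcnj_minus herm[of k j] ..
      then show ?thesis using that a by (simp add: B_nth shear_mult_nth of_real_def)
    qed
    have "{i. \<exists>j. j \<noteq> i \<and> B $ i $ j \<noteq> 0} \<subset> {i. \<exists>j. j \<noteq> i \<and> A $ i $ j \<noteq> 0}"
    proof (rule psubsetI)
      show "{i. \<exists>j. j \<noteq> i \<and> B $ i $ j \<noteq> 0} \<subseteq> {i. \<exists>j. j \<noteq> i \<and> A $ i $ j \<noteq> 0}"
      proof (intro Collect_mono impI, elim exE conjE)
        fix i j assume ij: "j \<noteq> i" "B $ i $ j \<noteq> 0"
        then have "i \<noteq> k" using B2 by blast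
        with ij(2) B1[of i j] have "A $ i $ j \<noteq> 0 \<or> A $ i $ k \<noteq> 0" by auto
        with ij \<open>i \<noteq> k\<close> show "\<exists>j. j \<noteq> i \<and> A $ i $ j \<noteq> 0" by metis
      qed
      have "k \<in> {i. \<exists>j. j \<noteq> i \<and> A $ i $ j \<noteq> 0}" "k \<notin> {i. \<exists>j. j \<noteq> i \<and> B $ i $ j \<noteq> 0}"
        using k B2 by auto
      then show "{i. \<exists>j. j \<noteq> i \<and> B $ i $ j \<noteq> 0} \<noteq> {i. \<exists>j. j \<noteq> i \<and> A $ i $ j \<noteq> 0}" by blast
    qed
    then have "card {i. \<exists>j. j \<noteq> i \<and> B $ i $ j \<noteq> 0} < card {i. \<exists>j. j \<noteq> i \<and> A $ i $ j \<noteq> 0}"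
      by (intro psubset_card_mono) simp_all
    from less.hyps[OF this] psd obtain V \<delta> where V: "B = V ** qadj V" "0 \<le> \<delta>"
        "det (cmat V) = of_real \<delta>" "det (realification V) = \<delta>\<^sup>2"
      unfolding B_def by (metis psd_congruence)
    let ?E = "shear k (\<lambda>i. - w i)"
    have "A = ?E ** B ** qadj ?E"
    proof -
      have "?E ** B ** qadj ?E = (?E ** shear k w) ** A ** qadj (?E ** shear k w)"
        by (simp only: B_def qadj_mult matrix_mul_assoc)
      also have "\<dots> = A"
        by (simp add: shear_inverse matrix_mul_lid matrix_mul_rid qadj_1)
      finally show ?thesis by simp
    qed
    also have "\<dots> = (?E ** V) ** qadj (?E ** V)"
      by (simp only: V qadj_mult matrix_mul_assoc)
    finally show ?thesis
      using V by (intro exI[of _ "?E ** V"] exI[of _ \<delta>])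
        (simp add: cmat_mult det_mul det_cmat_shear realification_mult det_realification_shear)
  qed
qed

text \<open>By multilinearity the claim reduces to determinants of matrices \<open>U\<close> whose
  columns are taken from the Cholesky factors of the given matrices. By
  \<open>pmix_mult_qadj\<close> such a determinant depends only on \<open>U ** qadj U\<close>, which
  has a Cholesky factor with nonnegative determinant.\<close>

lemma psd_pmix:
  assumes "\<And>k. psd (A k)"
  shows "\<exists>r\<ge>0. pmix (A :: 'n::finite \<Rightarrow> quat ^ 'n ^ 'n) = of_real r"
proof -
  have "\<forall>k. \<exists>V. A k = V ** qadj V"
    using psd_cholesky[OF assms] by blast
  then obtain V where V: "\<And>k. A k = V k ** qadj (V k)" by metis
  have "\<exists>r\<ge>0. det (cmat (\<chi> i k. V k $ i $ h k)) = of_real r" for h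
  proof -
    let ?U = "\<chi> i k. V k $ i $ h k"
    obtain U \<delta> where "?U ** qadj ?U = U ** qadj U" "0 \<le> \<delta>" "det (cmat U) = of_real \<delta>"
      using psd_cholesky[OF psd_mult_qadj[of ?U]] by metis
    then show ?thesis using pmix_mult_qadj[of ?U] pmix_mult_qadj[of U] by auto
  qed
  then obtain r where r: "\<And>h. 0 \<le> r h" "\<And>h. det (cmat (\<chi> i k. V k $ i $ h k)) = of_real (r h)" by metis
  have "pmix A = (\<Sum>h\<in>UNIV. det (cmat (\<chi> i k. V k $ i $ h k)) / fact CARD('n))"
    unfolding V[abs_def] mult_qadj_eq_sum_qouter pmix_sum pmix_qouter by simp
  also have "\<dots> = of_real (\<Sum>h\<in>UNIV. r h / fact CARD('n))"
    by (simp add: r)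
  finally show ?thesis
    using r(1) by (intro exI[of _ "\<Sum>h\<in>UNIV. r h / fact CARD('n)"]) (simp add: sum_nonneg)
qed

lemma det_realification_psd:
  assumes "psd A"
  shows "det (realification A) = Re (pmix (\<lambda>_. A)) ^ 4"
proof -
  obtain V \<delta> where V: "A = V ** qadj V" "det (cmat V) = of_real \<delta>" "det (realification V) = \<delta>\<^sup>2"
    using psd_cholesky[OF assms] by blast
  then have "det (realification A) = (\<delta>\<^sup>2)\<^sup>2"
    by (simp add: realification_mult realification_qadj det_mul det_transpose power2_eq_square)
  moreover have "pmix (\<lambda>_. A) = of_real \<delta>"
    using V by (simp add: pmix_mult_qadj)
  ultimately show ?thesis by simp
qed

lemma pmix_mat1: "pmix (\<lambda>_. mat 1) = 1"
  using pmix_mult_qadj[of "mat 1"] by (simp add: cmat_1 matrix_mul_lid)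

text \<open>Complex-valued polynomials are handled through their real and imaginary parts.\<close>

definition cpoly :: "('a::real_normed_vector \<Rightarrow> complex) \<Rightarrow> bool" where
  "cpoly f \<longleftrightarrow> real_polynomial_function (\<lambda>x. Re (f x)) \<and> real_polynomial_function (\<lambda>x. Im (f x))"

lemma cpoly_const [intro]: "cpoly (\<lambda>x. c)"
  by (auto simp: cpoly_def)

lemma cpoly_mult [intro]: "cpoly f \<Longrightarrow> cpoly g \<Longrightarrow> cpoly (\<lambda>x. f x * g x)"
  by (auto simp: cpoly_def)

lemma cpoly_add: "cpoly f \<Longrightarrow> cpoly g \<Longrightarrow> cpoly (\<lambda>x. f x + g x)"
  by (auto simp: cpoly_def)

lemma cpoly_sum [intro]: "finite I \<Longrightarrow> (\<And>i. i \<in> I \<Longrightarrow> cpoly (f i)) \<Longrightarrow> cpoly (\<lambda>x. \<Sum>i\<in>I. f i x)"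
  by (induction I rule: finite_induct) (auto intro: cpoly_add)

lemma cpoly_prod [intro]: "finite I \<Longrightarrow> (\<And>i. i \<in> I \<Longrightarrow> cpoly (f i)) \<Longrightarrow> cpoly (\<lambda>x. \<Prod>i\<in>I. f i x)"
  by (induction I rule: finite_induct) auto

lemma linear_quat_matrix_entry:
  fixes g :: "quat \<Rightarrow> real"
  assumes "linear g"
  shows "real_polynomial_function (\<lambda>A. g (A $ i $ j))"
proof (rule real_polynomial_function.intros(1))
  have "linear (g \<circ> ((\<lambda>v. v $ j) \<circ> (\<lambda>A :: (quat, 'a) vec ^ 'b. A $ i)))"
    using assms by (intro linear_compose) (auto intro: linearI)
  then show "bounded_linear (\<lambda>A :: (quat, 'a) vec ^ 'b. g (A $ i $ j))"
    by (simp add: linear_conv_bounded_linear comp_def)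
qed

lemma cpoly_bform: "cpoly (\<lambda>A. bform A x y)"
proof -
  have lin: "linear (\<lambda>q. Re (cq q s t))" "linear (\<lambda>q. Im (cq q s t))" for s t
    by (auto intro!: linearI simp: cq_add cq_scaleR)
  then show ?thesis
    unfolding cpoly_def bform_def
    by (cases "snd y") (auto intro!: linear_quat_matrix_entry[OF lin(1)] linear_quat_matrix_entry[OF lin(2)])
qed

lemma real_polynomial_pmix: "real_polynomial_function (\<lambda>A :: quat ^ 'n ^ 'n::finite. Re (pmix (\<lambda>_. A)))"
proof -
  have "cpoly (\<lambda>A :: quat ^ 'n ^ 'n. pmix (\<lambda>_. A))"
    unfolding pmix_def asum_def divide_inverse by (intro cpoly_mult cpoly_sum cpoly_prod cpoly_bform cpoly_const) auto
  then show ?thesis unfolding cpoly_def by (rule conjunct1)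
qed

lemma real_polynomial_det_realification: "real_polynomial_function (\<lambda>A :: quat ^ 'n ^ 'n::finite. det (realification A))"
proof -
  have lin: "linear (\<lambda>q. QRe (qcnj (quat_unit a) * q * quat_unit b))" for a b
    by (auto intro!: linearI simp: distrib_left distrib_right simp del: times_quat.sel)
  have "real_polynomial_function (\<lambda>A :: quat ^ 'n ^ 'n. realification A $ r $ s)" for r s
    using linear_quat_matrix_entry[OF lin[of "snd r" "snd s"], where i = "fst r" and j = "fst s"]
    unfolding realification_nth[symmetric] prod.collapse .
  then show ?thesis unfolding det_def
    by (intro real_polynomial_function_sum real_polynomial_function.intros(2,4) real_polynomial_function_prod) auto
qed

lemma real_polynomial_on_line:
  fixes A B :: "'a::real_normed_vector"
  assumes "real_polynomial_function p"
  shows "real_polynomial_function (\<lambda>t::real. p (A + t *\<^sub>R B))"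
proof -
  have "polynomial_function (\<lambda>t::real. A + t *\<^sub>R B)"
    by (intro polynomial_function_add polynomial_function_const polynomial_function_bounded_linear
        bounded_linear_scaleR_left)
  from real_polynomial_function_compose[OF this assms] show ?thesis by (simp add: comp_def)
qed

text \<open>The difference has infinitely many zeros.\<close>

lemma real_polynomial_function_eqI:
  fixes p q :: "real \<Rightarrow> real"
  assumes "real_polynomial_function p" "real_polynomial_function q"
    and "e > 0" and eq: "\<And>t. 0 \<le> t \<Longrightarrow> t \<le> e \<Longrightarrow> p t = q t"
  shows "p t = q t"
proof -
  obtain a n where a: "(\<lambda>t. p t - q t) = (\<lambda>x. \<Sum>i\<le>n. a i * x ^ i)"
    using real_polynomial_function_diff[OF assms(1,2)] unfolding real_polynomial_function_iff_sum by blast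
  have "{0..e} \<subseteq> {x. (\<Sum>i\<le>n. a i * x ^ i) = 0}"
    using eq by (auto simp flip: fun_cong[OF a])
  moreover have "infinite {0..e}" using \<open>e > 0\<close> by simp
  ultimately have "infinite {x. (\<Sum>i\<le>n. a i * x ^ i) = 0}" using finite_subset by blast
  then have "\<forall>i\<le>n. a i = 0"
    using polyfun_finite_roots[of a n] by blast
  then show ?thesis using fun_cong[OF a, of t] by simp
qed

text \<open>Polynomial identities on the hyperhermitian matrices are carried along this segment:
  they are known near the identity matrix, and they reach \<open>A\<close> because they are
  identities in one real variable.\<close>

definition segm :: "quat ^ 'n ^ 'n::finite \<Rightarrow> real \<Rightarrow> quat ^ 'n ^ 'n" where
  "segm A t = mat 1 + t *\<^sub>R (A - mat 1)"

lemma segm_simps: "segm A 0 = mat 1" "segm A 1 = A"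
  by (simp_all add: segm_def)

lemma hyperhermitian_segm: "hyperhermitian A \<Longrightarrow> hyperhermitian (segm A t)"
proof -
  have "qadj (segm A t) = segm (qadj A) t"
    by (simp add: vec_eq_iff qadj_nth segm_def quat_eq_iff mat_def)
  then show "hyperhermitian A \<Longrightarrow> hyperhermitian (segm A t)"
    by (simp add: hyperhermitian_iff)
qed

lemma real_form_bound: "\<exists>C\<ge>0. \<forall>v. \<bar>real_form A v v\<bar> \<le> C * (norm v)\<^sup>2"
proof (intro exI[of _ "\<Sum>i\<in>UNIV. \<Sum>j\<in>UNIV. norm (A $ i $ j)"] conjI allI)
  show "0 \<le> (\<Sum>i\<in>UNIV. \<Sum>j\<in>UNIV. norm (A $ i $ j))"
    by (intro sum_nonneg) auto
  fix v :: "quat ^ 'a"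
  have QRe_le: "\<bar>QRe q\<bar> \<le> norm q" for q
    using norm_bound_Basis_le Basis_le_norm[of 1 q] by (simp add: Basis_quat_def inner_quat_def)
  have n: "norm (qcnj q) = norm q" for q
    by (simp add: norm_quat_def inner_quat_def)
  have "\<bar>real_form A v v\<bar> \<le> norm (\<Sum>i\<in>UNIV. \<Sum>j\<in>UNIV. qcnj (v $ i) * A $ i $ j * v $ j)"
    by (simp only: real_form_def QRe_le)
  also have "\<dots> \<le> (\<Sum>i\<in>UNIV. \<Sum>j\<in>UNIV. norm (A $ i $ j) * (norm v)\<^sup>2)"
  proof (intro order_trans[OF norm_sum] sum_mono order_trans[OF norm_sum])
    fix i j
    have "norm (v $ i) * norm (v $ j) \<le> norm v * norm v"
      by (rule mult_mono[OF Finite_Cartesian_Product.norm_nth_le Finite_Cartesian_Product.norm_nth_le]) auto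
    then have "norm (A $ i $ j) * (norm (v $ i) * norm (v $ j)) \<le> norm (A $ i $ j) * (norm v)\<^sup>2"
      by (intro mult_left_mono) (auto simp: power2_eq_square)
    then show "norm (qcnj (v $ i) * A $ i $ j * v $ j) \<le> norm (A $ i $ j) * (norm v)\<^sup>2"
      by (simp only: norm_mult n ac_simps)
  qed
  finally show "\<bar>real_form A v v\<bar> \<le> (\<Sum>i\<in>UNIV. \<Sum>j\<in>UNIV. norm (A $ i $ j)) * (norm v)\<^sup>2"
    by (simp add: sum_distrib_right)
qed

text \<open>At the identity matrix the form is the squared norm, and the perturbation is at most a
  multiple of it.\<close>

lemma psd_segm:
  assumes "hyperhermitian A"
  obtains e where "e > 0" "\<And>t. 0 \<le> t \<Longrightarrow> t \<le> e \<Longrightarrow> psd (segm A t)"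
proof -
  obtain C where C: "C \<ge> 0" "\<And>v. \<bar>real_form A v v\<bar> \<le> C * (norm v)\<^sup>2"
    using real_form_bound by blast
  have "psd (segm A t)" if t: "0 \<le> t" "t \<le> 1 / (1 + C)" for t
    unfolding psd_def
  proof (intro conjI allI)
    show "hyperhermitian (segm A t)" by (rule hyperhermitian_segm[OF assms])
    fix v
    have "segm A t = (1 - t) *\<^sub>R mat 1 + t *\<^sub>R A"
      by (simp add: segm_def algebra_simps)
    then have "real_form (segm A t) v v = (1 - t) * (norm v)\<^sup>2 + t * real_form A v v"
      by (simp only: real_form_add real_form_scaleR real_form_mat1)
    moreover have "t * real_form A v v \<ge> t * - (C * (norm v)\<^sup>2)"
      using C(2)[of v] t(1) by (intro mult_left_mono) auto
    moreover have "(1 - t) * (norm v)\<^sup>2 + t * - (C * (norm v)\<^sup>2) = (1 - t * (1 + C)) * (norm v)\<^sup>2"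
      by (simp add: algebra_simps)
    moreover have "t * (1 + C) \<le> 1" using t(2) C(1) by (simp add: field_simps)
    ultimately show "0 \<le> real_form (segm A t) v v" by (smt (verit) mult_nonneg_nonneg zero_le_power2)
  qed
  then show thesis using C(1) by (intro that[of "1 / (1 + C)"]) auto
qed

text \<open>On a segment that starts at the identity matrix both sides of the fourth power identity
  are polynomials, and at its beginning the matrices are positive semidefinite.\<close>

lemma moore_polynomial_pmix:
  "moore_polynomial (\<lambda>A :: quat ^ 'n ^ 'n::finite. if hyperhermitian A then Re (pmix (\<lambda>_. A)) else 0)"
proof -
  have "det (realification A) = Re (pmix (\<lambda>_. A)) ^ 4" if "hyperhermitian A" for A :: "quat ^ 'n ^ 'n"
  proof -
    obtain e where e: "e > 0" "\<And>t. 0 \<le> t \<Longrightarrow> t \<le> e \<Longrightarrow> psd (segm A t)"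
      using psd_segm[OF \<open>hyperhermitian A\<close>] by blast
    have "det (realification (segm A 1)) = Re (pmix (\<lambda>_. segm A 1)) ^ 4"
      unfolding segm_def
      by (rule real_polynomial_function_eqI[OF _ _ e(1)])
        (use e(2) in \<open>auto simp flip: segm_def intro!: det_realification_psd\<close>,
         auto simp: segm_def intro!: real_polynomial_on_line real_polynomial_det_realification
           real_polynomial_pmix real_polynomial_function_power)
    then show ?thesis by (simp add: segm_simps)
  qed
  moreover have "hyperhermitian (mat 1 :: quat ^ 'n ^ 'n)"
    by (simp add: hyperhermitian_iff)
  ultimately show ?thesis
    unfolding moore_polynomial_def using real_polynomial_pmix by (auto simp: pmix_mat1)
qed

text \<open>The fourth power determines the polynomial up to sign. Near the identity matrix the sign
  is positive, by continuity and by the normalisation; so two such polynomials agree at the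
  beginning of the segment and therefore on all of it.\<close>

lemma moore_polynomial_unique:
  assumes P: "moore_polynomial (P :: quat ^ 'n ^ 'n::finite \<Rightarrow> real)" and Q: "moore_polynomial Q"
  shows "P = Q"
proof
  fix A :: "quat ^ 'n ^ 'n"
  show "P A = Q A"
  proof (cases "hyperhermitian A")
    case False
    then show ?thesis using P Q by (simp add: moore_polynomial_def)
  next
    case True
    note h = hyperhermitian_segm[OF True]
    obtain p q where p: "real_polynomial_function p" "\<And>t. P (segm A t) = p (segm A t)"
      and q: "real_polynomial_function q" "\<And>t. Q (segm A t) = q (segm A t)"
      using P Q h unfolding moore_polynomial_def by metis
    let ?p = "\<lambda>t. p (segm A t)" and ?q = "\<lambda>t. q (segm A t)"
    have poly: "real_polynomial_function ?p" "real_polynomial_function ?q"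
      unfolding segm_def using p(1) q(1) by (auto intro: real_polynomial_on_line)
    have cont: "isCont ?p 0" "isCont ?q 0"
      using poly by (auto intro: continuous_real_polymonial_function)
    have 1: "?p 0 = 1" "?q 0 = 1"
    proof -
      have "P (mat 1) = 1" "Q (mat 1) = 1" using P Q by (simp_all only: moore_polynomial_def)
      then show "?p 0 = 1" "?q 0 = 1" using p(2)[of 0] q(2)[of 0] by (simp_all add: segm_simps)
    qed
    have "eventually (\<lambda>t. ?p t > 0 \<and> ?q t > 0) (at 0)"
      using cont 1 unfolding isCont_def by (intro eventually_conj order_tendstoD(1)[of _ 1]) auto
    then obtain d where d: "d > 0" "\<And>t. t \<noteq> 0 \<Longrightarrow> \<bar>t\<bar> < d \<Longrightarrow> ?p t > 0 \<and> ?q t > 0"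
      by (auto simp: eventually_at dist_real_def)
    have "?p 1 = ?q 1"
    proof (rule real_polynomial_function_eqI[OF poly, of "d / 2"])
      fix t assume t: "0 \<le> t" "t \<le> d / 2"
      have "?p t ^ 4 = ?q t ^ 4"
        using P Q h[of t] unfolding p(2)[symmetric] q(2)[symmetric] by (metis moore_polynomial_def)
      moreover have "?p t > 0" "?q t > 0"
        using d t 1 by (cases "t = 0"; force)+
      ultimately show "?p t = ?q t"
        by (metis less_imp_le power_eq_imp_eq_base zero_less_numeral)
    qed (use d in auto)
    then show ?thesis using p(2)[of 1] q(2)[of 1] by (simp add: segm_simps)
  qed
qed

lemma moore_det_eq:
  fixes A :: "quat ^ 'n::finite ^ 'n"
  assumes "hyperhermitian A"
  shows "moore_det A = Re (pmix (\<lambda>_. A))"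
proof -
  let ?P = "\<lambda>A :: quat ^ 'n ^ 'n. if hyperhermitian A then Re (pmix (\<lambda>_. A)) else 0"
  have "moore_det = ?P"
    unfolding moore_det_def
    using the_equality[of moore_polynomial, OF moore_polynomial_pmix moore_polynomial_unique[OF _ moore_polynomial_pmix]]
    by blast
  then have "moore_det A = ?P A" by (rule fun_cong)
  then show ?thesis unfolding if_P[OF assms] .
qed

section \<open>Mixed discriminants of real Hessians\<close>

definition dirv :: "'n::finite \<times> 4 \<Rightarrow> quat ^ 'n" where
  "dirv e = axis (fst e) (quat_unit (snd e))"

text \<open>Applied to the real Hessian matrix of a function this is the quaternionic Hessian
  matrix. A pair \<open>(i, a)\<close> stands for the real direction given by the unit
  \<open>a\<close> in coordinate \<open>i\<close>.\<close>

definition quatize :: "('n::finite \<times> 4 \<Rightarrow> 'n \<times> 4 \<Rightarrow> real) \<Rightarrow> quat ^ 'n ^ 'n" where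
  "quatize H = (\<chi> i j. \<Sum>a\<in>UNIV. \<Sum>b\<in>UNIV. H (i, a) (j, b) *\<^sub>R (quat_unit a * qcnj (quat_unit b)))"

text \<open>The entry at \<open>x\<close> in column \<open>s\<close> of the complex matrix of the
  vector in direction \<open>e\<close>.\<close>

definition dcoef :: "bool \<Rightarrow> 'n \<times> bool \<Rightarrow> 'n \<times> 4 \<Rightarrow> complex" where
  "dcoef s x e = (if fst e = fst x then cq (quat_unit (snd e)) (snd x) s else 0)"

text \<open>The coefficient of a product of Hessian entries in the mixed discriminant: the entry in
  slot \<open>k\<close> has the first direction \<open>f k\<close> and the second direction \<open>g
  k\<close>.\<close>

definition wt :: "('n::finite \<Rightarrow> 'n \<times> 4) \<Rightarrow> ('n \<Rightarrow> 'n \<times> 4) \<Rightarrow> real" where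
  "wt f g = Re (asum (\<lambda>k x y. dcoef False x (f k) * dcoef True y (g k)) / fact CARD('n))"

definition mform :: "('n::finite \<Rightarrow> 'n \<times> 4 \<Rightarrow> 'n \<times> 4 \<Rightarrow> real) \<Rightarrow> real" where
  "mform H = (\<Sum>f\<in>UNIV. \<Sum>g\<in>UNIV. wt f g * (\<Prod>k\<in>UNIV. H k (f k) (g k)))"

lemma bform_quatize:
  "bform (quatize H) x y = (\<Sum>e\<in>UNIV. \<Sum>e'\<in>UNIV. of_real (H e e') * (dcoef False x e * dcoef True y e'))
     - (\<Sum>e\<in>UNIV. \<Sum>e'\<in>UNIV. of_real (H e e') * (dcoef True x e * dcoef False y e'))"
proof -
  let ?D = "\<lambda>e e'. dcoef False x e * dcoef True y e' - dcoef True x e * dcoef False y e'"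
  let ?c = "\<lambda>a b. cq (quat_unit a) (snd x) False * cq (quat_unit b) (snd y) True
      - cq (quat_unit a) (snd x) True * cq (quat_unit b) (snd y) False"
  have "bform (quatize H) x y = (if snd y then cq (quatize H $ fst x $ fst y) (snd x) False
      else - cq (quatize H $ fst x $ fst y) (snd x) True)"
    by (simp add: bform_def)
  also have "\<dots> = (\<Sum>a\<in>UNIV. \<Sum>b\<in>UNIV. of_real (H (fst x, a) (fst y, b)) *
     (if snd y then cq (quat_unit a * qcnj (quat_unit b)) (snd x) False
      else - cq (quat_unit a * qcnj (quat_unit b)) (snd x) True))"
    by (simp add: quatize_def cq_sum cq_scaleR sum_negf)
  also have "\<dots> = (\<Sum>a\<in>UNIV. \<Sum>b\<in>UNIV. of_real (H (fst x, a) (fst y, b)) * ?c a b)"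
    unfolding cq_outer ..
  also have "\<dots> = (\<Sum>i\<in>UNIV. if i = fst x then (\<Sum>a\<in>UNIV. \<Sum>j\<in>UNIV. if j = fst y then (\<Sum>b\<in>UNIV. of_real (H (i, a) (j, b)) * ?c a b) else 0) else 0)"
    by simp
  also have "\<dots> = (\<Sum>e\<in>UNIV. \<Sum>e'\<in>UNIV. of_real (H e e') * ?D e e')"
  proof -
    have D: "?D (i, a) (j, b) = (if i = fst x then if j = fst y then ?c a b else 0 else 0)" for i a j b
      by (simp add: dcoef_def)
    have "(if i = fst x then (\<Sum>a\<in>UNIV. \<Sum>j\<in>UNIV. if j = fst y then (\<Sum>b\<in>UNIV. of_real (H (i, a) (j, b)) * ?c a b) else 0) else 0)
      = (\<Sum>a\<in>UNIV. \<Sum>j\<in>UNIV. \<Sum>b\<in>UNIV. of_real (H (i, a) (j, b)) *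
          (if i = fst x then if j = fst y then ?c a b else 0 else 0))" for i
    proof (cases "i = fst x")
      case True
      show ?thesis unfolding if_P[OF True] by (intro sum.cong refl) simp
    qed simp
    then show ?thesis unfolding sum_UNIV_prod D by (rule sum.cong[OF refl])
  qed
  finally show ?thesis by (simp add: right_diff_distrib sum_subtractf)
qed

text \<open>For symmetric \<open>H k\<close> the form \<^term>\<open>bform (quatize (H k))\<close>
  is the antisymmetrisation of one of the two halves in \<open>bform_quatize\<close>. By
  \<open>asum_antisym\<close> only this half has to be expanded, and in it the first direction is
  paired with the first index and the second direction with the second one. This separation is what
  makes the weights antisymmetric in the first directions alone.\<close>

lemma Re_pmix_quatize:
  fixes H :: "'n::finite \<Rightarrow> 'n \<times> 4 \<Rightarrow> 'n \<times> 4 \<Rightarrow> real"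
  assumes sym: "\<And>k e e'. H k e e' = H k e' e"
  shows "Re (pmix (\<lambda>k. quatize (H k))) = mform H"
proof -
  define X where "X k x y = (\<Sum>e\<in>UNIV. \<Sum>e'\<in>UNIV. of_real (H k e e') * (dcoef False x e * dcoef True y e'))"
    for k and x y :: "'n \<times> bool"
  have "bform (quatize (H k)) = (\<lambda>x y. X k x y - X k y x)" for k
  proof (intro ext)
    fix x y
    have "(\<Sum>e\<in>UNIV. \<Sum>e'\<in>UNIV. of_real (H k e e') * (dcoef True x e * dcoef False y e')) = X k y x"
      unfolding X_def by (subst sum.swap) (simp add: sym[of k] mult.commute)
    then show "bform (quatize (H k)) x y = X k x y - X k y x"
      by (simp add: bform_quatize X_def)
  qed
  then have "pmix (\<lambda>k. quatize (H k)) = asum X / fact CARD('n)"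
    by (simp add: pmix_def asum_antisym)
  also have "asum X = (\<Sum>f\<in>UNIV. \<Sum>g\<in>UNIV. of_real (\<Prod>k\<in>UNIV. H k (f k) (g k)) *
      asum (\<lambda>k x y. dcoef False x (f k) * dcoef True y (g k)))"
  proof -
    have *: "(\<Prod>k\<in>UNIV. X k (p (k, False)) (p (k, True))) = (\<Sum>f\<in>UNIV. \<Sum>g\<in>UNIV.
       (\<Prod>k\<in>UNIV. of_real (H k (f k) (g k)) * (dcoef False (p (k, False)) (f k) * dcoef True (p (k, True)) (g k))))" for p
      unfolding X_def prod_sum_PiE[OF finite finite] by (simp add: PiE_UNIV_domain)
    show ?thesis
      unfolding asum_def * sum_distrib_left
      by (subst sum.swap, rule sum.cong[OF refl], subst sum.swap, intro sum.cong refl)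
        (simp add: prod.distrib mult.left_commute)
  qed
  finally have "pmix (\<lambda>k. quatize (H k)) = (\<Sum>f\<in>UNIV. \<Sum>g\<in>UNIV. of_real (\<Prod>k\<in>UNIV. H k (f k) (g k)) *
      (asum (\<lambda>k x y. dcoef False x (f k) * dcoef True y (g k)) / fact CARD('n)))"
    by (simp only: sum_divide_distrib times_divide_eq_right)
  moreover have "Re (of_real r * z) = Re z * r" for r z by simp
  ultimately show ?thesis
    by (simp only: mform_def wt_def Re_sum)
qed

lemma prod_comp_transpose:
  "(\<Prod>m\<in>UNIV. F (Transposition.transpose k l m) m) = (\<Prod>m\<in>UNIV. F m (Transposition.transpose k l (m :: 'n::finite)))"
  by (rule prod.reindex_bij_witness[of _ "Transposition.transpose k l" "Transposition.transpose k l"]) auto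

text \<open>Exchanging two first directions has the same effect as the transposition of the two
  first indices, which is odd.\<close>

lemma wt_swap_left:
  assumes "k \<noteq> l"
  shows "wt (f \<circ> Transposition.transpose k l) g = - wt (f :: 'n::finite \<Rightarrow> _) g"
proof -
  let ?t = "Transposition.transpose k l" and ?q = "Transposition.transpose (k, False) (l, False)"
  have q: "?q (m, False) = (?t m, False)" "?q (m, True) = (m, True)" for m
    by (auto simp: Transposition.transpose_def)
  have "asum (\<lambda>k x y. dcoef False x (f k) * dcoef True y (g k)) =
    - asum (\<lambda>k x y. dcoef False x ((f \<circ> ?t) k) * dcoef True y (g k))"
    using assms prod_comp_transpose[of "\<lambda>a b. dcoef False (p (b, False)) (f a)" for p]
    by (subst asum_reindex[of ?q])
      (simp_all add: permutes_swap_id sign_swap_id asum_def q prod.distrib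
        prod_comp_transpose[of "\<lambda>a b. dcoef False (_ (b, False)) (f a)" k l])
  then show ?thesis by (simp add: wt_def)
qed

lemma wt_swap_right:
  assumes "k \<noteq> l"
  shows "wt f (g \<circ> Transposition.transpose k l) = - wt (f :: 'n::finite \<Rightarrow> _) g"
proof -
  let ?t = "Transposition.transpose k l" and ?q = "Transposition.transpose (k, True) (l, True)"
  have q: "?q (m, False) = (m, False)" "?q (m, True) = (?t m, True)" for m
    by (auto simp: Transposition.transpose_def)
  have "asum (\<lambda>k x y. dcoef False x (f k) * dcoef True y (g k)) =
    - asum (\<lambda>k x y. dcoef False x (f k) * dcoef True y ((g \<circ> ?t) k))"
    using assms
    by (subst asum_reindex[of ?q])
      (simp_all add: permutes_swap_id sign_swap_id asum_def q prod.distrib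
        prod_comp_transpose[of "\<lambda>a b. dcoef True (_ (b, True)) (g a)" k l])
  then show ?thesis by (simp add: wt_def)
qed

text \<open>The four vectors are an orthogonal basis, over the reals, of the quaternionic line
  through \<open>v\<close>, all of the length of \<open>v\<close>. For the Hessian of a function
  this is the Laplacian of its restriction to that line, up to the square of that length.\<close>

definition line_trace :: "('n::finite \<times> 4 \<Rightarrow> 'n \<times> 4 \<Rightarrow> real) \<Rightarrow> quat ^ 'n \<Rightarrow> real" where
  "line_trace H v = (\<Sum>c\<in>UNIV. \<Sum>e\<in>UNIV. \<Sum>e'\<in>UNIV. H e e' *
     (inner (dirv e) (right_mult v (qcnj (quat_unit c))) * inner (dirv e') (right_mult v (qcnj (quat_unit c)))))"

lemma inner_dirv: "inner (dirv (i, a)) x = QRe (qcnj (quat_unit a) * x $ i)"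
  by (simp add: dirv_def inner_axis' inner_quat_QRe)

text \<open>Parseval's identity for the four quaternionic units splits the real part of a product
  into the products of inner products.\<close>

lemma real_form_quatize: "real_form (quatize H) v v = line_trace H v"
proof -
  have key: "QRe (qcnj (v $ i) * (quat_unit a * qcnj (quat_unit b)) * v $ j) =
     (\<Sum>c\<in>UNIV. inner (dirv (i, a)) (right_mult v (qcnj (quat_unit c))) * inner (dirv (j, b)) (right_mult v (qcnj (quat_unit c))))"
    for i j a b
  proof -
    have l: "QRe (qcnj (v $ i) * quat_unit a * quat_unit c) = inner (dirv (i, a)) (right_mult v (qcnj (quat_unit c)))" for c
    proof -
      have "QRe (qcnj (v $ i) * quat_unit a * quat_unit c) = QRe (qcnj (qcnj (v $ i) * quat_unit a * quat_unit c))"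
        by (simp only: qcnj.sel)
      also have "\<dots> = QRe (qcnj (quat_unit c) * (qcnj (quat_unit a) * v $ i))"
        by (simp only: qcnj_mult qcnj_qcnj)
      finally show ?thesis
        unfolding inner_dirv right_mult_def vec_lambda_beta QRe_mult_commute[of "qcnj (quat_unit c)"] mult.assoc .
    qed
    have r: "QRe (qcnj (quat_unit c) * (qcnj (quat_unit b) * v $ j)) = inner (dirv (j, b)) (right_mult v (qcnj (quat_unit c)))" for c
      unfolding inner_dirv right_mult_def vec_lambda_beta QRe_mult_commute[of "qcnj (quat_unit c)"] mult.assoc ..
    show ?thesis
      using quat_unit_parseval[of "qcnj (v $ i) * quat_unit a" "qcnj (quat_unit b) * v $ j"]
      unfolding l r by (simp only: mult.assoc)
  qed
  have "real_form (quatize H) v v = (\<Sum>i\<in>UNIV. \<Sum>j\<in>UNIV. \<Sum>a\<in>UNIV. \<Sum>b\<in>UNIV.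
     H (i, a) (j, b) * QRe (qcnj (v $ i) * (quat_unit a * qcnj (quat_unit b)) * v $ j))"
    unfolding real_form_def quatize_def vec_lambda_beta
    by (simp only: sum_distrib_left sum_distrib_right QRe_sum mult_scaleR_left mult_scaleR_right scaleR_quat.sel)
  also have "\<dots> = (\<Sum>i\<in>UNIV. \<Sum>a\<in>UNIV. \<Sum>j\<in>UNIV. \<Sum>b\<in>UNIV.
     H (i, a) (j, b) * QRe (qcnj (v $ i) * (quat_unit a * qcnj (quat_unit b)) * v $ j))"
    by (rule sum.cong[OF refl], rule sum.swap)
  also have "\<dots> = (\<Sum>e\<in>UNIV. \<Sum>e'\<in>UNIV. \<Sum>c\<in>UNIV. H e e' *
     (inner (dirv e) (right_mult v (qcnj (quat_unit c))) * inner (dirv e') (right_mult v (qcnj (quat_unit c)))))"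
    unfolding sum_UNIV_prod key sum_distrib_left ..
  also have "\<dots> = (\<Sum>e\<in>UNIV. \<Sum>c\<in>UNIV. \<Sum>e'\<in>UNIV. H e e' *
     (inner (dirv e) (right_mult v (qcnj (quat_unit c))) * inner (dirv e') (right_mult v (qcnj (quat_unit c)))))"
    by (rule sum.cong[OF refl], rule sum.swap)
  also have "\<dots> = line_trace H v"
    unfolding line_trace_def by (rule sum.swap)
  finally show ?thesis .
qed

lemma hyperhermitian_quatize:
  assumes "\<And>e e'. H e e' = H e' e"
  shows "hyperhermitian (quatize H)"
proof -
  have "qcnj (quatize H $ j $ i) = quatize H $ i $ j" for i j
    unfolding quatize_def vec_lambda_beta qcnj_sum qcnj_scaleR qcnj_mult qcnj_qcnj
    by (subst sum.swap) (simp only: assms[of "(j, _)"])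
  then show ?thesis by (simp add: hyperhermitian_iff vec_eq_iff qadj_nth)
qed

lemma mform_nonneg:
  assumes "\<And>k e e'. H k e e' = H k e' e" and "\<And>k v. 0 \<le> line_trace (H k) v"
  shows "0 \<le> mform H"
proof -
  have "psd (quatize (H k))" for k
    using assms by (simp add: psd_def hyperhermitian_quatize real_form_quatize)
  then obtain r where "r \<ge> 0" "pmix (\<lambda>k. quatize (H k)) = of_real r"
    using psd_pmix[of "\<lambda>k. quatize (H k)"] by blast
  then show ?thesis using Re_pmix_quatize[of H] assms(1) by simp
qed

lemma moore_det_quatize:
  assumes "\<And>e e'. H e e' = H e' e"
  shows "moore_det (quatize H) = mform (\<lambda>_. H)"
  using assms by (simp add: moore_det_eq hyperhermitian_quatize Re_pmix_quatize)

section \<open>Differentiable functions and integration by parts\<close>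

text \<open>The directional derivative is taken from the Frechet derivative, so that it is linear in
  the direction at every point of differentiability.\<close>

definition dd :: "'a::euclidean_space \<Rightarrow> ('a \<Rightarrow> real) \<Rightarrow> 'a \<Rightarrow> real" where
  "dd v f x = frechet_derivative f (at x) v"

text \<open>Recursion over directional derivatives lets properties be proved by induction on the
  order without higher derivatives as multilinear maps.\<close>

primrec Ck :: "nat \<Rightarrow> 'a::euclidean_space set \<Rightarrow> ('a \<Rightarrow> real) \<Rightarrow> bool" where
  "Ck 0 U f \<longleftrightarrow> continuous_on U f"
| "Ck (Suc k) U f \<longleftrightarrow> (\<forall>x\<in>U. f differentiable (at x)) \<and> (\<forall>v. Ck k U (dd v f))"

lemma dd_eqI: "(f has_derivative D) (at x) \<Longrightarrow> dd v f x = D v"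
  unfolding dd_def by (metis frechet_derivative_at)

lemma has_derivative_dd: "f differentiable (at x) \<Longrightarrow> (f has_derivative (\<lambda>v. dd v f x)) (at x)"
  unfolding dd_def by (metis frechet_derivative_works eta_contract_eq)

lemma Ck_differentiable: "Ck (Suc k) U f \<Longrightarrow> x \<in> U \<Longrightarrow> (f has_derivative (\<lambda>v. dd v f x)) (at x)"
  by (simp add: has_derivative_dd)

lemma Ck_SucD: "Ck (Suc k) U f \<Longrightarrow> Ck k U f"
proof (induction k arbitrary: f)
  case 0
  then show ?case
    by (auto intro!: continuous_at_imp_continuous_on differentiable_imp_continuous_within)
qed auto

lemma Ck_mono: "Ck m U f \<Longrightarrow> k \<le> m \<Longrightarrow> Ck k U f"
  by (induction m) (auto simp: le_Suc_eq dest: Ck_SucD simp del: Ck.simps)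

lemma Ck_continuous: "Ck k U f \<Longrightarrow> continuous_on U f"
  using Ck_mono[of k U f 0] by simp

lemma Ck_subset: "Ck k U f \<Longrightarrow> V \<subseteq> U \<Longrightarrow> Ck k V f"
  by (induction k arbitrary: f) (auto intro: continuous_on_subset)

lemma dd_cong:
  assumes "open U" "x \<in> U" "\<And>y. y \<in> U \<Longrightarrow> f y = g y"
  shows "dd v f x = dd v g x"
proof -
  have "(f has_derivative D) (at x) \<longleftrightarrow> (g has_derivative D) (at x)" for D
    using assms by (metis has_derivative_transform_within_open)
  then show ?thesis by (simp add: dd_def frechet_derivative_def)
qed

lemma Ck_cong:
  assumes "open U" "\<And>y. y \<in> U \<Longrightarrow> f y = g y" "Ck k U f"
  shows "Ck k U g"
  using assms(2,3)
proof (induction k arbitrary: f g)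
  case 0
  then show ?case by (metis Ck.simps(1) continuous_on_cong)
next
  case (Suc k)
  have "g differentiable (at x)" if x: "x \<in> U" for x
  proof -
    obtain D where "(f has_derivative D) (at x)"
      using Suc.prems(2) x by (auto simp: differentiable_def)
    then have "(g has_derivative D) (at x)"
      using assms(1) x Suc.prems(1) by (rule has_derivative_transform_within_open)
    then show ?thesis by (auto simp: differentiable_def)
  qed
  moreover have "Ck k U (dd v g)" for v
  proof (rule Suc.IH)
    show "dd v f y = dd v g y" if "y \<in> U" for y
      using assms(1) that Suc.prems(1) by (rule dd_cong)
    show "Ck k U (dd v f)" using Suc.prems(2) by simp
  qed
  ultimately show ?case by simp
qed

lemma Ck_local:
  assumes "\<And>x. x \<in> U \<Longrightarrow> \<exists>V. open V \<and> x \<in> V \<and> Ck k V f"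
  shows "Ck k U f"
  using assms
proof (induction k arbitrary: f)
  case 0
  then show ?case
    by (auto intro!: continuous_at_imp_continuous_on dest!: 0) (metis continuous_on_eq_continuous_at)
next
  case (Suc k)
  have "Ck k U (dd v f)" for v
    by (rule Suc.IH) (use Suc.prems in fastforce)
  moreover have "f differentiable (at x)" if "x \<in> U" for x
    using Suc.prems[OF that] by auto
  ultimately show ?case by simp
qed

lemma dd_const: "dd v (\<lambda>x. c) x = 0"
  by (rule dd_eqI[OF has_derivative_const])

lemma dd_linear: "bounded_linear f \<Longrightarrow> dd v f x = f v"
  by (metis dd_eqI bounded_linear_imp_has_derivative)

lemma dd_add: "f differentiable (at x) \<Longrightarrow> g differentiable (at x) \<Longrightarrow> dd v (\<lambda>x. f x + g x) x = dd v f x + dd v g x"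
  by (rule dd_eqI[OF has_derivative_add[OF has_derivative_dd has_derivative_dd]])

lemma dd_mult: "f differentiable (at x) \<Longrightarrow> g differentiable (at x) \<Longrightarrow>
    dd v (\<lambda>x. f x * g x) x = f x * dd v g x + dd v f x * g x"
  by (rule dd_eqI[OF has_derivative_mult[OF has_derivative_dd has_derivative_dd]])

lemma dd_cmult: "f differentiable (at x) \<Longrightarrow> dd v (\<lambda>x. c * f x) x = c * dd v f x"
  by (subst dd_mult) (auto simp: dd_const)

lemma Ck_const: "Ck k U (\<lambda>x. c)"
proof (induction k arbitrary: c)
  case (Suc k)
  have "dd v (\<lambda>x :: 'a. c) = (\<lambda>x. 0)" for v by (simp add: fun_eq_iff dd_const)
  with Suc show ?case by simp
qed auto

lemma Ck_linear: "bounded_linear f \<Longrightarrow> Ck k U f"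
proof (cases k)
  case (Suc m)
  assume f: "bounded_linear f"
  then have "dd v f = (\<lambda>x. f v)" for v by (simp add: fun_eq_iff dd_linear)
  with f show ?thesis unfolding Suc by (simp add: Ck_const bounded_linear_imp_differentiable)
qed (simp add: linear_continuous_on)

lemma Ck_add:
  assumes U: "open U"
  shows "Ck k U f \<Longrightarrow> Ck k U g \<Longrightarrow> Ck k U (\<lambda>x. f x + g x)"
proof (induction k arbitrary: f g)
  case (Suc k)
  have "Ck k U (dd v (\<lambda>x. f x + g x))" for v
    by (rule Ck_cong[OF U _ Suc.IH[of "dd v f" "dd v g"]]) (use Suc.prems in \<open>auto simp: dd_add\<close>)
  with Suc.prems show ?case by simp
qed (auto intro: continuous_on_add)

lemma Ck_mult:
  assumes U: "open U"
  shows "Ck k U f \<Longrightarrow> Ck k U g \<Longrightarrow> Ck k U (\<lambda>x. f x * g x)"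
proof (induction k arbitrary: f g)
  case (Suc k)
  have "Ck k U (dd v (\<lambda>x. f x * g x))" for v
  proof (rule Ck_cong[OF U])
    show "Ck k U (\<lambda>x. f x * dd v g x + dd v f x * g x)"
      using Suc.prems by (intro Ck_add[OF U] Suc.IH) (auto dest: Ck_SucD simp del: Ck.simps, auto)
  qed (use Suc.prems in \<open>auto simp: dd_mult\<close>)
  with Suc.prems show ?case by simp
qed (auto intro: continuous_on_mult)

lemma Ck_cmult: "open U \<Longrightarrow> Ck k U f \<Longrightarrow> Ck k U (\<lambda>x. c * f x)"
  by (intro Ck_mult Ck_const)

lemma Ck_diff: "open U \<Longrightarrow> Ck k U f \<Longrightarrow> Ck k U g \<Longrightarrow> Ck k U (\<lambda>x. f x - g x)"
  using Ck_add[of U k f "\<lambda>x. (-1) * g x"] Ck_cmult[of U k g "-1"] by simp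

lemma Ck_sum: "open U \<Longrightarrow> (\<And>i. i \<in> I \<Longrightarrow> Ck k U (f i)) \<Longrightarrow> Ck k U (\<lambda>x. \<Sum>i\<in>I. f i x)"
  by (induction I rule: infinite_finite_induct) (auto simp: Ck_const intro: Ck_add)

lemma Ck_prod: "open U \<Longrightarrow> (\<And>i. i \<in> I \<Longrightarrow> Ck k U (f i)) \<Longrightarrow> Ck k U (\<lambda>x. \<Prod>i\<in>I. f i x)"
  by (induction I rule: infinite_finite_induct) (auto simp: Ck_const intro: Ck_mult)

lemma Ck_polynomial:
  assumes "open U" "real_polynomial_function p"
  shows "Ck k U p"
  using assms(2) by induction (auto intro: Ck_const Ck_linear Ck_add Ck_mult assms(1))

lemma dd_diff: "f differentiable (at x) \<Longrightarrow> g differentiable (at x) \<Longrightarrow> dd v (\<lambda>x. f x - g x) x = dd v f x - dd v g x"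
  by (rule dd_eqI[OF has_derivative_diff[OF has_derivative_dd has_derivative_dd]])

lemma dd_sum: "(\<And>i. i \<in> I \<Longrightarrow> f i differentiable (at x)) \<Longrightarrow> dd v (\<lambda>x. \<Sum>i\<in>I. f i x) x = (\<Sum>i\<in>I. dd v (f i) x)"
  by (rule dd_eqI[OF has_derivative_sum]) (rule has_derivative_dd)

lemma dd_prod:
  assumes "finite I" "\<And>i. i \<in> I \<Longrightarrow> f i differentiable (at x)"
  shows "dd v (\<lambda>x. \<Prod>i\<in>I. f i x) x = (\<Sum>i\<in>I. dd v (f i) x * (\<Prod>j\<in>I - {i}. f j x))"
  by (rule dd_eqI[OF has_derivative_prod]) (rule has_derivative_dd[OF assms(2)])

lemma dd_line:
  assumes "f differentiable (at (x + s *\<^sub>R v))"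
  shows "((\<lambda>s. f (x + s *\<^sub>R v)) has_real_derivative dd v f (x + s *\<^sub>R v)) (at s)"
proof -
  have "((\<lambda>s. f (x + s *\<^sub>R v)) has_derivative (\<lambda>h. dd (h *\<^sub>R v) f (x + s *\<^sub>R v))) (at s)"
  proof -
    have "((\<lambda>s. x + s *\<^sub>R v) has_derivative (\<lambda>h. h *\<^sub>R v)) (at s)"
      by (auto intro!: derivative_eq_intros)
    then show ?thesis
      by (rule has_derivative_compose[where g = f and g' = "\<lambda>w. dd w f (x + s *\<^sub>R v)"])
        (rule has_derivative_dd[OF assms])
  qed
  moreover have "dd (h *\<^sub>R v) f (x + s *\<^sub>R v) = dd v f (x + s *\<^sub>R v) * h" for h
    using linear_cmul[OF has_derivative_linear[OF has_derivative_dd[OF assms]], of h v] by simp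
  ultimately show ?thesis by (simp add: has_field_derivative_def)
qed

lemma double_mean_value:
  assumes "open U" "Ck 2 U f" "h > 0"
    and seg: "\<And>s t. 0 \<le> s \<Longrightarrow> s \<le> h \<Longrightarrow> 0 \<le> t \<Longrightarrow> t \<le> h \<Longrightarrow> x + s *\<^sub>R a + t *\<^sub>R b \<in> U"
  shows "\<exists>s t. 0 < s \<and> s < h \<and> 0 < t \<and> t < h \<and>
     f (x + h *\<^sub>R a + h *\<^sub>R b) - f (x + h *\<^sub>R a) - f (x + h *\<^sub>R b) + f x
       = h * h * dd b (dd a f) (x + s *\<^sub>R a + t *\<^sub>R b)"
proof -
  have C: "\<And>y. y \<in> U \<Longrightarrow> f differentiable (at y)" "\<And>y. y \<in> U \<Longrightarrow> dd a f differentiable (at y)"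
    using assms(2) by (auto simp: numeral_2_eq_2)
  have d1: "((\<lambda>s. f (x + s *\<^sub>R a + h *\<^sub>R b) - f (x + s *\<^sub>R a)) has_real_derivative
      dd a f (x + s *\<^sub>R a + h *\<^sub>R b) - dd a f (x + s *\<^sub>R a)) (at s)" if "0 \<le> s" "s \<le> h" for s
    using dd_line[of f "x + h *\<^sub>R b" s a] dd_line[of f x s a] C(1) seg[OF that, of h] seg[OF that, of 0] \<open>h > 0\<close>
    by (auto intro!: DERIV_diff simp: add_ac)
  obtain s where s: "0 < s" "s < h"
    "f (x + h *\<^sub>R a + h *\<^sub>R b) - f (x + h *\<^sub>R a) - (f (x + 0 *\<^sub>R a + h *\<^sub>R b) - f (x + 0 *\<^sub>R a))
      = (h - 0) * (dd a f (x + s *\<^sub>R a + h *\<^sub>R b) - dd a f (x + s *\<^sub>R a))"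
    using MVT2[OF \<open>h > 0\<close> d1] by blast
  have d2: "((\<lambda>t. dd a f (x + s *\<^sub>R a + t *\<^sub>R b)) has_real_derivative
      dd b (dd a f) (x + s *\<^sub>R a + t *\<^sub>R b)) (at t)" if "0 \<le> t" "t \<le> h" for t
    using s seg[of s t] that by (intro dd_line C(2)) auto
  obtain t where t: "0 < t" "t < h"
    "dd a f (x + s *\<^sub>R a + h *\<^sub>R b) - dd a f (x + s *\<^sub>R a + 0 *\<^sub>R b)
      = (h - 0) * dd b (dd a f) (x + s *\<^sub>R a + t *\<^sub>R b)"
    using MVT2[OF \<open>h > 0\<close> d2] by blast
  show ?thesis
    using s t by (intro exI[of _ s] exI[of _ t]) (simp add: algebra_simps)
qed

text \<open>Schwarz's theorem: a second difference is symmetric in its two increments, and by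
  \<open>double_mean_value\<close> it is a value of either mixed derivative near the point.\<close>

lemma dd_commute:
  assumes "open U" "Ck 2 U f" "x \<in> U"
  shows "dd a (dd b f) x = dd b (dd a f) x"
proof (rule ccontr)
  let ?F = "dd a (dd b f)" and ?G = "dd b (dd a f)"
  assume ne: "?F x \<noteq> ?G x"
  define e where "e = \<bar>?F x - ?G x\<bar> / 2"
  have e: "e > 0" using ne by (simp add: e_def)
  have "continuous_on U ?F" "continuous_on U ?G"
    using assms(2) by (auto simp: numeral_2_eq_2)
  then have "isCont ?F x" "isCont ?G x"
    using assms(1,3) continuous_on_eq_continuous_at by blast+
  then obtain d1 d2 where d: "d1 > 0" "\<And>y. dist y x < d1 \<Longrightarrow> \<bar>?F y - ?F x\<bar> < e"
      "d2 > 0" "\<And>y. dist y x < d2 \<Longrightarrow> \<bar>?G y - ?G x\<bar> < e"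
    using e unfolding continuous_at_eps_delta dist_real_def by metis
  obtain d3 where d3: "d3 > 0" "ball x d3 \<subseteq> U"
    using assms(1,3) open_contains_ball by blast
  define m where "m = min d1 (min d2 d3)"
  define h where "h = m / (norm a + norm b + 1)"
  have m: "m > 0" using d d3 by (simp add: m_def)
  then have h: "h > 0" unfolding h_def by (intro divide_pos_pos) (auto intro: add_nonneg_pos)
  have near: "dist (x + s *\<^sub>R a + t *\<^sub>R b) x < m" if "0 \<le> s" "s \<le> h" "0 \<le> t" "t \<le> h" for s t
  proof -
    have "dist (x + s *\<^sub>R a + t *\<^sub>R b) x \<le> s * norm a + t * norm b"
      using that norm_triangle_ineq[of "s *\<^sub>R a" "t *\<^sub>R b"] by (simp add: dist_norm add.assoc)
    also have "\<dots> \<le> h * norm a + h * norm b"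
      using that by (intro add_mono mult_right_mono) auto
    also have "\<dots> < h * (norm a + norm b + 1)"
      using h by (simp add: algebra_simps)
    also have "\<dots> = m"
      by (simp add: h_def) (metis add_nonneg_pos norm_ge_zero add_nonneg_nonneg zero_less_one less_irrefl)
    finally show ?thesis .
  qed
  have "x + s *\<^sub>R a + t *\<^sub>R b \<in> U" "x + t *\<^sub>R b + s *\<^sub>R a \<in> U" if "0 \<le> s" "s \<le> h" "0 \<le> t" "t \<le> h" for s t
    using near[OF that] d3(2) by (auto simp: m_def dist_commute add_ac)
  then obtain s t s' t' where st: "0 < s" "s < h" "0 < t" "t < h" "0 < s'" "s' < h" "0 < t'" "t' < h"
    "f (x + h *\<^sub>R a + h *\<^sub>R b) - f (x + h *\<^sub>R a) - f (x + h *\<^sub>R b) + f x = h * h * ?G (x + s *\<^sub>R a + t *\<^sub>R b)"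
    "f (x + h *\<^sub>R b + h *\<^sub>R a) - f (x + h *\<^sub>R b) - f (x + h *\<^sub>R a) + f x = h * h * ?F (x + s' *\<^sub>R b + t' *\<^sub>R a)"
    using double_mean_value[OF assms(1,2) h, of x a b] double_mean_value[OF assms(1,2) h, of x b a] by metis
  moreover have "f (x + h *\<^sub>R b + h *\<^sub>R a) = f (x + h *\<^sub>R a + h *\<^sub>R b)"
    by (simp add: add_ac)
  ultimately have "h * h * ?G (x + s *\<^sub>R a + t *\<^sub>R b) = h * h * ?F (x + s' *\<^sub>R b + t' *\<^sub>R a)"
    by linarith
  then have "?G (x + s *\<^sub>R a + t *\<^sub>R b) = ?F (x + t' *\<^sub>R a + s' *\<^sub>R b)"
    using h by (simp add: add_ac)
  moreover have "\<bar>?G (x + s *\<^sub>R a + t *\<^sub>R b) - ?G x\<bar> < e" "\<bar>?F (x + t' *\<^sub>R a + s' *\<^sub>R b) - ?F x\<bar> < e"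
    using near[of s t] near[of t' s'] st d by (auto simp: m_def)
  ultimately show False unfolding e_def by (simp add: abs_if split: if_splits)
qed

lemma Ck_zero_extend:
  assumes "open U" "closed K" "K \<subseteq> U" "Ck k U f" "\<And>x. x \<notin> K \<Longrightarrow> f x = 0"
  shows "Ck k V f"
proof (rule Ck_local)
  fix x
  have "Ck k (- K) f"
    by (rule Ck_cong[of _ "\<lambda>_. 0"]) (use assms in \<open>auto simp: Ck_const\<close>)
  moreover have "open (- K)" using assms(2) by auto
  ultimately show "\<exists>V. open V \<and> x \<in> V \<and> Ck k V f"
    using assms by (cases "x \<in> K") auto
qed

lemma dd_eq_0_outside:
  assumes "closed K" "\<And>x. x \<notin> K \<Longrightarrow> f x = 0" "x \<notin> K"
  shows "dd v f x = 0"
  using dd_cong[of "- K" x f "\<lambda>_. 0" v] assms by (auto simp: dd_const)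

lemma integrable_compact_support:
  fixes f :: "'a::euclidean_space \<Rightarrow> real"
  assumes "compact K" "continuous_on K f" "\<And>x. x \<notin> K \<Longrightarrow> f x = 0"
  shows "integrable lborel f"
proof -
  have "(\<lambda>x. indicator K x *\<^sub>R f x) = f"
    using assms(3) by (auto simp: fun_eq_iff indicator_def)
  then show ?thesis using borel_integrable_compact[OF assms(1,2)] by simp
qed

lemma integral_translate:
  fixes f :: "'a::euclidean_space \<Rightarrow> real"
  assumes "continuous_on UNIV f"
  shows "(LINT x|lborel. f (x + c)) = (LINT x|lborel. f x)"
proof -
  have "(LINT x|lborel. f x) = (LINT x|distr lborel borel ((+) c). f x)"
    by (simp add: lborel_distr_plus)
  also have "\<dots> = (LINT x|lborel. f (c + x))"
    by (rule integral_distr) (auto intro: borel_measurable_continuous_onI assms)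
  finally show ?thesis by (simp add: add.commute)
qed

text \<open>Difference quotients have integral zero by translation invariance, and they converge
  dominatedly to the derivative: by the mean value theorem they are bounded by its supremum, and
  they vanish outside the compact set swept out by the support.\<close>

lemma integral_dd_eq_0:
  assumes "Ck 1 UNIV f" "compact K" and 0: "\<And>x. x \<notin> K \<Longrightarrow> f x = 0"
  shows "(LINT x|lborel. dd v f x) = 0"
proof -
  have cl: "closed K" using assms(2) by (rule compact_imp_closed)
  have diff: "f differentiable (at x)" for x using assms(1) by auto
  have cf: "continuous_on UNIV f" using assms(1) by (rule Ck_continuous)
  have cd: "continuous_on UNIV (dd v f)" using assms(1) by auto
  have d0: "dd v f x = 0" if "x \<notin> K" for x by (rule dd_eq_0_outside[OF cl 0 that])
  obtain B where B: "\<And>x. \<bar>dd v f x\<bar> \<le> B" "B \<ge> 0"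
  proof -
    have "bounded (dd v f ` K)"
      using assms(2) cd by (intro compact_imp_bounded compact_continuous_image) (auto intro: continuous_on_subset)
    then obtain B where "\<And>x. x \<in> K \<Longrightarrow> \<bar>dd v f x\<bar> \<le> B" "B > 0"
      by (auto simp: bounded_pos)
    then show thesis using d0 by (intro that[of B]) (metis abs_zero less_imp_le, simp)
  qed
  define L where "L = (\<lambda>(x, s). x - s *\<^sub>R v) ` (K \<times> {0..1::real})"
  have L: "compact L"
    unfolding L_def using assms(2)
    by (intro compact_continuous_image compact_Times) (auto intro!: continuous_intros simp: case_prod_beta)
  have LI: "x \<in> L" if "x + s *\<^sub>R v \<in> K" "0 \<le> s" "s \<le> 1" for x s
    unfolding L_def using that by (intro image_eqI[of _ _ "(x + s *\<^sub>R v, s)"]) auto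
  define q where "q m x = (f (x + (1 / Suc m) *\<^sub>R v) - f x) / (1 / Suc m)" for m x
  have qb: "\<bar>q m x\<bar> \<le> B * indicator L x" for m x
  proof (cases "x \<in> L")
    case True
    obtain z where "f (x + (1 / Suc m) *\<^sub>R v) - f (x + 0 *\<^sub>R v) = (1 / Suc m - 0) * dd v f (x + z *\<^sub>R v)"
      using MVT2[of 0 "1 / Suc m" "\<lambda>s. f (x + s *\<^sub>R v)" "\<lambda>s. dd v f (x + s *\<^sub>R v)"] dd_line[OF diff]
      by auto
    then have "q m x = dd v f (x + z *\<^sub>R v)" by (simp add: q_def)
    with B True show ?thesis by simp
  next
    case False
    have "x + (1 / Suc m) *\<^sub>R v \<notin> K" "x \<notin> K"
      using False LI[of x "1 / Suc m"] LI[of x 0] by auto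
    then show ?thesis using 0 False by (simp add: q_def)
  qed
  have qint: "(LINT x|lborel. q m x) = 0" for m
  proof -
    have i: "integrable lborel f" using assms(2) cf 0 by (auto intro: integrable_compact_support continuous_on_subset)
    have "integrable lborel (\<lambda>x. f (x + (1 / Suc m) *\<^sub>R v))"
    proof (rule integrable_compact_support[OF L])
      show "continuous_on L (\<lambda>x. f (x + (1 / Suc m) *\<^sub>R v))"
        by (rule continuous_on_compose2[OF cf]) (auto intro!: continuous_intros)
      fix x assume "x \<notin> L"
      then have "x + (1 / Suc m) *\<^sub>R v \<notin> K"
        using LI[of x "1 / Suc m"] by auto
      then show "f (x + (1 / Suc m) *\<^sub>R v) = 0" by (rule 0)
    qed
    with i show ?thesis
      unfolding q_def by (simp add: integral_translate[OF cf])
  qed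
  have "(\<lambda>m. LINT x|lborel. q m x) \<longlonglongrightarrow> (LINT x|lborel. dd v f x)"
  proof (rule integral_dominated_convergence[where w = "\<lambda>x. B * indicator L x"])
    show "integrable lborel (\<lambda>x. B * indicator L x :: real)"
      using integrable_compact_support[OF L, of "\<lambda>x. B * indicator L x"]
      by (auto simp: indicator_def intro!: continuous_on_cong[THEN iffD2, OF refl _ continuous_on_const])
    show "dd v f \<in> borel_measurable lborel" using cd by (simp add: borel_measurable_continuous_onI)
    show "q m \<in> borel_measurable lborel" for m
    proof -
      have "continuous_on UNIV (q m)"
        unfolding q_def by (intro continuous_intros continuous_on_compose2[OF cf] cf) auto
      then show ?thesis by (simp add: borel_measurable_continuous_onI)
    qed
    show "AE x in lborel. (\<lambda>m. q m x) \<longlonglongrightarrow> dd v f x"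
    proof (rule AE_I2)
      fix x
      have "((\<lambda>s. f (x + s *\<^sub>R v)) has_real_derivative dd v f (x + 0 *\<^sub>R v)) (at 0)"
        by (rule dd_line[OF diff])
      then have "(\<lambda>s. (f (x + s *\<^sub>R v) - f x) / s) \<midarrow>0\<rightarrow> dd v f x"
        by (simp add: DERIV_def)
      moreover have "filterlim (\<lambda>m. 1 / real (Suc m)) (at 0) sequentially"
        by (rule filterlim_atI) (auto intro: LIMSEQ_inverse_real_of_nat simp: inverse_eq_divide[symmetric] simp del: of_nat_Suc)
      ultimately show "(\<lambda>m. q m x) \<longlonglongrightarrow> dd v f x"
        unfolding q_def by (rule filterlim_compose)
    qed
  qed (use qb in auto)
  then show ?thesis using qint LIMSEQ_unique[of "\<lambda>m. 0"] by auto
qed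

lemma integral_by_parts:
  assumes "open U" "compact K" "K \<subseteq> U" "Ck 1 U f" "Ck 1 U g" and 0: "\<And>x. x \<notin> K \<Longrightarrow> f x = 0"
  shows "(LINT x|lborel. dd v f x * g x) = - (LINT x|lborel. f x * dd v g x)"
proof -
  have cl: "closed K" using assms(2) by (rule compact_imp_closed)
  have C: "Ck 1 UNIV (\<lambda>x. f x * g x)"
    by (rule Ck_zero_extend[OF assms(1) cl assms(3) Ck_mult[OF assms(1,4,5)]]) (simp add: 0)
  have d0: "dd v f x = 0" if "x \<notin> K" for x by (rule dd_eq_0_outside[OF cl 0 that])
  have "dd v (\<lambda>x. f x * g x) x = f x * dd v g x + dd v f x * g x" for x
  proof (cases "x \<in> U")
    case True
    then show ?thesis using assms(4,5) by (intro dd_mult) auto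
  next
    case False
    then have "x \<notin> K" using assms(3) by auto
    then show ?thesis using dd_eq_0_outside[OF cl, of "\<lambda>x. f x * g x" x v] 0 d0 by simp
  qed
  then have "0 = (LINT x|lborel. f x * dd v g x + dd v f x * g x)"
    using integral_dd_eq_0[OF C assms(2), of v] 0 by simp
  also have "\<dots> = (LINT x|lborel. f x * dd v g x) + (LINT x|lborel. dd v f x * g x)"
  proof (rule Bochner_Integration.integral_add)
    have "continuous_on K f" "continuous_on K g" "continuous_on K (dd v f)" "continuous_on K (dd v g)"
      using assms(3-5) by (auto intro: continuous_on_subset Ck_continuous simp del: Ck.simps)
        (auto intro: continuous_on_subset)
    then show "integrable lborel (\<lambda>x. f x * dd v g x)" "integrable lborel (\<lambda>x. dd v f x * g x)"
      using 0 d0 by (auto intro!: integrable_compact_support[OF assms(2)] continuous_on_mult)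
  qed
  finally show ?thesis by simp
qed

section \<open>Mollification\<close>

lemma DERIV_pos_part_power:
  "((\<lambda>t::real. max 0 t ^ Suc (Suc k)) has_real_derivative real (Suc (Suc k)) * max 0 t ^ Suc k) (at t)"
proof -
  consider "t > 0" | "t < 0" | "t = 0" by linarith
  then show ?thesis
  proof cases
    case 1
    have "((\<lambda>t. t ^ Suc (Suc k)) has_real_derivative real (Suc (Suc k)) * t ^ Suc k) (at t)"
      by (rule DERIV_cong[OF DERIV_pow]) simp
    then have "((\<lambda>t. max 0 t ^ Suc (Suc k)) has_real_derivative real (Suc (Suc k)) * t ^ Suc k) (at t)"
      by (rule has_field_derivative_transform_within_open[of _ _ _ "{0<..}"]) (use 1 in \<open>auto simp: max_def\<close>)
    then show ?thesis using 1 by (simp add: max_def)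
  next
    case 2
    have "((\<lambda>t. max 0 t ^ Suc (Suc k)) has_real_derivative 0) (at t)"
      by (rule has_field_derivative_transform_within_open[OF DERIV_const[of 0], of "{..<0}"])
        (use 2 in \<open>auto simp: max_def\<close>)
    then show ?thesis using 2 by (simp add: max_def)
  next
    case 3
    have "(\<lambda>h::real. max 0 h ^ Suc (Suc k) / h) \<midarrow>0\<rightarrow> 0"
    proof (rule Lim_null_comparison)
      have "norm (max 0 h ^ Suc (Suc k) / h) \<le> \<bar>h\<bar> ^ Suc k" for h :: real
      proof (cases "h > 0")
        case False
        then have "max 0 h ^ Suc (Suc k) / h = 0" by simp
        then show ?thesis by (simp only: norm_zero zero_le_power abs_ge_zero)
      qed (simp add: max_def)
      then show "eventually (\<lambda>h::real. norm (max 0 h ^ Suc (Suc k) / h) \<le> \<bar>h\<bar> ^ Suc k) (at 0)"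
        by simp
      show "(\<lambda>h::real. \<bar>h\<bar> ^ Suc k) \<midarrow>0\<rightarrow> 0"
        by (rule tendsto_eq_intros refl | simp)+
    qed
    with 3 show ?thesis by (simp add: DERIV_def)
  qed
qed

lemma Ck_pos_part_power:
  assumes U: "open U" and p: "\<And>j. Ck j U p"
  shows "Ck k U (\<lambda>x. max 0 (p x) ^ Suc k)"
proof (induction k)
  case 0
  show ?case using p[of 0] by (auto intro!: continuous_intros)
next
  case (Suc k)
  have "((\<lambda>x. max 0 (p x) ^ Suc (Suc k)) has_derivative (\<lambda>v. real (Suc (Suc k)) * max 0 (p x) ^ Suc k * dd v p x)) (at x)"
    if "x \<in> U" for x
    using has_derivative_compose[OF Ck_differentiable[OF p that]
        DERIV_pos_part_power[of k "p x", unfolded has_field_derivative_def]] by simp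
  note D = this
  have "Ck k U (dd v (\<lambda>x. max 0 (p x) ^ Suc (Suc k)))" for v
  proof (rule Ck_cong[OF U])
    show "Ck k U (\<lambda>x. real (Suc (Suc k)) * (max 0 (p x) ^ Suc k * dd v p x))"
      using p[of "Suc k"] by (intro Ck_cmult Ck_mult U Suc) auto
  qed (simp add: dd_eqI[OF D] del: power_Suc)
  then show ?case using D by (auto simp: differentiable_def simp del: power_Suc)
qed

text \<open>The third power makes the function twice continuously differentiable, which is the
  regularity that cut-off functions and mollifiers need here.\<close>

definition bump :: "'a::euclidean_space \<Rightarrow> real \<Rightarrow> 'a \<Rightarrow> real" where
  "bump c r x = max 0 (r\<^sup>2 - (norm (x - c))\<^sup>2) ^ 3"

lemma polynomial_norm_sq: "real_polynomial_function (\<lambda>x. (norm (x - c))\<^sup>2)"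
  for c :: "'a::euclidean_space"
proof -
  have "(\<lambda>x. (norm (x - c))\<^sup>2) = (\<lambda>x. \<Sum>b\<in>Basis. (inner x b - inner c b) * (inner x b - inner c b))"
    by (rule ext, unfold power2_norm_eq_inner, subst euclidean_inner, simp add: inner_diff_left)
  moreover have "real_polynomial_function (\<lambda>x. \<Sum>b\<in>Basis. (inner x b - inner c b) * (inner x b - inner c b))"
    by (intro real_polynomial_function_sum real_polynomial_function.intros(4) real_polynomial_function_diff
        real_polynomial_function.intros(1,2)) (auto intro: bounded_linear_inner_left)
  ultimately show ?thesis by simp
qed

lemma Ck_bump: "Ck 2 U (bump c r)"
proof -
  have "Ck 2 UNIV (\<lambda>x. max 0 (r\<^sup>2 - (norm (x - c))\<^sup>2) ^ Suc 2)"
    by (intro Ck_pos_part_power Ck_diff Ck_const Ck_polynomial polynomial_norm_sq) auto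
  moreover have "Suc 2 = 3" by simp
  ultimately have "Ck 2 UNIV (bump c r)" unfolding bump_def[abs_def] by (simp only:)
  then show ?thesis by (rule Ck_subset) simp
qed

lemma bump_nonneg: "0 \<le> bump c r x"
  by (simp add: bump_def)

lemma bump_pos: "x \<in> ball c r \<Longrightarrow> 0 < bump c r x"
proof -
  assume "x \<in> ball c r"
  then have "(norm (x - c))\<^sup>2 < r\<^sup>2"
    by (intro power_strict_mono) (auto simp: dist_norm norm_minus_commute)
  then show ?thesis by (simp add: bump_def)
qed

lemma bump_zero: "r > 0 \<Longrightarrow> x \<notin> cball c r \<Longrightarrow> bump c r x = 0"
proof -
  assume "r > 0" "x \<notin> cball c r"
  then have "r\<^sup>2 \<le> (norm (x - c))\<^sup>2"
    by (intro power_mono) (auto simp: dist_norm norm_minus_commute)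
  then show ?thesis by (simp add: bump_def max_def)
qed

text \<open>Leibniz's rule, restated for directional derivatives.\<close>

lemma parametric_integral:
  fixes f :: "'a::euclidean_space \<Rightarrow> 'b::euclidean_space \<Rightarrow> real"
  assumes V: "open V" "convex V" and x0: "x0 \<in> V"
    and diff: "\<And>x t. x \<in> V \<Longrightarrow> t \<in> cbox a b \<Longrightarrow> (\<lambda>x. f x t) differentiable (at x)"
    and cont: "\<And>h. continuous_on (V \<times> cbox a b) (\<lambda>(x, t). dd h (\<lambda>x. f x t) x)"
    and int: "\<And>x. x \<in> V \<Longrightarrow> f x integrable_on cbox a b"
  shows "((\<lambda>x. integral (cbox a b) (f x)) has_derivative
      (\<lambda>h. integral (cbox a b) (\<lambda>t. dd h (\<lambda>x. f x t) x0))) (at x0)"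
proof -
  define fx where "fx x t = Blinfun (\<lambda>h. dd h (\<lambda>x. f x t) x)" for x t
  have fx: "blinfun_apply (fx x t) = (\<lambda>h. dd h (\<lambda>x. f x t) x)" if "x \<in> V" "t \<in> cbox a b" for x t
    unfolding fx_def using has_derivative_dd[OF diff[OF that]]
    by (intro bounded_linear_Blinfun_apply) (rule has_derivative_bounded_linear)
  have c: "continuous_on (V \<times> cbox a b) (\<lambda>(x, t). fx x t)"
  proof (rule continuous_on_blinfun_componentwise)
    fix i :: 'a
    show "continuous_on (V \<times> cbox a b) (\<lambda>p. blinfun_apply (case p of (x, t) \<Rightarrow> fx x t) i)"
      by (rule continuous_on_cong[THEN iffD1, OF refl _ cont[of i]]) (auto simp: fx)
  qed
  have "((\<lambda>x. integral (cbox a b) (f x)) has_derivative blinfun_apply (integral (cbox a b) (fx x0))) (at x0 within V)"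
    using has_derivative_dd[OF diff] x0
    by (intro leibniz_rule[OF _ int c _ V(2)]) (auto simp: fx intro: has_derivative_at_withinI)
  then have D: "((\<lambda>x. integral (cbox a b) (f x)) has_derivative blinfun_apply (integral (cbox a b) (fx x0))) (at x0)"
    unfolding at_within_open[OF x0 V(1)] .
  have "continuous_on (cbox a b) (fx x0)"
    by (rule continuous_on_compose2[OF c, of _ "\<lambda>t. (x0, t)", simplified]) (auto intro!: continuous_intros x0)
  then have "fx x0 integrable_on cbox a b" by (rule integrable_continuous)
  then have "blinfun_apply (integral (cbox a b) (fx x0)) h = integral (cbox a b) (\<lambda>t. dd h (\<lambda>x. f x t) x0)" for h
    by (simp add: blinfun_apply_integral fx x0 cong: integral_cong)
  then have "blinfun_apply (integral (cbox a b) (fx x0)) = (\<lambda>h. integral (cbox a b) (\<lambda>t. dd h (\<lambda>x. f x t) x0))"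
    by (rule ext)
  with D show ?thesis by simp
qed

text \<open>The cube contains the ball of the same radius, and integrals of continuous functions
  over it are Henstock-Kurzweil integrals over a box.\<close>

definition rbox :: "real \<Rightarrow> 'a::euclidean_space set" where
  "rbox d = cbox (- (d *\<^sub>R One)) (d *\<^sub>R One)"

lemma mem_rbox: "x \<in> rbox d \<longleftrightarrow> (\<forall>b\<in>Basis. \<bar>inner x b\<bar> \<le> d)"
  by (auto simp: rbox_def mem_box abs_le_iff; smt (verit))

lemma norm_rbox: "x \<in> rbox d \<Longrightarrow> norm x \<le> d * DIM('a)" for x :: "'a::euclidean_space"
  using norm_le_l1[of x] sum_bounded_above[of Basis "\<lambda>b. \<bar>inner x b\<bar>" d]
  by (auto simp: mem_rbox mult.commute)

text \<open>The mollification of \<open>g\<close> at scale \<open>d\<close>: an average of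
  \<open>g\<close> near \<open>x\<close> with the bump as weight.\<close>

definition conv :: "real \<Rightarrow> ('a::euclidean_space \<Rightarrow> real) \<Rightarrow> 'a \<Rightarrow> real" where
  "conv d g x = integral (rbox d) (\<lambda>y. bump 0 d y * g (x + y)) / integral (rbox d) (bump (0 :: 'a) d)"

lemma bump_zero_box:
  assumes "d > 0" "x \<notin> rbox d"
  shows "bump 0 d x = 0"
proof (rule bump_zero[OF assms(1)])
  show "x \<notin> cball 0 d"
    using assms(2) Basis_le_norm[of _ x] by (auto simp: mem_rbox) (meson order_trans)
qed

lemma integral_bump_pos: "d > 0 \<Longrightarrow> 0 < integral (rbox d) (bump (0 :: 'a::euclidean_space) d)"
proof -
  assume d: "d > 0"
  have c: "continuous_on (rbox d) (bump (0 :: 'a) d)"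
    using Ck_continuous[OF Ck_bump] .
  have "(0 :: 'a) \<in> box (- (d *\<^sub>R One)) (d *\<^sub>R One)" "(0 :: 'a) \<in> rbox d"
    using d by (auto simp: mem_box rbox_def)
  moreover have "bump (0 :: 'a) d 0 > 0" using d by (intro bump_pos) simp
  ultimately have "integral (rbox d) (bump (0 :: 'a) d) \<noteq> 0"
    using integral_cbox_eq_0_iff[of "- (d *\<^sub>R One)" "d *\<^sub>R One" "bump (0 :: 'a) d"] c bump_nonneg
    unfolding rbox_def by (metis empty_iff less_irrefl)
  moreover have "0 \<le> integral (rbox d) (bump (0 :: 'a) d)"
    using c by (intro integral_nonneg) (auto simp: bump_nonneg rbox_def intro: integrable_continuous)
  ultimately show ?thesis by simp
qed

lemma dd_shift: "g differentiable (at (x + y)) \<Longrightarrow> dd h (\<lambda>x. g (x + y)) x = dd h g (x + y)"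
  by (rule dd_eqI, rule has_derivative_compose[where g = g and f = "\<lambda>x. x + y", OF _ has_derivative_dd])
    (auto intro!: derivative_eq_intros)

lemma conv_derivative:
  fixes g :: "'a::euclidean_space \<Rightarrow> real"
  assumes U: "open U" "Ck 1 U g" and d: "d > 0"
    and x: "x \<in> W" and W: "open W" "\<And>x y. x \<in> W \<Longrightarrow> y \<in> rbox d \<Longrightarrow> x + y \<in> U"
  shows "(conv d g has_derivative (\<lambda>h. conv d (dd h g) x)) (at x)"
proof -
  obtain r where r: "r > 0" "ball x r \<subseteq> W"
    using W(1) x open_contains_ball by blast
  have diff: "(\<lambda>x. g (x + y)) differentiable (at z)" if "z \<in> ball x r" "y \<in> rbox d" for z y
  proof -
    have g: "(g has_derivative (\<lambda>v. dd v g (z + y))) (at (z + y))"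
      using U(2) W(2) r(2) that by (auto intro!: has_derivative_dd)
    have "((\<lambda>x. g (x + y)) has_derivative (\<lambda>v. dd v g (z + y))) (at z)"
    proof -
      have "((\<lambda>x. x + y) has_derivative (\<lambda>v. v)) (at z)" by (auto intro!: derivative_eq_intros)
      from has_derivative_compose[OF this g] show ?thesis .
    qed
    then show ?thesis by (auto simp: differentiable_def)
  qed
  have ddf: "dd h (\<lambda>x. bump 0 d y * g (x + y)) z = bump 0 d y * dd h g (z + y)"
    if "z \<in> ball x r" "y \<in> rbox d" for h z y
  proof -
    have "g differentiable (at (z + y))" using U(2) W(2) r(2) that by auto
    then show ?thesis using diff[OF that] by (simp add: dd_cmult dd_shift)
  qed
  have cb: "continuous_on S (bump 0 d)" for S :: "'a set"
    using Ck_continuous[OF Ck_bump] .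
  have cg: "continuous_on U (dd h g)" "continuous_on U g" for h
    using U(2) Ck_continuous[OF U(2)] by auto
  have "((\<lambda>x. integral (rbox d) (\<lambda>y. bump 0 d y * g (x + y))) has_derivative
      (\<lambda>h. integral (rbox d) (\<lambda>y. dd h (\<lambda>x. bump 0 d y * g (x + y)) x))) (at x)"
    unfolding rbox_def
  proof (rule parametric_integral[where V = "ball x r"])
    fix z y :: 'a assume zy: "z \<in> ball x r" "y \<in> cbox (- (d *\<^sub>R One)) (d *\<^sub>R One)"
    show "(\<lambda>x. bump 0 d y * g (x + y)) differentiable (at z)"
      using diff[of z y] zy by (simp add: rbox_def)
  next
    fix h
    have "continuous_on (ball x r \<times> rbox d) (\<lambda>p. bump 0 d (snd p) * dd h g (fst p + snd p))"
      using W(2) r(2) by (intro continuous_on_mult continuous_on_compose2[OF cb[of UNIV]] continuous_on_compose2[OF cg(1)])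
        (auto intro!: continuous_intros)
    then show "continuous_on (ball x r \<times> cbox (- (d *\<^sub>R One)) (d *\<^sub>R One)) (\<lambda>(z, y). dd h (\<lambda>x. bump 0 d y * g (x + y)) z)"
      by (rule continuous_on_cong[THEN iffD1, rotated 2]) (auto simp: ddf rbox_def)
  next
    fix z assume z: "z \<in> ball x r"
    have "continuous_on (rbox d) (\<lambda>y. bump 0 d y * g (z + y))"
      using W(2) r(2) z by (intro continuous_on_mult cb continuous_on_compose2[OF cg(2)]) (auto intro!: continuous_intros)
    then show "(\<lambda>y. bump 0 d y * g (z + y)) integrable_on cbox (- (d *\<^sub>R One)) (d *\<^sub>R One)"
      unfolding rbox_def by (rule integrable_continuous)
  qed (use r in auto)
  then have "((\<lambda>x. integral (rbox d) (\<lambda>y. bump 0 d y * g (x + y))) has_derivative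
      (\<lambda>h. integral (rbox d) (\<lambda>y. bump 0 d y * dd h g (x + y)))) (at x)"
    using r(1) by (simp add: ddf cong: integral_cong)
  then show ?thesis
    unfolding conv_def[abs_def] divide_inverse by (rule has_derivative_mult_left)
qed

text \<open>Mollification gains one derivative. Substituting \<open>z = x + y\<close> moves the
  point of differentiation from \<open>g\<close> into the bump; near \<open>x\<close> the integral
  may be taken over the fixed box \<open>cbox A B\<close>, where the bumps around all nearby points
  have their supports.\<close>

lemma conv_Ck_1:
  assumes U: "continuous_on U g" and d: "d > 0"
    and W: "open W" "\<And>x y. x \<in> W \<Longrightarrow> y \<in> rbox (2 * d) \<Longrightarrow> x + y \<in> U"
  shows "Ck 1 W (conv d g)"
proof (rule Ck_local)
  fix x assume x: "x \<in> W"
  define A where "A = x - (2 * d) *\<^sub>R One"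
  define B where "B = x + (2 * d) *\<^sub>R One"
  have box: "z \<in> cbox A B \<longleftrightarrow> z - x \<in> rbox (2 * d)" for z
    by (auto simp: A_def B_def mem_rbox mem_box algebra_simps abs_le_iff; smt (verit))
  then have BU: "cbox A B \<subseteq> U" using W(2)[OF x] by (metis add.commute diff_add_cancel subsetI)
  define V where "V = ball x d"
  have near: "z \<in> cbox A B" if "y \<in> V" "z - y \<in> rbox d" for y z
    unfolding box mem_rbox
  proof
    fix b :: 'a assume b: "b \<in> Basis"
    have "\<bar>inner (y - x) b\<bar> \<le> d"
      using Basis_le_norm[OF b, of "y - x"] that(1) by (auto simp: V_def dist_norm norm_minus_commute)
    moreover have "\<bar>inner (z - y) b\<bar> \<le> d" using that(2) b by (auto simp: mem_rbox)
    ultimately show "\<bar>inner (z - x) b\<bar> \<le> 2 * d" by (simp add: inner_diff_left)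
  qed
  let ?f = "\<lambda>y z. bump 0 d (z - y) * g z"
  have C1: "Ck 1 UNIV (bump (0::'a) d)" by (rule Ck_mono[OF Ck_bump]) simp
  have bd: "((\<lambda>y. bump 0 d (z - y)) has_derivative (\<lambda>h. - dd h (bump 0 d) (z - y))) (at y)" for y z :: 'a
  proof -
    have D: "(bump 0 d has_derivative (\<lambda>h. dd h (bump 0 d) (z - y))) (at (z - y))"
      using C1 by (intro has_derivative_dd) auto
    have "((\<lambda>y. z - y) has_derivative (\<lambda>h. - h)) (at y)" by (auto intro!: derivative_eq_intros)
    from has_derivative_compose[OF this D] show ?thesis
      using linear_neg[OF has_derivative_linear[OF D]] by simp
  qed
  have fd: "((\<lambda>y. ?f y z) has_derivative (\<lambda>h. - dd h (bump 0 d) (z - y) * g z)) (at y)" for y z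
    by (rule has_derivative_eq_rhs[OF has_derivative_mult_left[OF bd]]) simp
  have cb: "continuous_on S (bump 0 d)" "continuous_on S (dd h (bump 0 d))" for S :: "'a set" and h
    using C1 Ck_continuous[OF C1] by (auto intro: continuous_on_subset)
  have cg: "continuous_on (cbox A B) g" using U BU by (rule continuous_on_subset)
  have cont: "continuous_on (V \<times> cbox A B) (\<lambda>(y, z). - dd h (bump 0 d) (z - y) * g z)" for h
    unfolding case_prod_beta
    by (intro continuous_on_mult continuous_on_minus continuous_on_compose2[OF cb(2)[of UNIV]] continuous_on_compose2[OF cg])
      (auto intro!: continuous_intros)
  have D: "((\<lambda>y. integral (cbox A B) (?f y)) has_derivative
      (\<lambda>h. integral (cbox A B) (\<lambda>z. - dd h (bump 0 d) (z - y) * g z))) (at y)" if "y \<in> V" for y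
  proof -
    have "((\<lambda>y. integral (cbox A B) (?f y)) has_derivative
      (\<lambda>h. integral (cbox A B) (\<lambda>z. dd h (\<lambda>y. ?f y z) y))) (at y)"
    proof (rule parametric_integral[of V])
      show "continuous_on (V \<times> cbox A B) (\<lambda>(y, z). dd h (\<lambda>y. ?f y z) y)" for h
        using cont[of h] unfolding dd_eqI[OF fd] .
      show "?f y integrable_on cbox A B" for y
        by (intro integrable_continuous continuous_on_mult continuous_on_compose2[OF cb(1)[of UNIV]] cg)
          (auto intro!: continuous_intros)
    qed (use that fd in \<open>auto simp: V_def differentiable_def\<close>)
    then show ?thesis unfolding dd_eqI[OF fd] .
  qed
  have eq: "conv d g y = integral (cbox A B) (?f y) / integral (rbox d) (bump (0 :: 'a) d)" if "y \<in> V" for y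
  proof -
    have sub: "cbox (- (d *\<^sub>R One) + y) (d *\<^sub>R One + y) \<subseteq> cbox A B"
    proof
      fix z assume "z \<in> cbox (- (d *\<^sub>R One) + y) (d *\<^sub>R One + y)"
      then have "z - y \<in> rbox d" by (auto simp: mem_rbox mem_box inner_diff_left inner_add_left abs_le_iff; smt (verit))
      then show "z \<in> cbox A B" using near that by blast
    qed
    have "integral (rbox d) (\<lambda>u. bump 0 d u * g (y + u)) = integral (cbox (- (d *\<^sub>R One) + y) (d *\<^sub>R One + y)) (?f y)"
      unfolding rbox_def integral_shift_cbox_plus[symmetric] by (simp add: comp_def)
    also have "\<dots> = integral (cbox A B) (?f y)"
    proof -
      let ?S = "cbox (- (d *\<^sub>R One) + y) (d *\<^sub>R One + y)"
      have "?f y z = 0" if "z \<notin> ?S" for z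
      proof -
        have "z - y \<notin> rbox d"
          using that by (auto simp: mem_rbox mem_box inner_diff_left inner_add_left abs_le_iff; smt (verit))
        then show ?thesis using bump_zero_box[OF d, of "z - y"] by simp
      qed
      then have "?f y = (\<lambda>z. if z \<in> ?S then ?f y z else 0)" by auto
      then have "integral (cbox A B) (?f y) = integral (cbox A B) (\<lambda>z. if z \<in> ?S then ?f y z else 0)"
        by (rule arg_cong)
      also have "\<dots> = integral ?S (?f y)"
        unfolding integral_restrict_Int Int_absorb2[OF sub] ..
      finally show ?thesis ..
    qed
    finally show ?thesis by (simp add: conv_def)
  qed
  have V: "open V" "x \<in> V" using d by (auto simp: V_def)
  have "Ck 1 V (conv d g)"
  proof (rule Ck_cong[OF V(1)])
    let ?I = "\<lambda>y. integral (cbox A B) (?f y)"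
    have "continuous_on V (dd h ?I)" for h
      using integral_continuous_on_param[OF cont[of h]]
      by (rule continuous_on_cong[THEN iffD1, rotated 2]) (auto simp: dd_eqI[OF D])
    then have "Ck 1 V ?I" using D by (auto simp: differentiable_def)
    then show "Ck 1 V (\<lambda>y. (1 / integral (rbox d) (bump (0 :: 'a) d)) * ?I y)"
      by (rule Ck_cmult[OF V(1)])
  qed (simp add: eq)
  with V show "\<exists>V. open V \<and> x \<in> V \<and> Ck 1 V (conv d g)" by blast
qed

text \<open>Mollification commutes with derivatives, so the gain of one derivative holds at every
  order.\<close>

lemma conv_Ck:
  assumes U: "open U" and d: "d > 0"
    and W: "open W" "\<And>x y. x \<in> W \<Longrightarrow> y \<in> rbox (2 * d) \<Longrightarrow> x + y \<in> U"
  shows "Ck m U g \<Longrightarrow> Ck (Suc m) W (conv d g)"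
proof (induction m arbitrary: g)
  case 0
  then show ?case using conv_Ck_1[of U g d W] d W by simp
next
  case (Suc m)
  have W': "x + y \<in> U" if "x \<in> W" "y \<in> rbox d" for x y
    using W(2)[OF that(1), of y] that(2) d by (force simp: mem_rbox)
  have D: "(conv d g has_derivative (\<lambda>h. conv d (dd h g) x)) (at x)" if "x \<in> W" for x
    using conv_derivative[OF U Ck_mono[OF Suc.prems] d that W(1) W'] by simp
  have "Ck (Suc m) W (dd v (conv d g))" for v
    by (rule Ck_cong[OF W(1) _ Suc.IH[of "dd v g"]]) (use Suc.prems in \<open>auto simp: dd_eqI[OF D]\<close>)
  then show ?case using D by (subst Ck.simps) (auto simp: differentiable_def simp del: Ck.simps)
qed

lemma conv_close:
  assumes d: "d > 0" and c: "continuous_on ((+) x ` rbox d) g"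
    and e: "\<And>y. y \<in> rbox d \<Longrightarrow> \<bar>g (x + y) - g x\<bar> \<le> e"
  shows "\<bar>conv d g x - g x\<bar> \<le> e"
proof -
  let ?N = "integral (rbox d) (bump (0::'a) d)"
  have N: "?N > 0" by (rule integral_bump_pos[OF d])
  have cb: "continuous_on (rbox d) (bump (0::'a) d)" using Ck_continuous[OF Ck_bump] .
  have cg: "continuous_on (rbox d) (\<lambda>y. g (x + y))"
    by (rule continuous_on_compose2[OF c]) (auto intro!: continuous_intros)
  have "continuous_on (rbox d) (\<lambda>y. bump 0 d y * g (x + y))" "continuous_on (rbox d) (\<lambda>y :: 'a. bump 0 d y * c)" for c
    by (intro continuous_on_mult cb cg continuous_on_const)+
  then have i: "(\<lambda>y. bump 0 d y * g (x + y)) integrable_on rbox d" "(\<lambda>y :: 'a. bump 0 d y * c) integrable_on rbox d" for c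
    unfolding rbox_def by (auto intro: integrable_continuous)
  have "integral (rbox d) (\<lambda>y. bump 0 d y * g (x + y)) - g x * ?N = integral (rbox d) (\<lambda>y. bump 0 d y * g (x + y) - bump 0 d y * g x)"
    using i by (simp add: Henstock_Kurzweil_Integration.integral_diff integral_mult_left mult.commute)
  also have "\<bar>\<dots>\<bar> \<le> integral (rbox d) (\<lambda>y :: 'a. bump 0 d y * e)"
    unfolding real_norm_def[symmetric]
  proof (rule Henstock_Kurzweil_Integration.integral_norm_bound_integral)
    fix y :: 'a assume "y \<in> rbox d"
    from mult_left_mono[OF e[OF this] bump_nonneg[of 0 d y]]
    show "norm (bump 0 d y * g (x + y) - bump 0 d y * g x) \<le> bump 0 d y * e"
      by (simp add: abs_mult bump_nonneg flip: right_diff_distrib)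
  qed (use i in \<open>auto intro: integrable_diff\<close>)
  also have "\<dots> = e * ?N" by (simp add: mult.commute)
  finally have *: "\<bar>integral (rbox d) (\<lambda>y. bump 0 d y * g (x + y)) - g x * ?N\<bar> \<le> e * ?N" .
  have "conv d g x - g x = (integral (rbox d) (\<lambda>y. bump 0 d y * g (x + y)) - g x * ?N) / ?N"
    using N by (simp add: conv_def field_simps)
  then have "\<bar>conv d g x - g x\<bar> = \<bar>integral (rbox d) (\<lambda>y. bump 0 d y * g (x + y)) - g x * ?N\<bar> / ?N"
    using N by (simp only: abs_divide abs_of_pos)
  also have "\<dots> \<le> e * ?N / ?N"
    using * N by (intro divide_right_mono) auto
  finally show ?thesis using N by simp
qed

text \<open>The second derivatives of a mollification are mollified second derivatives, and these
  are uniformly continuous on a compact neighbourhood of \<open>K\<close>.\<close>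

lemma smooth_approximation:
  fixes u :: "'a::euclidean_space \<Rightarrow> real"
  assumes \<Omega>: "open \<Omega>" and u: "Ck 2 \<Omega> u" and K: "compact K" "K \<subseteq> \<Omega>" and \<eta>: "\<eta> > 0" and E: "finite E"
  shows "\<exists>U w. open U \<and> K \<subseteq> U \<and> U \<subseteq> \<Omega> \<and> Ck 3 U w \<and>
     (\<forall>x\<in>K. \<forall>a\<in>E. \<forall>b\<in>E. \<bar>dd a (dd b w) x - dd a (dd b u) x\<bar> \<le> \<eta>)"
proof -
  obtain \<delta> where \<delta>: "\<delta> > 0" "(\<Union>x\<in>K. cball x \<delta>) \<subseteq> \<Omega>"
    using compact_subset_open_imp_cball_epsilon_subset[OF K(1) \<Omega> K(2)] by blast
  define K' where "K' = {x + y | x y. x \<in> K \<and> y \<in> cball 0 \<delta>}"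
  have K': "compact K'" unfolding K'_def by (intro compact_sums K compact_cball)
  have K'\<Omega>: "K' \<subseteq> \<Omega>" using \<delta> by (force simp: K'_def dist_norm)
  have cont: "continuous_on \<Omega> (dd a (dd b u))" for a b
    using u by (auto simp: numeral_2_eq_2)
  have "\<exists>r>0. \<forall>x\<in>K'. \<forall>y\<in>K'. dist y x < r \<longrightarrow> dist (dd a (dd b u) y) (dd a (dd b u) x) < \<eta>" for a b
    using compact_uniformly_continuous[OF continuous_on_subset[OF cont K'\<Omega>] K'] \<eta>
    unfolding uniformly_continuous_on_def by blast
  then obtain r where r: "\<And>a b. r a b > 0"
    "\<And>a b x y. x \<in> K' \<Longrightarrow> y \<in> K' \<Longrightarrow> dist y x < r a b \<Longrightarrow> dist (dd a (dd b u) y) (dd a (dd b u) x) < \<eta>"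
    by metis
  define m where "m = Min (insert (\<delta> / 2) ((\<lambda>(a, b). r a b) ` (E \<times> E)))"
  have m: "m > 0" "m \<le> \<delta> / 2" "\<And>a b. a \<in> E \<Longrightarrow> b \<in> E \<Longrightarrow> m \<le> r a b"
  proof -
    have fin: "finite (insert (\<delta> / 2) ((\<lambda>(a, b). r a b) ` (E \<times> E)))" using E by simp
    show "m > 0" unfolding m_def using fin \<delta>(1) r(1) by (subst Min_gr_iff) auto
    show "m \<le> \<delta> / 2" unfolding m_def by (rule Min_le[OF fin]) simp
    show "m \<le> r a b" if "a \<in> E" "b \<in> E" for a b
      unfolding m_def by (rule Min_le[OF fin]) (use that in force)
  qed
  define d where "d = m / (4 * DIM('a))"
  have d: "d > 0" using m by (simp add: d_def)
  have dn: "norm y \<le> m / 2" if "y \<in> rbox (2 * d)" for y :: 'a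
    using norm_rbox[OF that] by (simp add: d_def)
  have rb: "rbox d \<subseteq> (rbox (2 * d) :: 'a set)" using d by (force simp: mem_rbox)
  define W where "W = (\<Union>x\<in>K. ball x (\<delta> / 2))"
  have W: "open W" "K \<subseteq> W" "W \<subseteq> \<Omega>"
  proof -
    have "ball x (\<delta> / 2) \<subseteq> cball x \<delta>" for x using \<delta>(1) by auto
    then show "W \<subseteq> \<Omega>" using \<delta>(2) unfolding W_def by blast
  qed (use \<delta>(1) in \<open>auto simp: W_def\<close>)
  have WU: "x + y \<in> \<Omega>" if x: "x \<in> W" and y: "y \<in> rbox (2 * d)" for x y
  proof -
    obtain k where "k \<in> K" "dist k x < \<delta> / 2" using x by (auto simp: W_def)
    moreover have "dist x (x + y) \<le> \<delta> / 2" using dn[OF y] m by (simp add: dist_norm)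
    ultimately have "x + y \<in> cball k \<delta>"
      using dist_triangle[of k "x + y" x] by simp
    with \<delta>(2) \<open>k \<in> K\<close> show ?thesis by blast
  qed
  have WU': "x + y \<in> \<Omega>" if "x \<in> W" "y \<in> rbox d" for x y
    using WU that rb by blast
  have "Ck 3 W (conv d u)" using conv_Ck[OF \<Omega> d W(1) WU u] by (simp add: eval_nat_numeral)
  moreover have "\<bar>dd a (dd b (conv d u)) x - dd a (dd b u) x\<bar> \<le> \<eta>" if x: "x \<in> K" and ab: "a \<in> E" "b \<in> E" for x a b
  proof -
    have C1: "Ck 1 \<Omega> u" by (rule Ck_mono[OF u]) simp
    have C2: "Ck 1 \<Omega> (dd b u)" using u by (auto simp: numeral_2_eq_2)
    have xW: "x \<in> W" using x W by auto
    have "dd b (conv d u) y = conv d (dd b u) y" if "y \<in> W" for y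
      by (rule dd_eqI[OF conv_derivative[OF \<Omega> C1 d that W(1) WU']])
    then have "dd a (dd b (conv d u)) x = dd a (conv d (dd b u)) x"
      by (rule dd_cong[OF W(1) xW])
    also have "\<dots> = conv d (dd a (dd b u)) x"
      by (rule dd_eqI[OF conv_derivative[OF \<Omega> C2 d xW W(1) WU']])
    finally have eq: "dd a (dd b (conv d u)) x = conv d (dd a (dd b u)) x" .
    show ?thesis unfolding eq
    proof (rule conv_close[OF d])
      show "continuous_on ((+) x ` rbox d) (dd a (dd b u))"
        using WU'[OF xW] by (intro continuous_on_subset[OF cont]) auto
      fix y :: 'a assume y: "y \<in> rbox d"
      then have n: "norm y \<le> m / 2" using dn rb by blast
      have K'I: "x + z \<in> K'" if "norm z \<le> \<delta>" for z
        using x that by (auto simp: K'_def)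
      have "x \<in> K'" "x + y \<in> K'"
        using K'I[of 0] K'I[of y] n m \<delta>(1) by auto
      moreover have "dist (x + y) x < r a b" using n m(1) m(3)[OF ab] by (simp add: dist_norm)
      ultimately show "\<bar>dd a (dd b u) (x + y) - dd a (dd b u) x\<bar> \<le> \<eta>"
        using r(2)[of x "x + y" a b] by (simp add: dist_real_def)
    qed
  qed
  ultimately show ?thesis using W by blast
qed

section \<open>Integration by parts for mixed discriminants\<close>

definition hess :: "(quat ^ 'n::finite \<Rightarrow> real) \<Rightarrow> quat ^ 'n \<Rightarrow> 'n \<times> 4 \<Rightarrow> 'n \<times> 4 \<Rightarrow> real" where
  "hess u x e e' = dd (dirv e) (dd (dirv e') u) x"

text \<open>The density of the mixed Monge-Ampere measure of the functions \<open>u k\<close>; if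
  they all equal \<open>f\<close>, it is the Moore determinant of the quaternionic Hessian matrix of
  \<open>f\<close>.\<close>

definition mixed :: "('n::finite \<Rightarrow> quat ^ 'n \<Rightarrow> real) \<Rightarrow> quat ^ 'n \<Rightarrow> real" where
  "mixed u x = mform (\<lambda>k. hess (u k) x)"

lemma sum_eq_0_if_swap_negates:
  fixes F :: "('n \<Rightarrow> 'e) \<Rightarrow> real"
  assumes "\<And>f. F (f \<circ> Transposition.transpose k l) = - F f"
  shows "(\<Sum>f\<in>UNIV. F f) = 0"
proof -
  let ?t = "\<lambda>f :: 'n \<Rightarrow> 'e. f \<circ> Transposition.transpose k l"
  have "(\<Sum>f\<in>UNIV. F f) = (\<Sum>f\<in>UNIV. F (?t f))"
    by (rule sum.reindex_bij_witness[of _ ?t ?t]) (auto simp: comp_assoc)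
  then show ?thesis by (simp add: assms sum_negf)
qed

text \<open>The mixed discriminant is linear in the second derivatives of \<open>u m\<close>; as in
  the expansion of a determinant along a row, its coefficients are sums of these products.\<close>

definition cofactor ::
  "'n \<Rightarrow> ('n::finite \<Rightarrow> quat ^ 'n \<Rightarrow> real) \<Rightarrow> ('n \<Rightarrow> 'n \<times> 4) \<Rightarrow> ('n \<Rightarrow> 'n \<times> 4) \<Rightarrow> quat ^ 'n \<Rightarrow> real" where
  "cofactor m u f g x = (\<Prod>k\<in>-{m}. hess (u k) x (f k) (g k))"

lemma mixed_cofactor:
  "mixed u x = (\<Sum>f\<in>UNIV. \<Sum>g\<in>UNIV. wt f g * (hess (u m) x (f m) (g m) * cofactor m u f g x))"
  unfolding mixed_def mform_def cofactor_def Compl_eq_Diff_UNIV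
  by (intro sum.cong refl arg_cong2[where f = "(*)"] prod.remove) auto

lemma cofactor_upd [simp]: "cofactor m (u(m := v)) = cofactor m u"
  by (intro ext) (simp add: cofactor_def)

lemma Ck_hess: "Ck (Suc (Suc k)) U u \<Longrightarrow> Ck k U (\<lambda>x. hess u x e e')"
  by (simp add: hess_def)

lemma Ck_cofactor:
  assumes "open U" "\<And>k. k \<noteq> m \<Longrightarrow> Ck (Suc (Suc j)) U (u k)"
  shows "Ck j U (cofactor m u f g)"
  unfolding cofactor_def[abs_def] by (intro Ck_prod Ck_hess assms) auto

lemma Ck_3_Suc: "Ck 3 U u \<Longrightarrow> Ck (Suc (Suc 1)) U u"
  by (simp add: eval_nat_numeral)

lemma dd_cofactor:
  assumes U: "open U" "x \<in> U" and u: "\<And>k. k \<noteq> m \<Longrightarrow> Ck 3 U (u k)"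
  shows "dd v (cofactor m u f g) x = (\<Sum>l\<in>-{m}. dd v (\<lambda>x. hess (u l) x (f l) (g l)) x *
     (\<Prod>j\<in>-{m}-{l}. hess (u j) x (f j) (g j)))"
proof -
  have "(\<lambda>x. hess (u l) x (f l) (g l)) differentiable (at x)" if "l \<noteq> m" for l
    using Ck_hess[OF Ck_3_Suc[OF u[OF that]]] U(2) by simp
  then show ?thesis
    unfolding cofactor_def[abs_def] by (subst dd_prod) auto
qed

text \<open>The third derivatives are symmetric, the weights are antisymmetric: so the
  cofactors of the mixed discriminant are divergence free, in the first slot and in the second.\<close>

lemma divergence_free_left:
  fixes u :: "'n::finite \<Rightarrow> quat ^ 'n \<Rightarrow> real"
  assumes U: "open U" "x \<in> U" and u: "\<And>k. k \<noteq> m \<Longrightarrow> Ck 3 U (u k)"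
  shows "(\<Sum>f\<in>UNIV. wt f g * dd (dirv (f m)) (cofactor m u f g) x) = 0"
proof -
  let ?T = "\<lambda>f l. dd (dirv (f m)) (\<lambda>x. hess (u l) x (f l) (g l)) x * (\<Prod>j\<in>-{m}-{l}. hess (u j) x (f j) (g j))"
  have "(\<Sum>f\<in>UNIV. wt f g * ?T f l) = 0" if l: "l \<in> -{m}" for l
  proof (rule sum_eq_0_if_swap_negates[of _ m l])
    fix f :: "'n \<Rightarrow> 'n \<times> 4"
    let ?f = "f \<circ> Transposition.transpose m l"
    have C: "Ck 2 U (dd (dirv (g l)) (u l))"
      using u[of l] l by (simp add: eval_nat_numeral)
    have "?f m = f l" "?f l = f m" by auto
    moreover have "?f j = f j" if "j \<in> -{m}-{l}" for j
      using that by (auto simp: Transposition.transpose_def)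
    ultimately have "?T ?f l = ?T f l"
      using dd_commute[OF U(1) C U(2), of "dirv (f l)" "dirv (f m)"] by (simp add: hess_def)
    then show "wt ?f g * ?T ?f l = - (wt f g * ?T f l)"
      using wt_swap_left[of m l f g] l by simp
  qed
  then have 0: "(\<Sum>l\<in>-{m}. \<Sum>f\<in>UNIV. wt f g * ?T f l) = 0" by simp
  have "(\<Sum>f\<in>UNIV. wt f g * dd (dirv (f m)) (cofactor m u f g) x) = (\<Sum>f\<in>UNIV. \<Sum>l\<in>-{m}. wt f g * ?T f l)"
    using dd_cofactor[OF U, of m u] u by (simp add: sum_distrib_left)
  also have "\<dots> = 0" unfolding 0[symmetric] by (rule sum.swap)
  finally show ?thesis .
qed

lemma divergence_free_right:
  fixes u :: "'n::finite \<Rightarrow> quat ^ 'n \<Rightarrow> real"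
  assumes U: "open U" "x \<in> U" and u: "\<And>k. k \<noteq> m \<Longrightarrow> Ck 3 U (u k)"
  shows "(\<Sum>g\<in>UNIV. wt f g * dd (dirv (g m)) (cofactor m u f g) x) = 0"
proof -
  let ?T = "\<lambda>g l. dd (dirv (g m)) (\<lambda>x. hess (u l) x (f l) (g l)) x * (\<Prod>j\<in>-{m}-{l}. hess (u j) x (f j) (g j))"
  have "(\<Sum>g\<in>UNIV. wt f g * ?T g l) = 0" if l: "l \<in> -{m}" for l
  proof (rule sum_eq_0_if_swap_negates[of _ m l])
    fix g :: "'n \<Rightarrow> 'n \<times> 4"
    let ?g = "g \<circ> Transposition.transpose m l"
    have u3: "Ck 3 U (u l)" using u[of l] l by simp
    then have C2: "Ck 2 U (u l)" by (rule Ck_mono) simp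
    have C: "Ck 2 U (dd (dirv (f l)) (u l))" using u3 by (simp add: eval_nat_numeral)
    have eq: "dd c (dd (dirv (f l)) (dd b (u l))) x = dd c (dd b (dd (dirv (f l)) (u l))) x" for b c
      by (rule dd_cong[OF U]) (rule dd_commute[OF U(1) C2])
    have "?g m = g l" "?g l = g m" by auto
    moreover have "?g j = g j" if "j \<in> -{m}-{l}" for j
      using that by (auto simp: Transposition.transpose_def)
    ultimately have "?T ?g l = ?T g l"
      using dd_commute[OF U(1) C U(2), of "dirv (g l)" "dirv (g m)"] by (simp add: hess_def eq)
    then show "wt f ?g * ?T ?g l = - (wt f g * ?T g l)"
      using wt_swap_right[of m l f g] l by simp
  qed
  then have 0: "(\<Sum>l\<in>-{m}. \<Sum>g\<in>UNIV. wt f g * ?T g l) = 0" by simp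
  have "(\<Sum>g\<in>UNIV. wt f g * dd (dirv (g m)) (cofactor m u f g) x) = (\<Sum>g\<in>UNIV. \<Sum>l\<in>-{m}. wt f g * ?T g l)"
    using dd_cofactor[OF U, of m u] u by (simp add: sum_distrib_left)
  also have "\<dots> = 0" unfolding 0[symmetric] by (rule sum.swap)
  finally show ?thesis .
qed

lemma integral_mixed:
  fixes u :: "'n::finite \<Rightarrow> quat ^ 'n \<Rightarrow> real"
  assumes int: "\<And>f g. integrable lborel (\<lambda>x. \<phi> x * (hess (u m) x (f m) (g m) * cofactor m u f g x))"
  shows "(LINT x|lborel. \<phi> x * mixed u x) = (\<Sum>f\<in>UNIV. \<Sum>g\<in>UNIV. wt f g *
     (LINT x|lborel. \<phi> x * (hess (u m) x (f m) (g m) * cofactor m u f g x)))"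
proof -
  have "(LINT x|lborel. \<phi> x * mixed u x) = (LINT x|lborel. (\<Sum>f\<in>UNIV. \<Sum>g\<in>UNIV. wt f g *
      (\<phi> x * (hess (u m) x (f m) (g m) * cofactor m u f g x))))"
    unfolding mixed_cofactor[of _ _ m] by (simp add: sum_distrib_left mult.left_commute)
  also have "\<dots> = (\<Sum>f\<in>UNIV. \<Sum>g\<in>UNIV. wt f g *
     (LINT x|lborel. \<phi> x * (hess (u m) x (f m) (g m) * cofactor m u f g x)))"
    using int by (simp add: Bochner_Integration.integral_sum)
  finally show ?thesis .
qed

text \<open>Two integrations by parts move both derivatives from \<open>u m\<close> to
  \<open>\<phi>\<close>. In each of them a derivative also falls on the cofactor, and these terms
  cancel in the sum because the cofactors are divergence free. The third derivatives in the
  cancelling terms are the reason for the assumption of class \<open>Ck 3\<close>.\<close>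

lemma mixed_by_parts_smooth:
  fixes u :: "'n::finite \<Rightarrow> quat ^ 'n \<Rightarrow> real"
  assumes U: "open U" and K: "compact K" "K \<subseteq> U"
    and \<phi>: "Ck 2 U \<phi>" "\<And>x. x \<notin> K \<Longrightarrow> \<phi> x = 0"
    and um: "Ck 2 U (u m)" and u: "\<And>k. k \<noteq> m \<Longrightarrow> Ck 3 U (u k)"
  shows "(LINT x|lborel. \<phi> x * mixed u x) = (LINT x|lborel. u m x * mixed (u(m := \<phi>)) x)"
proof -
  let ?R = "cofactor m u"
  have cl: "closed K" using K(1) by (rule compact_imp_closed)
  have CR: "Ck 1 U (?R f g)" for f g by (rule Ck_cofactor[OF U]) (rule Ck_3_Suc[OF u])
  have C\<phi>: "Ck 1 U \<phi>" "Ck 1 U (dd v \<phi>)" for v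
    using Ck_mono[OF \<phi>(1), of 1] \<phi>(1) by (simp_all add: numeral_2_eq_2)
  have Cu: "Ck 1 U (u m)" "Ck 1 U (dd v (u m))" for v
    using Ck_mono[OF um, of 1] um by (simp_all add: numeral_2_eq_2)
  have \<phi>0: "dd v \<phi> x = 0" "dd w (dd v \<phi>) x = 0" if "x \<notin> K" for v w x
    using dd_eq_0_outside[OF cl] \<phi>(2) that by metis+
  have cont: "continuous_on K h" if "Ck k U h" for k and h :: "quat ^ 'n \<Rightarrow> real"
    using Ck_continuous[OF that] K(2) by (rule continuous_on_subset)
  have contd: "continuous_on K (dd v h)" if "Ck 1 U h" for v and h :: "quat ^ 'n \<Rightarrow> real"
    using cont[of 0 "dd v h"] that by simp
  note conts = cont[OF C\<phi>(1)] cont[OF C\<phi>(2)] cont[OF Cu(1)] cont[OF Cu(2)] cont[OF CR]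
    contd[OF C\<phi>(1)] contd[OF C\<phi>(2)] contd[OF Cu(1)] contd[OF Cu(2)] contd[OF CR]
  have int: "integrable lborel h" if "continuous_on K h" "\<And>x. x \<notin> K \<Longrightarrow> h x = 0" for h :: "quat ^ 'n \<Rightarrow> real"
    using integrable_compact_support[OF K(1)] that by blast
  \<comment> \<open>The integral with one derivative on either function, where the two integrations by parts meet.\<close>
  define P where "P f g = (LINT x|lborel. dd (dirv (f m)) \<phi> x * ?R f g x * dd (dirv (g m)) (u m) x)" for f g
  have 1: "(LINT x|lborel. \<phi> x * (hess (u m) x (f m) (g m) * ?R f g x)) =
      - P f g - (LINT x|lborel. \<phi> x * dd (dirv (g m)) (u m) x * dd (dirv (f m)) (?R f g) x)" for f g
  proof -
    have "(LINT x|lborel. dd (dirv (f m)) (\<lambda>x. \<phi> x * ?R f g x) x * dd (dirv (g m)) (u m) x)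
      = - (LINT x|lborel. (\<phi> x * ?R f g x) * dd (dirv (f m)) (dd (dirv (g m)) (u m)) x)"
      by (rule integral_by_parts[OF U K Ck_mult[OF U C\<phi>(1) CR] Cu(2)]) (simp add: \<phi>(2))
    moreover have "dd (dirv (f m)) (\<lambda>x. \<phi> x * ?R f g x) x * dd (dirv (g m)) (u m) x =
       dd (dirv (f m)) \<phi> x * ?R f g x * dd (dirv (g m)) (u m) x +
       \<phi> x * dd (dirv (g m)) (u m) x * dd (dirv (f m)) (?R f g) x" for x
    proof (cases "x \<in> K")
      case True
      then have "x \<in> U" using K(2) by auto
      then show ?thesis
        using C\<phi>(1) CR[of f g] by (subst dd_mult) (auto simp: algebra_simps)
    next
      case False
      then show ?thesis
        using dd_eq_0_outside[OF cl, of "\<lambda>x. \<phi> x * ?R f g x" x] \<phi>(2) \<phi>0 by simp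
    qed
    moreover have "(LINT x|lborel. dd (dirv (f m)) \<phi> x * ?R f g x * dd (dirv (g m)) (u m) x +
       \<phi> x * dd (dirv (g m)) (u m) x * dd (dirv (f m)) (?R f g) x) = P f g +
       (LINT x|lborel. \<phi> x * dd (dirv (g m)) (u m) x * dd (dirv (f m)) (?R f g) x)"
      unfolding P_def
      by (intro Bochner_Integration.integral_add int continuous_on_mult conts) (simp_all add: \<phi>(2) \<phi>0)
    ultimately show ?thesis by (simp add: hess_def mult.assoc mult.commute mult.left_commute)
  qed
  have 2: "(LINT x|lborel. u m x * (hess \<phi> x (f m) (g m) * ?R f g x)) =
      - P f g - (LINT x|lborel. dd (dirv (f m)) \<phi> x * u m x * dd (dirv (g m)) (?R f g) x)" for f g
  proof -
    have "(LINT x|lborel. dd (dirv (g m)) (\<lambda>x. dd (dirv (f m)) \<phi> x * ?R f g x) x * u m x)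
      = - (LINT x|lborel. (dd (dirv (f m)) \<phi> x * ?R f g x) * dd (dirv (g m)) (u m) x)"
      by (rule integral_by_parts[OF U K Ck_mult[OF U C\<phi>(2) CR] Cu(1)]) (simp add: \<phi>0)
    moreover have "dd (dirv (g m)) (\<lambda>x. dd (dirv (f m)) \<phi> x * ?R f g x) x * u m x =
       u m x * (hess \<phi> x (f m) (g m) * ?R f g x) +
       dd (dirv (f m)) \<phi> x * u m x * dd (dirv (g m)) (?R f g) x" for x
    proof (cases "x \<in> K")
      case True
      then have "x \<in> U" using K(2) by auto
      then show ?thesis
        using C\<phi>(2) CR[of f g] dd_commute[OF U \<phi>(1), of x "dirv (g m)" "dirv (f m)"]
        by (subst dd_mult) (auto simp: algebra_simps hess_def)
    next
      case False
      then show ?thesis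
        using dd_eq_0_outside[OF cl, of "\<lambda>x. dd (dirv (f m)) \<phi> x * ?R f g x" x] \<phi>0 by (simp add: hess_def)
    qed
    moreover have "(LINT x|lborel. u m x * (hess \<phi> x (f m) (g m) * ?R f g x) +
       dd (dirv (f m)) \<phi> x * u m x * dd (dirv (g m)) (?R f g) x) =
       (LINT x|lborel. u m x * (hess \<phi> x (f m) (g m) * ?R f g x)) +
       (LINT x|lborel. dd (dirv (f m)) \<phi> x * u m x * dd (dirv (g m)) (?R f g) x)"
      unfolding hess_def
      by (intro Bochner_Integration.integral_add int continuous_on_mult conts) (simp_all add: \<phi>0)
    ultimately show ?thesis by (simp add: P_def)
  qed
  have 3: "(\<Sum>f\<in>UNIV. \<Sum>g\<in>UNIV. wt f g *
      (LINT x|lborel. \<phi> x * dd (dirv (g m)) (u m) x * dd (dirv (f m)) (?R f g) x)) = 0"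
  proof -
    have "(\<Sum>f\<in>UNIV. \<Sum>g\<in>UNIV. wt f g *
        (LINT x|lborel. \<phi> x * dd (dirv (g m)) (u m) x * dd (dirv (f m)) (?R f g) x)) =
      (LINT x|lborel. (\<Sum>f\<in>UNIV. \<Sum>g\<in>UNIV. wt f g * (\<phi> x * dd (dirv (g m)) (u m) x * dd (dirv (f m)) (?R f g) x)))"
    proof -
      have i: "integrable lborel (\<lambda>x. \<phi> x * dd (dirv (g m)) (u m) x * dd (dirv (f m)) (?R f g) x)" for f g
        by (intro int continuous_on_mult conts) (simp add: \<phi>(2))
      then show ?thesis by (simp add: Bochner_Integration.integral_sum)
    qed
    also have "(\<lambda>x. \<Sum>f\<in>UNIV. \<Sum>g\<in>UNIV. wt f g * (\<phi> x * dd (dirv (g m)) (u m) x * dd (dirv (f m)) (?R f g) x)) = (\<lambda>x. 0)"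
    proof
      fix x
      show "(\<Sum>f\<in>UNIV. \<Sum>g\<in>UNIV. wt f g * (\<phi> x * dd (dirv (g m)) (u m) x * dd (dirv (f m)) (?R f g) x)) = 0"
      proof (cases "x \<in> K")
        case True
        then have x: "x \<in> U" using K(2) by auto
        have "(\<Sum>f\<in>UNIV. wt f g * (\<phi> x * dd (dirv (g m)) (u m) x * dd (dirv (f m)) (?R f g) x)) =
           \<phi> x * dd (dirv (g m)) (u m) x * (\<Sum>f\<in>UNIV. wt f g * dd (dirv (f m)) (?R f g) x)" for g
          by (simp add: sum_distrib_left mult_ac)
        then show ?thesis
          by (subst sum.swap) (simp add: divergence_free_left[OF U x u])
      qed (simp add: \<phi>(2))
    qed
    finally show ?thesis by simp
  qed
  have 4: "(\<Sum>f\<in>UNIV. \<Sum>g\<in>UNIV. wt f g *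
      (LINT x|lborel. dd (dirv (f m)) \<phi> x * u m x * dd (dirv (g m)) (?R f g) x)) = 0"
  proof -
    have "(\<Sum>f\<in>UNIV. \<Sum>g\<in>UNIV. wt f g *
        (LINT x|lborel. dd (dirv (f m)) \<phi> x * u m x * dd (dirv (g m)) (?R f g) x)) =
      (LINT x|lborel. (\<Sum>f\<in>UNIV. \<Sum>g\<in>UNIV. wt f g * (dd (dirv (f m)) \<phi> x * u m x * dd (dirv (g m)) (?R f g) x)))"
    proof -
      have i: "integrable lborel (\<lambda>x. dd (dirv (f m)) \<phi> x * u m x * dd (dirv (g m)) (?R f g) x)" for f g
        by (intro int continuous_on_mult conts) (simp add: \<phi>0)
      then show ?thesis by (simp add: Bochner_Integration.integral_sum)
    qed
    also have "(\<lambda>x. \<Sum>f\<in>UNIV. \<Sum>g\<in>UNIV. wt f g * (dd (dirv (f m)) \<phi> x * u m x * dd (dirv (g m)) (?R f g) x)) = (\<lambda>x. 0)"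
    proof
      fix x
      show "(\<Sum>f\<in>UNIV. \<Sum>g\<in>UNIV. wt f g * (dd (dirv (f m)) \<phi> x * u m x * dd (dirv (g m)) (?R f g) x)) = 0"
      proof (cases "x \<in> K")
        case True
        then have x: "x \<in> U" using K(2) by auto
        have "(\<Sum>g\<in>UNIV. wt f g * (dd (dirv (f m)) \<phi> x * u m x * dd (dirv (g m)) (?R f g) x)) =
           dd (dirv (f m)) \<phi> x * u m x * (\<Sum>g\<in>UNIV. wt f g * dd (dirv (g m)) (?R f g) x)" for f
          by (simp add: sum_distrib_left mult_ac)
        then show ?thesis
          by (simp add: divergence_free_right[OF U x u])
      qed (simp add: \<phi>0)
    qed
    finally show ?thesis by simp
  qed
  have 5: "(LINT x|lborel. \<phi> x * mixed u x) = (\<Sum>f\<in>UNIV. \<Sum>g\<in>UNIV. wt f g * - P f g)"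
  proof -
    have "(LINT x|lborel. \<phi> x * mixed u x) = (\<Sum>f\<in>UNIV. \<Sum>g\<in>UNIV. wt f g *
       (LINT x|lborel. \<phi> x * (hess (u m) x (f m) (g m) * ?R f g x)))"
      unfolding hess_def
      by (rule integral_mixed[unfolded hess_def]) (intro int continuous_on_mult conts, simp add: \<phi>(2))
    then show ?thesis
      unfolding 1 right_diff_distrib sum_subtractf 3 by simp
  qed
  have 6: "(LINT x|lborel. u m x * mixed (u(m := \<phi>)) x) = (\<Sum>f\<in>UNIV. \<Sum>g\<in>UNIV. wt f g * - P f g)"
  proof -
    have "(LINT x|lborel. u m x * mixed (u(m := \<phi>)) x) = (\<Sum>f\<in>UNIV. \<Sum>g\<in>UNIV. wt f g *
       (LINT x|lborel. u m x * (hess ((u(m := \<phi>)) m) x (f m) (g m) * cofactor m (u(m := \<phi>)) f g x)))"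
    proof (rule integral_mixed)
      show "integrable lborel (\<lambda>x. u m x * (hess ((u(m := \<phi>)) m) x (f m) (g m) * cofactor m (u(m := \<phi>)) f g x))" for f g
        unfolding hess_def cofactor_upd fun_upd_same
        by (intro int continuous_on_mult conts) (simp add: \<phi>0)
    qed
    also have "\<dots> = (\<Sum>f\<in>UNIV. \<Sum>g\<in>UNIV. wt f g * (LINT x|lborel. u m x * (hess \<phi> x (f m) (g m) * ?R f g x)))"
      by simp
    finally show ?thesis
      unfolding 2 right_diff_distrib sum_subtractf 4 by simp
  qed
  show ?thesis unfolding 5 6 ..
qed

lemma mform_upd:
  "mform (H(m := A)) = (\<Sum>f\<in>UNIV. \<Sum>g\<in>UNIV. wt f g * (A (f m) (g m) * (\<Prod>k\<in>-{m}. H k (f k) (g k))))"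
proof -
  have "(\<Prod>k\<in>UNIV. (H(m := A)) k (f k) (g k)) = A (f m) (g m) * (\<Prod>k\<in>-{m}. H k (f k) (g k))" for f g
    by (subst prod.remove[of _ m]) (auto simp: Compl_eq_Diff_UNIV intro!: prod.cong)
  then show ?thesis by (simp add: mform_def)
qed

lemma mform_linear:
  "mform (H(m := \<lambda>e e'. a * A e e' + b * B e e')) = a * mform (H(m := A)) + b * mform (H(m := B))"
  unfolding mform_upd by (simp add: algebra_simps sum.distrib sum_distrib_left)

lemma mform_0: "mform (H(m := \<lambda>e e'. 0)) = 0"
  unfolding mform_upd by simp

lemma mixed_upd: "mixed (u(m := v)) x = mform ((\<lambda>k. hess (u k) x)(m := hess v x))"
  unfolding mixed_def by (rule arg_cong[of _ _ mform]) auto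

lemma mform_bound:
  "\<exists>C. \<forall>H :: 'n::finite \<Rightarrow> 'n \<times> 4 \<Rightarrow> 'n \<times> 4 \<Rightarrow> real. (\<forall>k e e'. \<bar>H k e e'\<bar> \<le> B) \<longrightarrow> \<bar>mform H\<bar> \<le> C"
proof (intro exI allI impI)
  fix H :: "'n::finite \<Rightarrow> 'n \<times> 4 \<Rightarrow> 'n \<times> 4 \<Rightarrow> real"
  assume H: "\<forall>k e e'. \<bar>H k e e'\<bar> \<le> B"
  show "\<bar>mform H\<bar> \<le> (\<Sum>f\<in>UNIV. \<Sum>g\<in>UNIV. \<bar>wt (f :: 'n \<Rightarrow> _) g\<bar> * (\<Prod>k\<in>(UNIV :: 'n set). B))"
    unfolding mform_def
    by (intro order_trans[OF sum_abs] sum_mono)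
      (auto simp: abs_mult abs_prod H simp del: prod_constant intro!: mult_left_mono prod_mono)
qed

text \<open>The densities converge pointwise and are bounded on \<open>K\<close>, as polynomials in
  the entries of the Hessians, so dominated convergence applies.\<close>

lemma mixed_limit:
  fixes u :: "'n::finite \<Rightarrow> quat ^ 'n \<Rightarrow> real"
  assumes K: "compact K" and h: "continuous_on K h"
    and u: "\<And>k e e'. continuous_on K (\<lambda>x. hess (u k) x e e')"
    and v: "\<And>N k e e'. continuous_on K (\<lambda>x. hess (v N k) x e e')"
    and close: "\<And>N k e e' x. x \<in> K \<Longrightarrow> \<bar>hess (v N k) x e e' - hess (u k) x e e'\<bar> \<le> 1 / Suc N"
    and 0: "\<And>N x. x \<notin> K \<Longrightarrow> h x * mixed (v N) x = 0" "\<And>x. x \<notin> K \<Longrightarrow> h x * mixed u x = 0"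
  shows "(\<lambda>N. LINT x|lborel. h x * mixed (v N) x) \<longlonglongrightarrow> (LINT x|lborel. h x * mixed u x)"
proof -
  have bdd: "\<exists>B. \<forall>x\<in>K. \<bar>f x\<bar> \<le> B" if "continuous_on K f" for f :: "quat ^ 'n \<Rightarrow> real"
    using compact_imp_bounded[OF compact_continuous_image[OF that K]] by (auto simp: bounded_iff)
  obtain b where b: "\<And>k e e' x. x \<in> K \<Longrightarrow> \<bar>hess (u k) x e e'\<bar> \<le> b k e e'"
    using bdd[OF u] by metis
  define B where "B = (\<Sum>k\<in>UNIV. \<Sum>e\<in>UNIV. \<Sum>e'\<in>UNIV. \<bar>b k e e'\<bar>) + 1"
  have bB: "b k e e' + 1 \<le> B" for k e e'
  proof -
    have "b k e e' \<le> \<bar>b k e e'\<bar>" by simp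
    also have "\<dots> \<le> (\<Sum>e'\<in>UNIV. \<bar>b k e e'\<bar>)"
      by (rule member_le_sum[of e' UNIV "\<lambda>e'. \<bar>b k e e'\<bar>"]) auto
    also have "\<dots> \<le> (\<Sum>e\<in>UNIV. \<Sum>e'\<in>UNIV. \<bar>b k e e'\<bar>)"
      by (rule member_le_sum[of e UNIV "\<lambda>e. \<Sum>e'\<in>UNIV. \<bar>b k e e'\<bar>"]) (auto intro: sum_nonneg)
    also have "\<dots> \<le> (\<Sum>k\<in>UNIV. \<Sum>e\<in>UNIV. \<Sum>e'\<in>UNIV. \<bar>b k e e'\<bar>)"
      by (rule member_le_sum[of k UNIV "\<lambda>k. \<Sum>e\<in>UNIV. \<Sum>e'\<in>UNIV. \<bar>b k e e'\<bar>"]) (auto intro!: sum_nonneg)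
    finally show ?thesis by (simp add: B_def)
  qed
  obtain C where C: "\<And>H :: 'n \<Rightarrow> 'n \<times> 4 \<Rightarrow> 'n \<times> 4 \<Rightarrow> real. (\<And>k e e'. \<bar>H k e e'\<bar> \<le> B) \<Longrightarrow> \<bar>mform H\<bar> \<le> C"
    using mform_bound[of B] by metis
  obtain Bh where Bh: "\<And>x. x \<in> K \<Longrightarrow> \<bar>h x\<bar> \<le> Bh" using bdd[OF h] by blast
  have vB: "\<bar>hess (v N k) x e e'\<bar> \<le> B" if "x \<in> K" for N k e e' x
  proof -
    have "1 / real (Suc N) \<le> 1" by simp
    then show ?thesis using close[OF that, of N k e e'] b[OF that, of k e e'] bB[of k e e'] by linarith
  qed
  have cm: "continuous_on K (mixed w)" if "\<And>k e e'. continuous_on K (\<lambda>x. hess (w k) x e e')"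
    for w :: "'n \<Rightarrow> quat ^ 'n \<Rightarrow> real"
    unfolding mixed_def[abs_def] mform_def by (intro continuous_intros that)
  have ch: "continuous_on K (\<lambda>x. h x * mixed (v N) x)" "continuous_on K (\<lambda>x. h x * mixed u x)" for N
    by (intro continuous_on_mult h cm u v)+
  show ?thesis
  proof (rule integral_dominated_convergence[where w = "\<lambda>x. indicator K x * (Bh * C)"])
    show "integrable lborel (\<lambda>x. indicator K x * (Bh * C) :: real)"
      using borel_integrable_compact[OF K continuous_on_const[of K "Bh * C"]] by simp
    show "(\<lambda>x. h x * mixed u x) \<in> borel_measurable lborel"
      "(\<lambda>x. h x * mixed (v N) x) \<in> borel_measurable lborel" for N
      using integrable_compact_support[OF K ch(2) 0(2)] integrable_compact_support[OF K ch(1) 0(1)] by auto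
    show "AE x in lborel. (\<lambda>N. h x * mixed (v N) x) \<longlonglongrightarrow> h x * mixed u x"
    proof (rule AE_I2)
      fix x
      show "(\<lambda>N. h x * mixed (v N) x) \<longlonglongrightarrow> h x * mixed u x"
      proof (cases "x \<in> K")
        case True
        have "(\<lambda>N. hess (v N k) x e e') \<longlonglongrightarrow> hess (u k) x e e'" for k e e'
        proof (rule LIM_zero_cancel, rule Lim_null_comparison)
          show "eventually (\<lambda>N. norm (hess (v N k) x e e' - hess (u k) x e e') \<le> 1 / Suc N) sequentially"
            using close[OF True] by simp
          show "(\<lambda>N. 1 / real (Suc N)) \<longlonglongrightarrow> 0"
            using LIMSEQ_inverse_real_of_nat by (simp add: inverse_eq_divide)
        qed
        then show ?thesis unfolding mixed_def mform_def by (intro tendsto_intros)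
      qed (simp add: 0)
    qed
    show "AE x in lborel. norm (h x * mixed (v N) x) \<le> indicator K x * (Bh * C)" for N
    proof (rule AE_I2)
      fix x
      show "norm (h x * mixed (v N) x) \<le> indicator K x * (Bh * C)"
      proof (cases "x \<in> K")
        case True
        have "\<bar>mixed (v N) x\<bar> \<le> C" unfolding mixed_def by (rule C) (rule vB[OF True])
        then have "\<bar>h x\<bar> * \<bar>mixed (v N) x\<bar> \<le> Bh * C"
          using Bh[OF True] by (intro mult_mono) auto
        then show ?thesis using True by (simp add: abs_mult)
      qed (simp add: 0)
    qed
  qed
qed

lemma continuous_on_hess: "Ck 2 U u \<Longrightarrow> continuous_on U (\<lambda>x. hess u x e e')"
  by (simp add: hess_def numeral_2_eq_2)

lemma hess_eq_0_outside:
  assumes "closed K" "\<And>x. x \<notin> K \<Longrightarrow> \<phi> x = 0" "x \<notin> K"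
  shows "hess \<phi> x = (\<lambda>e e'. 0)"
proof -
  have "dd v \<phi> y = 0" if "y \<notin> K" for v y by (rule dd_eq_0_outside[OF assms(1,2) that])
  then show ?thesis
    unfolding hess_def by (intro ext) (rule dd_eq_0_outside[OF assms(1) _ assms(3)])
qed

text \<open>The formula itself contains only second derivatives. Replacing all functions but
  \<open>u m\<close> by mollifications, whose second derivatives converge uniformly on
  \<open>K\<close>, reduces it to smooth ones.\<close>

lemma mixed_by_parts:
  fixes u :: "'n::finite \<Rightarrow> quat ^ 'n \<Rightarrow> real"
  assumes \<Omega>: "open \<Omega>" and K: "compact K" "K \<subseteq> \<Omega>"
    and \<phi>: "Ck 2 \<Omega> \<phi>" "\<And>x. x \<notin> K \<Longrightarrow> \<phi> x = 0" and u: "\<And>k. Ck 2 \<Omega> (u k)"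
  shows "(LINT x|lborel. \<phi> x * mixed u x) = (LINT x|lborel. u m x * mixed (u(m := \<phi>)) x)"
proof -
  have cl: "closed K" using K(1) by (rule compact_imp_closed)
  define Q where "Q N k U w \<longleftrightarrow> open U \<and> K \<subseteq> U \<and> U \<subseteq> \<Omega> \<and> Ck 3 U w \<and>
     (\<forall>x\<in>K. \<forall>a\<in>range dirv. \<forall>b\<in>range dirv. \<bar>dd a (dd b w) x - dd a (dd b (u k)) x\<bar> \<le> 1 / real (Suc N))"
    for N k U w
  have "\<exists>U w. Q N k U w" for N k
    unfolding Q_def by (rule smooth_approximation[OF \<Omega> u K]) auto
  then obtain U w where Q: "\<And>N k. Q N k (U N k) (w N k)" by metis
  have U: "open (U N k)" "K \<subseteq> U N k" "U N k \<subseteq> \<Omega>" and w: "Ck 3 (U N k) (w N k)" for N k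
    using Q[of N k] by (simp_all add: Q_def)
  have close: "\<bar>hess (w N k) x e e' - hess (u k) x e e'\<bar> \<le> 1 / real (Suc N)" if "x \<in> K" for N k x e e'
    unfolding hess_def using Q[of N k] that unfolding Q_def by blast
  define v where "v N = (w N)(m := u m)" for N
  define V where "V N = (\<Inter>k. U N k)" for N
  have V: "open (V N)" "K \<subseteq> V N" "V N \<subseteq> \<Omega>" "V N \<subseteq> U N k" for N k
  proof -
    show "open (V N)" unfolding V_def by (intro open_INT) (simp_all add: U(1))
    show "K \<subseteq> V N" "V N \<subseteq> U N k" unfolding V_def using U(2) by blast+
    then show "V N \<subseteq> \<Omega>" using U(3) by blast
  qed
  have vm: "Ck 2 (V N) (v N m)" for N
    using Ck_subset[OF u V(3)] by (simp add: v_def)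
  have v3: "Ck 3 (V N) (v N k)" if "k \<noteq> m" for N k
    using Ck_subset[OF w V(4)] that by (simp add: v_def)
  have v2: "Ck 2 (V N) (v N k)" for N k
    using vm[of N] v3[of k N] Ck_mono[of 3 "V N" "v N k" 2] by (cases "k = m") (auto simp del: Ck.simps)
  have eq: "(LINT x|lborel. \<phi> x * mixed (v N) x) = (LINT x|lborel. u m x * mixed ((v N)(m := \<phi>)) x)" for N
    using mixed_by_parts_smooth[where u = "v N" and m = m, OF V(1) K(1) V(2) Ck_subset[OF \<phi>(1) V(3)] \<phi>(2) vm v3] by (simp add: v_def)
  have c: "\<bar>hess (v N k) x e e' - hess (u k) x e e'\<bar> \<le> 1 / real (Suc N)" if "x \<in> K" for N k e e' x
    using close[OF that, of N k e e'] by (cases "k = m") (auto simp: v_def)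
  have cu: "continuous_on K (\<lambda>x. hess (u k) x e e')" "continuous_on K (\<lambda>x. hess (v N k) x e e')"
      "continuous_on K (\<lambda>x. hess \<phi> x e e')" for N k e e'
    using continuous_on_subset[OF continuous_on_hess] u v2 V(2) \<phi>(1) K(2) by blast+
  have z: "mixed (y(m := \<phi>)) x = 0" if "x \<notin> K" for y x
    using hess_eq_0_outside[OF cl \<phi>(2) that] by (simp add: mixed_upd mform_0)
  have "(\<lambda>N. LINT x|lborel. \<phi> x * mixed (v N) x) \<longlonglongrightarrow> (LINT x|lborel. \<phi> x * mixed u x)"
    by (rule mixed_limit[OF K(1)])
      (use c cu \<phi>(2) continuous_on_subset[OF Ck_continuous[OF \<phi>(1)] K(2)] in auto)
  moreover have "(\<lambda>N. LINT x|lborel. u m x * mixed ((v N)(m := \<phi>)) x) \<longlonglongrightarrow> (LINT x|lborel. u m x * mixed (u(m := \<phi>)) x)"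
  proof (rule mixed_limit[OF K(1)])
    show "continuous_on K (u m)" using continuous_on_subset[OF Ck_continuous[OF u] K(2)] .
    fix N k e e' x assume "x \<in> K"
    show "\<bar>hess (((v N)(m := \<phi>)) k) x e e' - hess ((u(m := \<phi>)) k) x e e'\<bar> \<le> 1 / real (Suc N)"
      using c[OF \<open>x \<in> K\<close>, of N k e e'] by (cases "k = m") auto
  next
    show "continuous_on K (\<lambda>x. hess ((u(m := \<phi>)) k) x e e')"
      "continuous_on K (\<lambda>x. hess (((v N)(m := \<phi>)) k) x e e')" for N k e e'
      using cu by (cases "k = m"; simp)+
  qed (simp_all add: z)
  ultimately show ?thesis unfolding eq using LIMSEQ_unique by blast
qed

section \<open>Chern-Levine-Nirenberg estimates\<close>

text \<open>The pointwise form of plurisubharmonicity: every \<^const>\<open>line_trace\<close> of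
  the Hessian is nonnegative, that is, the quaternionic Hessian matrix is positive
  semidefinite.\<close>

definition psh2 :: "(quat ^ 'n::finite) set \<Rightarrow> (quat ^ 'n \<Rightarrow> real) \<Rightarrow> bool" where
  "psh2 \<Omega> u \<longleftrightarrow> Ck 2 \<Omega> u \<and> (\<forall>x\<in>\<Omega>. \<forall>v. 0 \<le> line_trace (hess u x) v)"

definition nsq :: "quat ^ 'n::finite \<Rightarrow> real" where
  "nsq x = (norm x)\<^sup>2"

lemma hess_sym: "open \<Omega> \<Longrightarrow> Ck 2 \<Omega> u \<Longrightarrow> x \<in> \<Omega> \<Longrightarrow> hess u x e e' = hess u x e' e"
  unfolding hess_def by (rule dd_commute)

lemma inner_dirv_dirv: "inner (dirv e) (dirv e') = (if e = e' then 1 else 0)"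
proof -
  have "inner (quat_unit a) (quat_unit b) = (if a = b then 1 else 0)" for a b :: 4
    using exhaust_4[of a] exhaust_4[of b] by (auto simp: inner_quat_def)
  then show ?thesis by (auto simp: dirv_def inner_axis_axis prod_eq_iff)
qed

lemma hess_nsq: "hess nsq x e e' = (if e = e' then 2 else 0)"
proof -
  have "dd v nsq y = 2 * inner v y" for v y :: "quat ^ 'a"
    unfolding nsq_def power2_norm_eq_inner
    by (rule dd_eqI) (auto intro!: derivative_eq_intros simp: inner_commute)
  then have "dd (dirv e') nsq = (\<lambda>y. 2 * inner (dirv e') y)" by (rule ext)
  then have "hess nsq x e e' = dd (dirv e) (\<lambda>y. 2 * inner (dirv e') y) x"
    by (simp only: hess_def)
  also have "\<dots> = 2 * inner (dirv e') (dirv e)"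
    by (rule dd_eqI) (auto intro!: derivative_eq_intros)
  finally show ?thesis by (simp add: inner_dirv_dirv)
qed

lemma Ck_nsq: "Ck k UNIV nsq"
  using Ck_polynomial[OF open_UNIV polynomial_norm_sq[of 0]] by (simp add: nsq_def[abs_def])

lemma line_trace_linear:
  "line_trace (\<lambda>e e'. a * A e e' + b * B e e') v = a * line_trace A v + b * line_trace B v"
  by (simp add: line_trace_def algebra_simps sum.distrib sum_distrib_left)

text \<open>The Hessian of the squared norm is twice the identity matrix, so it dominates every
  bounded matrix; the constant comes from \<open>2 a b \<le> a\<^sup>2 + b\<^sup>2\<close>.\<close>

lemma line_trace_nsq_le:
  assumes "\<And>e e'. \<bar>H e e'\<bar> \<le> C"
  shows "\<bar>line_trace H v\<bar> \<le> C * CARD('n \<times> 4) / 2 * line_trace (hess nsq (x :: quat ^ 'n::finite)) v"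
proof -
  define \<xi> where "\<xi> c e = inner (dirv e) (right_mult v (qcnj (quat_unit c)))" for c e
  have nsq: "line_trace (hess nsq x) v = 2 * (\<Sum>c\<in>UNIV. \<Sum>e\<in>UNIV. (\<xi> c e)\<^sup>2)"
  proof -
    have "hess nsq x e e' * (\<xi> c e * \<xi> c e') = (if e = e' then 2 * (\<xi> c e)\<^sup>2 else 0)" for c e e'
      by (simp add: hess_nsq power2_eq_square)
    then show ?thesis by (simp add: line_trace_def sum_distrib_left flip: \<xi>_def)
  qed
  have "\<bar>H e e' * (\<xi> c e * \<xi> c e')\<bar> \<le> C / 2 * ((\<xi> c e)\<^sup>2 + (\<xi> c e')\<^sup>2)" for c e e'
  proof -
    have "0 \<le> (\<bar>\<xi> c e\<bar> - \<bar>\<xi> c e'\<bar>)\<^sup>2" by simp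
    then have "\<bar>\<xi> c e\<bar> * \<bar>\<xi> c e'\<bar> \<le> ((\<xi> c e)\<^sup>2 + (\<xi> c e')\<^sup>2) / 2"
      by (simp add: power2_diff)
    then have "\<bar>H e e'\<bar> * (\<bar>\<xi> c e\<bar> * \<bar>\<xi> c e'\<bar>) \<le> C * (((\<xi> c e)\<^sup>2 + (\<xi> c e')\<^sup>2) / 2)"
      using assms[of e e'] by (intro mult_mono) auto
    then show ?thesis by (simp add: abs_mult)
  qed
  then have "\<bar>line_trace H v\<bar> \<le> (\<Sum>c\<in>UNIV. \<Sum>e\<in>UNIV. \<Sum>e'\<in>UNIV. C / 2 * ((\<xi> c e)\<^sup>2 + (\<xi> c e')\<^sup>2))"
    unfolding line_trace_def \<xi>_def[symmetric]
    by (intro order_trans[OF sum_abs] sum_mono)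
  also have "\<dots> = C / 2 * (\<Sum>c\<in>UNIV. 2 * (CARD('n \<times> 4) * (\<Sum>e\<in>UNIV. (\<xi> c e)\<^sup>2)))"
  proof -
    have "(\<Sum>e\<in>UNIV. \<Sum>e'\<in>UNIV. a e + a e') = 2 * (CARD('n \<times> 4) * (\<Sum>e\<in>UNIV. a e))"
      for a :: "'n \<times> 4 \<Rightarrow> real"
      by (simp add: sum.distrib flip: sum_distrib_left)
    then show ?thesis by (simp only: sum_distrib_left[symmetric])
  qed
  also have "\<dots> = C * CARD('n \<times> 4) / 2 * line_trace (hess nsq x) v"
    by (simp add: nsq sum_distrib_left algebra_simps)
  finally show ?thesis .
qed

lemma psh2_nsq: "psh2 \<Omega> nsq"
proof -
  have "0 \<le> line_trace (hess nsq x) v" for x v :: "quat ^ 'a"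
  proof -
    have "line_trace (\<lambda>_ _. 0) v = 0" by (simp add: line_trace_def)
    then show ?thesis
      using line_trace_nsq_le[of "\<lambda>_ _. 0" 2 v x] by (simp add: zero_le_mult_iff)
  qed
  then show ?thesis using Ck_subset[OF Ck_nsq] by (auto simp: psh2_def)
qed

lemma mixed_nonneg:
  assumes "open \<Omega>" "\<And>k. psh2 \<Omega> (u k)" "x \<in> \<Omega>"
  shows "0 \<le> mixed u x"
  unfolding mixed_def using assms by (intro mform_nonneg hess_sym) (auto simp: psh2_def)

text \<open>In slot \<open>m\<close> both \<open>c\<close> times the squared norm plus
  \<open>b\<close> and \<open>c\<close> times the squared norm minus \<open>b\<close> have a
  positive semidefinite Hessian at \<open>x\<close>, so both mixed densities are nonnegative
  there.\<close>

lemma mixed_dominated: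
  assumes \<Omega>: "open \<Omega>" "x \<in> \<Omega>" and u: "\<And>k. psh2 \<Omega> (u k)" and b: "Ck 2 \<Omega> b"
    and c: "\<And>v. \<bar>line_trace (hess b x) v\<bar> \<le> c * line_trace (hess nsq x) v"
  shows "\<bar>mixed (u(m := b)) x\<bar> \<le> c * mixed (u(m := nsq)) x"
proof -
  let ?H = "\<lambda>k. hess (u k) x"
  have sym: "hess (u k) x e e' = hess (u k) x e' e" "hess b x e e' = hess b x e' e"
    "hess nsq x e e' = hess nsq x e' e" for k e e'
    using hess_sym[OF \<Omega>(1) _ \<Omega>(2)] u b by (auto simp: psh2_def hess_nsq)
  have "0 \<le> mform (?H(m := \<lambda>e e'. c * hess nsq x e e' + s * hess b x e e'))" if "s = 1 \<or> s = -1" for s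
  proof (rule mform_nonneg)
    fix k e e' v
    show "(?H(m := \<lambda>e e'. c * hess nsq x e e' + s * hess b x e e')) k e e' =
        (?H(m := \<lambda>e e'. c * hess nsq x e e' + s * hess b x e e')) k e' e"
      using sym(1)[of k e e'] sym(2)[of e e'] sym(3)[of e e'] by simp
    show "0 \<le> line_trace ((?H(m := \<lambda>e e'. c * hess nsq x e e' + s * hess b x e e')) k) v"
      using c[of v] u \<Omega>(2) that by (auto simp: line_trace_linear psh2_def)
  qed
  from this[of 1] this[of "-1"] show ?thesis
    unfolding mform_linear mixed_upd by (simp add: abs_le_iff)
qed


text \<open>A sum of bumps over a finite cover of \<open>K\<close> is positive on \<open>K\<close>
  and can be divided by its minimum there.\<close>

lemma exists_bump:
  fixes K :: "'a::euclidean_space set"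
  assumes \<Omega>: "open \<Omega>" and K: "compact K" "K \<subseteq> \<Omega>"
  obtains b L where "Ck 2 UNIV b" "compact L" "L \<subseteq> \<Omega>" "K \<subseteq> L" "\<And>x. 0 \<le> b x" "\<And>x. x \<in> K \<Longrightarrow> 1 \<le> b x" "\<And>x. x \<notin> L \<Longrightarrow> b x = 0"
proof (cases "K = {}")
  case True
  show ?thesis by (rule that[of "\<lambda>_. 0" "{}"]) (auto simp: Ck_const True)
next
  case False
  have "\<forall>x\<in>K. \<exists>r>0. cball x r \<subseteq> \<Omega>" using \<Omega> K(2) open_contains_cball by blast
  then obtain r where r: "\<And>x. x \<in> K \<Longrightarrow> r x > 0" "\<And>x. x \<in> K \<Longrightarrow> cball x (r x) \<subseteq> \<Omega>" by metis
  have "K \<subseteq> (\<Union>x\<in>K. ball x (r x))" using r(1) by auto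
  then obtain D where D: "D \<subseteq> K" "finite D" "K \<subseteq> (\<Union>x\<in>D. ball x (r x))"
    using compactE_image[OF K(1), of K "\<lambda>x. ball x (r x)"] by auto
  define c where "c x = (\<Sum>d\<in>D. bump d (r d) x)" for x
  have Cc: "Ck 2 UNIV c" unfolding c_def[abs_def] by (intro Ck_sum Ck_bump) auto
  have c0: "0 \<le> c x" for x unfolding c_def by (intro sum_nonneg bump_nonneg)
  have cpos: "0 < c x" if x: "x \<in> K" for x
  proof -
    obtain d where "d \<in> D" "x \<in> ball d (r d)" using D(3) x by blast
    then show ?thesis
      unfolding c_def using D(2) bump_nonneg bump_pos by (intro sum_pos2[of D d]) auto
  qed
  obtain y where y: "y \<in> K" "\<And>x. x \<in> K \<Longrightarrow> c y \<le> c x"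
    using continuous_attains_inf[OF K(1) False continuous_on_subset[OF Ck_continuous[OF Cc]]] by auto
  define L where "L = (\<Union>d\<in>D. cball d (r d))"
  show ?thesis
  proof (rule that[of "\<lambda>x. (1 / c y) * c x" L])
    show "Ck 2 UNIV (\<lambda>x. (1 / c y) * c x)" by (rule Ck_cmult[OF open_UNIV Cc])
    show "compact L" unfolding L_def using D(2) by (intro compact_UN) auto
    show "L \<subseteq> \<Omega>" unfolding L_def using D(1) r(2) by (meson UN_least subsetD)
    have "(\<Union>d\<in>D. ball d (r d)) \<subseteq> L" unfolding L_def by (intro UN_mono ball_subset_cball order_refl)
    with D(3) show "K \<subseteq> L" by (rule order_trans)
    show "0 \<le> 1 / c y * c x" for x using c0 by simp
    show "1 \<le> 1 / c y * c x" if "x \<in> K" for x using y(2)[OF that] cpos[OF y(1)] by simp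
    show "1 / c y * c x = 0" if "x \<notin> L" for x
    proof -
      have "bump d (r d) x = 0" if "d \<in> D" for d
        using \<open>x \<notin> L\<close> that D(1) r(1) by (intro bump_zero) (auto simp: L_def)
      then show ?thesis by (simp add: c_def)
    qed
  qed
qed

lemma line_trace_bounded:
  assumes K: "compact (K :: (quat ^ 'n::finite) set)" "K \<subseteq> \<Omega>" and b: "Ck 2 \<Omega> b"
  obtains c where "c \<ge> 0" "\<And>x v. x \<in> K \<Longrightarrow> \<bar>line_trace (hess b x) v\<bar> \<le> c * line_trace (hess nsq x) v"
proof -
  have "\<exists>B. \<forall>x\<in>K. \<bar>hess b x e e'\<bar> \<le> B" for e e'
    using compact_imp_bounded[OF compact_continuous_image[OF continuous_on_subset[OF continuous_on_hess[OF b] K(2)] K(1)], of e e']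
    by (auto simp: bounded_iff)
  then obtain B where B: "\<And>e e' x. x \<in> K \<Longrightarrow> \<bar>hess b x e e'\<bar> \<le> B e e'" by metis
  define C where "C = Max (insert 0 (range (\<lambda>(e, e'). B e e')))"
  have "B e e' \<in> insert 0 (range (\<lambda>(e, e'). B e e'))" for e e'
    by (rule insertI2, rule range_eqI[of _ _ "(e, e')"]) simp
  then have C: "0 \<le> C" "\<And>e e'. B e e' \<le> C"
    unfolding C_def by (meson Max_ge finite finite_imageI finite_insert insertI1)+
  have "\<bar>line_trace (hess b x) v\<bar> \<le> (C * CARD('n \<times> 4) / 2) * line_trace (hess nsq x) v" if "x \<in> K" for x v
    using B[OF that] C(2) by (intro line_trace_nsq_le) (meson order_trans)
  then show thesis using C(1) by (intro that[of "C * CARD('n \<times> 4) / 2"]) auto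
qed

lemma continuous_on_mixed:
  assumes "\<And>k. Ck 2 U (u k)"
  shows "continuous_on U (mixed u)"
  unfolding mixed_def[abs_def] mform_def by (intro continuous_intros continuous_on_hess assms)

lemma integrable_on_compact:
  fixes h :: "'a::euclidean_space \<Rightarrow> real"
  assumes "compact K" "K \<subseteq> U" "continuous_on U h"
  shows "integrable lborel (\<lambda>x. indicator K x * h x)"
  using borel_integrable_compact[OF assms(1) continuous_on_subset[OF assms(3,2)]] by simp

lemma integrable_supported:
  fixes h :: "'a::euclidean_space \<Rightarrow> real"
  assumes "compact K" "K \<subseteq> U" "continuous_on U \<phi>" "\<And>x. x \<notin> K \<Longrightarrow> \<phi> x = 0" "continuous_on U h"
  shows "integrable lborel (\<lambda>x. \<phi> x * h x)"
  using assms by (intro integrable_compact_support[OF assms(1)] continuous_on_mult) (auto intro: continuous_on_subset)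

text \<open>Once the derivatives are moved from \<open>u m\<close> to \<open>\<phi>\<close>, only the supremum of \<open>u m\<close> matters, and the
  Hessian of \<open>\<phi>\<close> can be replaced by that of the squared norm, which dominates it.\<close>

lemma abs_integral_by_parts_le:
  fixes u :: "'n::finite \<Rightarrow> quat ^ 'n \<Rightarrow> real"
  assumes \<Omega>: "open \<Omega>" and K: "compact K" "K \<subseteq> \<Omega>"
    and \<phi>: "Ck 2 \<Omega> \<phi>" "\<And>x. x \<notin> K \<Longrightarrow> \<phi> x = 0"
    and c: "\<And>x v. x \<in> K \<Longrightarrow> \<bar>line_trace (hess \<phi> x) v\<bar> \<le> c * line_trace (hess nsq x) v"
    and u: "\<And>k. k \<noteq> m \<Longrightarrow> psh2 \<Omega> (u k)" and um: "Ck 2 \<Omega> (u m)"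
    and B: "\<And>x. x \<in> K \<Longrightarrow> \<bar>u m x\<bar> \<le> B"
  shows "\<bar>LINT x|lborel. \<phi> x * mixed u x\<bar> \<le> B * c * (LINT x|lborel. indicator K x * mixed (u(m := nsq)) x)"
proof -
  have cl: "closed K" using K(1) by (rule compact_imp_closed)
  have C: "Ck 2 \<Omega> (u k)" for k using u[of k] um by (cases "k = m") (auto simp: psh2_def)
  have z: "mixed (u(m := \<phi>)) x = 0" if "x \<notin> K" for x
    using hess_eq_0_outside[OF cl \<phi>(2) that] by (simp add: mixed_upd mform_0)
  have psh: "psh2 \<Omega> ((u(m := nsq)) k)" for k
    using u psh2_nsq by auto
  have "\<bar>u m x * mixed (u(m := \<phi>)) x\<bar> \<le> indicator K x * (B * c * mixed (u(m := nsq)) x)" for x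
  proof (cases "x \<in> K")
    case True
    then have "x \<in> \<Omega>" using K(2) by auto
    then have "\<bar>mixed ((u(m := nsq))(m := \<phi>)) x\<bar> \<le> c * mixed ((u(m := nsq))(m := nsq)) x"
      by (intro mixed_dominated[OF \<Omega> _ psh \<phi>(1)] c[OF True])
    then have "\<bar>mixed (u(m := \<phi>)) x\<bar> \<le> c * mixed (u(m := nsq)) x"
      by (simp only: fun_upd_upd)
    then have "\<bar>u m x\<bar> * \<bar>mixed (u(m := \<phi>)) x\<bar> \<le> B * (c * mixed (u(m := nsq)) x)"
      using B[OF True] by (intro mult_mono) auto
    then show ?thesis using True by (simp add: abs_mult mult.assoc)
  qed (simp add: z)
  note le = this
  have i: "integrable lborel (\<lambda>x. u m x * mixed (u(m := \<phi>)) x)"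
  proof (rule integrable_compact_support[OF K(1) continuous_on_mult])
    have "Ck 2 \<Omega> ((u(m := \<phi>)) k)" for k using C \<phi>(1) by simp
    then show "continuous_on K (mixed (u(m := \<phi>)))"
      by (intro continuous_on_subset[OF continuous_on_mixed K(2)])
    show "continuous_on K (u m)" by (rule continuous_on_subset[OF Ck_continuous[OF C] K(2)])
  qed (simp add: z)
  have i2: "integrable lborel (\<lambda>x. indicator K x * (B * c * mixed (u(m := nsq)) x))"
    using psh by (intro integrable_on_compact[OF K] continuous_on_mult continuous_on_const continuous_on_mixed)
      (auto simp: psh2_def)
  have "\<bar>LINT x|lborel. \<phi> x * mixed u x\<bar> = \<bar>LINT x|lborel. u m x * mixed (u(m := \<phi>)) x\<bar>"
    using mixed_by_parts[where u = u and m = m, OF \<Omega> K \<phi> C] by (rule arg_cong)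
  also have "\<dots> \<le> (LINT x|lborel. \<bar>u m x * mixed (u(m := \<phi>)) x\<bar>)"
    by (rule integral_abs_bound)
  also have "\<dots> \<le> (LINT x|lborel. indicator K x * (B * c * mixed (u(m := nsq)) x))"
    using i i2 le by (intro integral_mono) auto
  finally show ?thesis by (simp add: mult.left_commute)
qed

text \<open>The slots outside \<open>J\<close> hold the squared norm. With \<open>J\<close> empty
  the density is fixed, which starts the induction that admits arbitrary functions in one slot after
  another.\<close>

definition mass_bound ::
  "(quat ^ 'n::finite) set \<Rightarrow> 'n set \<Rightarrow> (quat ^ 'n) set \<Rightarrow> (quat ^ 'n) set \<Rightarrow> real \<Rightarrow> real \<Rightarrow> bool" where
  "mass_bound \<Omega> J K L B C \<longleftrightarrow> (\<forall>u. (\<forall>k. psh2 \<Omega> (u k)) \<longrightarrow>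
     (\<forall>k\<in>J. \<forall>x\<in>L. \<bar>u k x\<bar> \<le> B) \<longrightarrow> (\<forall>k. k \<notin> J \<longrightarrow> u k = nsq) \<longrightarrow>
     (LINT x|lborel. indicator K x * mixed u x) \<le> C)"

text \<open>A cut-off function dominates the indicator of \<open>K\<close>, and integration by parts
  against it replaces the function in slot \<open>j\<close> by its bound times the squared norm, on
  a slightly larger compact set. After one such step for every slot only squared norms are
  left.\<close>

proposition Chern_Levine_Nirenberg:
  fixes \<Omega> :: "(quat ^ 'n::finite) set" and J :: "'n set"
  assumes \<Omega>: "open \<Omega>" and K: "compact K" "K \<subseteq> \<Omega>"
  shows "\<exists>L. compact L \<and> L \<subseteq> \<Omega> \<and> (\<forall>B. \<exists>C\<ge>0. mass_bound \<Omega> J K L B C)"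
  using finite[of J] K
proof (induction J arbitrary: K rule: finite_induct)
  case empty
  let ?C = "\<bar>LINT x|lborel. indicator K x * mixed (\<lambda>_. nsq) x\<bar>"
  have "mass_bound \<Omega> {} K {} B ?C" for B
    unfolding mass_bound_def
  proof (intro allI impI)
    fix u :: "'n \<Rightarrow> quat ^ 'n \<Rightarrow> real"
    assume "\<forall>k. k \<notin> {} \<longrightarrow> u k = nsq"
    then have "u = (\<lambda>_. nsq)" by auto
    then show "(LINT x|lborel. indicator K x * mixed u x) \<le> ?C" by simp
  qed
  then have "\<exists>C\<ge>0. mass_bound \<Omega> {} K {} B C" for B
    by (meson abs_ge_zero)
  then show ?case by (intro exI[of _ "{}"]) auto
next
  case (insert j J)
  obtain b K' where b: "Ck 2 UNIV b" "compact K'" "K' \<subseteq> \<Omega>" "\<And>x. 0 \<le> b x" "\<And>x. x \<in> K \<Longrightarrow> 1 \<le> b x"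
      "\<And>x. x \<notin> K' \<Longrightarrow> b x = 0"
    using exists_bump[OF \<Omega> insert.prems] by metis
  have b2: "Ck 2 \<Omega> b" using Ck_subset[OF b(1)] by auto
  obtain c where c: "c \<ge> 0" "\<And>x v. x \<in> K' \<Longrightarrow> \<bar>line_trace (hess b x) v\<bar> \<le> c * line_trace (hess nsq x) v"
    using line_trace_bounded[OF b(2,3) b2] by metis
  obtain L where L: "compact L" "L \<subseteq> \<Omega>" "\<And>B. \<exists>C\<ge>0. mass_bound \<Omega> J K' L B C"
    using insert.IH[OF b(2,3)] by metis
  have "\<exists>C\<ge>0. mass_bound \<Omega> (insert j J) K (L \<union> K') B C" for B
  proof -
    obtain C where C: "C \<ge> 0" "mass_bound \<Omega> J K' L B C"
      using L(3)[of B] by metis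
    have "(LINT x|lborel. indicator K x * mixed u x) \<le> \<bar>B\<bar> * c * C"
      if u: "\<forall>k. psh2 \<Omega> (u k)" and uB: "\<forall>k\<in>insert j J. \<forall>x\<in>L \<union> K'. \<bar>u k x\<bar> \<le> B"
        and un: "\<forall>k. k \<notin> insert j J \<longrightarrow> u k = nsq" for u
    proof -
      have u: "psh2 \<Omega> (u k)" for k using u by blast
      have Cu: "Ck 2 \<Omega> (u k)" for k using u by (simp add: psh2_def)
      have "(LINT x|lborel. indicator K x * mixed u x) \<le> (LINT x|lborel. b x * mixed u x)"
      proof (rule integral_mono)
        show "integrable lborel (\<lambda>x. indicator K x * mixed u x)"
          using insert.prems Cu by (intro integrable_on_compact continuous_on_mixed)
        show "integrable lborel (\<lambda>x. b x * mixed u x)"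
          by (rule integrable_supported[OF b(2,3) Ck_continuous[OF b2] b(6) continuous_on_mixed[OF Cu]])
        show "indicator K x * mixed u x \<le> b x * mixed u x" for x
        proof (cases "x \<in> \<Omega>")
          case True
          have "indicator K x \<le> b x" using b(4)[of x] b(5)[of x] by (cases "x \<in> K") auto
          then show ?thesis using mixed_nonneg[OF \<Omega> u True] by (rule mult_right_mono)
        next
          case False
          then have "x \<notin> K" "x \<notin> K'" using b(3) insert.prems(2) by auto
          then show ?thesis using b(6) by simp
        qed
      qed
      also have "\<dots> \<le> \<bar>LINT x|lborel. b x * mixed u x\<bar>" by simp
      also have "\<dots> \<le> \<bar>B\<bar> * c * (LINT x|lborel. indicator K' x * mixed (u(j := nsq)) x)"
      proof (rule abs_integral_by_parts_le[OF \<Omega> b(2,3) b2 b(6) c(2) u Cu])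
        show "\<bar>u j x\<bar> \<le> \<bar>B\<bar>" if "x \<in> K'" for x
          using uB that by force
      qed
      also have "\<dots> \<le> \<bar>B\<bar> * c * C"
      proof (rule mult_left_mono)
        show "(LINT x|lborel. indicator K' x * mixed (u(j := nsq)) x) \<le> C"
          using C(2) u psh2_nsq uB insert.hyps(2) un unfolding mass_bound_def
          by (elim allE[of _ "u(j := nsq)"]) auto
      qed (use c(1) in auto)
      finally show ?thesis .
    qed
    then have "mass_bound \<Omega> (insert j J) K (L \<union> K') B (\<bar>B\<bar> * c * C)"
      unfolding mass_bound_def by blast
    then show ?thesis using C(1) c(1) by (intro exI[of _ "\<bar>B\<bar> * c * C"]) auto
  qed
  moreover have "compact (L \<union> K')" "L \<union> K' \<subseteq> \<Omega>" using L b by auto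
  ultimately show ?case by blast
qed

text \<open>A modulus of continuity of the Monge-Ampere measures, tested against
  \<open>\<psi>\<close>. The constant has to serve all members of an approximating sequence at once,
  so it comes before the functions.\<close>

definition lipschitz_bound ::
  "(quat ^ 'n::finite) set \<Rightarrow> (quat ^ 'n \<Rightarrow> real) \<Rightarrow> (quat ^ 'n) set \<Rightarrow> (quat ^ 'n) set \<Rightarrow> real \<Rightarrow> real \<Rightarrow> bool" where
  "lipschitz_bound \<Omega> \<psi> K L B C \<longleftrightarrow> (\<forall>f g e. psh2 \<Omega> f \<longrightarrow> psh2 \<Omega> g \<longrightarrow>
     (\<forall>x\<in>L. \<bar>f x\<bar> \<le> B) \<longrightarrow> (\<forall>x\<in>L. \<bar>g x\<bar> \<le> B) \<longrightarrow> (\<forall>x\<in>K. \<bar>f x - g x\<bar> \<le> e) \<longrightarrow> 0 \<le> e \<longrightarrow>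
     \<bar>(LINT x|lborel. \<psi> x * mixed (\<lambda>_. f) x) - (LINT x|lborel. \<psi> x * mixed (\<lambda>_. g) x)\<bar> \<le> C * e)"

text \<open>The function \<open>g\<close> is replaced by \<open>f\<close> in one slot at a time.
  Each replacement changes the integral by that of a mixed density with \<open>f - g\<close> in one
  slot; after integration by parts only the supremum of \<open>\<bar>f - g\<bar>\<close> remains,
  times a mass that the Chern-Levine-Nirenberg estimate bounds.\<close>

lemma mixed_difference_bound:
  fixes \<Omega> :: "(quat ^ 'n::finite) set"
  assumes \<Omega>: "open \<Omega>" and K: "compact K" "K \<subseteq> \<Omega>"
    and \<psi>: "Ck 2 UNIV \<psi>" "\<And>x. x \<notin> K \<Longrightarrow> \<psi> x = 0"
  shows "\<exists>L. compact L \<and> L \<subseteq> \<Omega> \<and> (\<forall>B. \<exists>C\<ge>0. lipschitz_bound \<Omega> \<psi> K L B C)"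
proof -
  have \<psi>2: "Ck 2 \<Omega> \<psi>" using Ck_subset[OF \<psi>(1)] by auto
  obtain c where c: "c \<ge> 0" "\<And>x v. x \<in> K \<Longrightarrow> \<bar>line_trace (hess \<psi> x) v\<bar> \<le> c * line_trace (hess nsq x) v"
    using line_trace_bounded[OF K \<psi>2] by blast
  have "\<forall>m. \<exists>L. compact L \<and> L \<subseteq> \<Omega> \<and> (\<forall>B. \<exists>C\<ge>0. mass_bound \<Omega> (-{m}) K L B C)"
    using Chern_Levine_Nirenberg[OF \<Omega> K] by metis
  then obtain Lf where Lf: "\<And>m. compact (Lf m)" "\<And>m. Lf m \<subseteq> \<Omega>"
      "\<And>m B. \<exists>C\<ge>0. mass_bound \<Omega> (-{m}) K (Lf m) B C"
    by metis
  define L where "L = (\<Union>m. Lf m)"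
  show ?thesis
  proof (intro exI[of _ L] conjI allI)
    show "compact L" "L \<subseteq> \<Omega>"
      using Lf(1,2) unfolding L_def by (auto intro!: compact_UN)
    fix B :: real
    obtain Cf where Cf0: "\<And>m. 0 \<le> Cf m" and Cf: "\<And>m. mass_bound \<Omega> (-{m}) K (Lf m) B (Cf m)"
      using Lf(3)[of _ B] by metis
    have step: "\<bar>(LINT x|lborel. \<psi> x * mixed (\<lambda>k. if k \<in> T then f else g) x) - (LINT x|lborel. \<psi> x * mixed (\<lambda>_. g) x)\<bar>
        \<le> (\<Sum>m\<in>T. e * c * Cf m)"
      if f: "psh2 \<Omega> f" and g: "psh2 \<Omega> g" and fB: "\<And>x. x \<in> L \<Longrightarrow> \<bar>f x\<bar> \<le> B" and gB: "\<And>x. x \<in> L \<Longrightarrow> \<bar>g x\<bar> \<le> B"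
        and e: "\<And>x. x \<in> K \<Longrightarrow> \<bar>f x - g x\<bar> \<le> e" "0 \<le> e" and T: "finite T" for f g e T
      using T
    proof (induction T rule: finite_induct)
      case empty
      show ?case by simp
    next
      case (insert m T)
      let ?h = "\<lambda>k. if k \<in> T then f else g"
      have psh: "psh2 \<Omega> (?h k)" for k using f g by simp
      have hm: "?h(m := g) = ?h" using insert.hyps(2) by auto
      have hf: "(\<lambda>k. if k \<in> insert m T then f else g) = ?h(m := f)" by auto
      have C2: "Ck 2 \<Omega> f" "Ck 2 \<Omega> g" using f g by (auto simp: psh2_def)
      have fg: "Ck 2 \<Omega> (\<lambda>x. f x - g x)" by (rule Ck_diff[OF \<Omega> C2])
      have "mixed (?h(m := f)) x - mixed (?h(m := g)) x = mixed (?h(m := (\<lambda>x. f x - g x))) x" if "x \<in> \<Omega>" for x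
      proof -
        have "hess (\<lambda>x. f x - g x) x = (\<lambda>e e'. 1 * hess f x e e' + (-1) * hess g x e e')"
        proof (intro ext)
          fix e e'
          have d: "dd (dirv e') (\<lambda>x. f x - g x) y = dd (dirv e') f y - dd (dirv e') g y" if "y \<in> \<Omega>" for y
            using C2 that by (intro dd_diff) (auto simp: numeral_2_eq_2)
          have "hess (\<lambda>x. f x - g x) x e e' = dd (dirv e) (\<lambda>y. dd (dirv e') f y - dd (dirv e') g y) x"
            unfolding hess_def by (rule dd_cong[OF \<Omega> \<open>x \<in> \<Omega>\<close> d])
          also have "\<dots> = hess f x e e' - hess g x e e'"
            unfolding hess_def using C2 \<open>x \<in> \<Omega>\<close> by (intro dd_diff) (auto simp: numeral_2_eq_2)
          finally show "hess (\<lambda>x. f x - g x) x e e' = 1 * hess f x e e' + (-1) * hess g x e e'" by simp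
        qed
        then show ?thesis unfolding mixed_upd by (simp only: mform_linear)
      qed
      then have "\<psi> x * mixed (?h(m := f)) x - \<psi> x * mixed (?h(m := g)) x = \<psi> x * mixed (?h(m := (\<lambda>x. f x - g x))) x" for x
        using \<psi>(2) K(2) by (cases "x \<in> \<Omega>") (auto simp flip: right_diff_distrib)
      moreover have "integrable lborel (\<lambda>x. \<psi> x * mixed (?h(m := w)) x)" if "Ck 2 \<Omega> w" for w
        using that C2 by (intro integrable_supported[OF K Ck_continuous[OF \<psi>2] \<psi>(2)] continuous_on_mixed) auto
      note this[OF C2(1)] this[OF C2(2)]
      ultimately have "\<bar>(LINT x|lborel. \<psi> x * mixed (?h(m := f)) x) - (LINT x|lborel. \<psi> x * mixed (?h(m := g)) x)\<bar>
          = \<bar>LINT x|lborel. \<psi> x * mixed (?h(m := (\<lambda>x. f x - g x))) x\<bar>"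
        by (simp flip: Bochner_Integration.integral_diff)
      also have "\<dots> \<le> e * c * (LINT x|lborel. indicator K x * mixed (?h(m := (\<lambda>x. f x - g x), m := nsq)) x)"
        using psh fg e(1) by (intro abs_integral_by_parts_le[OF \<Omega> K \<psi>2 \<psi>(2) c(2)]) auto
      also have "?h(m := (\<lambda>x. f x - g x), m := nsq) = ?h(m := nsq)" by simp
      also have "e * c * (LINT x|lborel. indicator K x * mixed (?h(m := nsq)) x) \<le> e * c * Cf m"
      proof (rule mult_left_mono)
        have "\<forall>k. psh2 \<Omega> ((?h(m := nsq)) k)" using psh psh2_nsq by auto
        moreover have "\<forall>k\<in>-{m}. \<forall>x\<in>Lf m. \<bar>(?h(m := nsq)) k x\<bar> \<le> B" using fB gB by (auto simp: L_def)
        ultimately show "(LINT x|lborel. indicator K x * mixed (?h(m := nsq)) x) \<le> Cf m"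
          using Cf[of m] unfolding mass_bound_def by auto
      qed (use e c in auto)
      finally have "\<bar>(LINT x|lborel. \<psi> x * mixed (?h(m := f)) x) - (LINT x|lborel. \<psi> x * mixed ?h x)\<bar> \<le> e * c * Cf m"
        unfolding hm .
      with insert.IH insert.hyps show ?case unfolding hf by simp
    qed
    have "lipschitz_bound \<Omega> \<psi> K L B (\<Sum>m\<in>UNIV. c * Cf m)"
      unfolding lipschitz_bound_def
    proof (intro allI impI)
      fix f g e
      assume "psh2 \<Omega> f" "psh2 \<Omega> g" "\<forall>x\<in>L. \<bar>f x\<bar> \<le> B" "\<forall>x\<in>L. \<bar>g x\<bar> \<le> B" "\<forall>x\<in>K. \<bar>f x - g x\<bar> \<le> e" "0 \<le> e"
      then have "\<bar>(LINT x|lborel. \<psi> x * mixed (\<lambda>k. if k \<in> UNIV then f else g) x) - (LINT x|lborel. \<psi> x * mixed (\<lambda>_. g) x)\<bar>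
          \<le> (\<Sum>m\<in>UNIV. e * c * Cf m)"
        by (intro step) auto
      then show "\<bar>(LINT x|lborel. \<psi> x * mixed (\<lambda>_. f) x) - (LINT x|lborel. \<psi> x * mixed (\<lambda>_. g) x)\<bar> \<le> (\<Sum>m\<in>UNIV. c * Cf m) * e"
        by (simp add: sum_distrib_left mult_ac)
    qed
    moreover have "0 \<le> (\<Sum>m\<in>UNIV. c * Cf m)" using c(1) Cf0 by (intro sum_nonneg) auto
    ultimately show "\<exists>C\<ge>0. lipschitz_bound \<Omega> \<psi> K L B C" by blast
  qed
qed

section \<open>Hessians of plurisubharmonic functions\<close>

lemma C2_on_imp_Ck:
  assumes \<Omega>: "open \<Omega>" and "C2_on \<Omega> f"
  shows "Ck 2 \<Omega> f"
proof -
  obtain f' :: "'a \<Rightarrow> 'a \<Rightarrow>\<^sub>L real" and f'' :: "'a \<Rightarrow> 'a \<Rightarrow>\<^sub>L 'a \<Rightarrow>\<^sub>L real"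
    where f': "\<And>x. x \<in> \<Omega> \<Longrightarrow> (f has_derivative blinfun_apply (f' x)) (at x)"
      and f'': "\<And>x. x \<in> \<Omega> \<Longrightarrow> (f' has_derivative blinfun_apply (f'' x)) (at x)"
      and c: "continuous_on \<Omega> f''"
    using assms(2) unfolding C2_on_def by blast
  have d2: "((\<lambda>x. f' x v) has_derivative (\<lambda>w. f'' x w v)) (at x)" if "x \<in> \<Omega>" for x v
    using bounded_linear.has_derivative[OF blinfun.bounded_linear_left f''[OF that]] .
  have 1: "Ck 1 \<Omega> (\<lambda>x. f' x v)" for v
  proof -
    have "continuous_on \<Omega> (\<lambda>x. f'' x w v)" for w by (intro continuous_intros c)
    then have "continuous_on \<Omega> (dd w (\<lambda>x. f' x v))" for w
      by (rule continuous_on_cong[THEN iffD1, rotated 2]) (auto simp: dd_eqI[OF d2])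
    then show ?thesis using d2 by (auto simp: differentiable_def)
  qed
  have "Ck 1 \<Omega> (dd v f)" for v
    by (rule Ck_cong[OF \<Omega> _ 1[of v]]) (simp add: dd_eqI[OF f'])
  then have "Ck (Suc 1) \<Omega> f"
    using f' by (subst Ck.simps) (auto simp: differentiable_def simp del: Ck.simps)
  then show ?thesis by (simp add: numeral_2_eq_2)
qed

lemma partial_deriv_sum:
  fixes F :: "4 \<Rightarrow> quat ^ 'n::finite \<Rightarrow> real" and c :: "4 \<Rightarrow> quat"
  assumes \<Omega>: "open \<Omega>" "x \<in> \<Omega>" and F: "\<And>b. F b differentiable (at x)"
    and g: "\<And>y. y \<in> \<Omega> \<Longrightarrow> g y = (\<Sum>b\<in>UNIV. F b y *\<^sub>R c b)"
  shows "partial_deriv v g x = (\<Sum>b\<in>UNIV. dd v (F b) x *\<^sub>R c b)"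
proof -
  have line: "((\<lambda>s. F b (x + s *\<^sub>R v)) has_real_derivative dd v (F b) x) (at 0)" for b
    using dd_line[of "F b" x 0 v] F by simp
  have "((\<lambda>s. \<Sum>b\<in>UNIV. F b (x + s *\<^sub>R v) *\<^sub>R c b) has_vector_derivative (\<Sum>b\<in>UNIV. dd v (F b) x *\<^sub>R c b)) (at 0)"
    using has_vector_derivative_scaleR[OF line has_vector_derivative_const[of "c _"]]
    by (intro has_vector_derivative_sum) simp
  then have "((\<lambda>s. g (x + s *\<^sub>R v)) has_vector_derivative (\<Sum>b\<in>UNIV. dd v (F b) x *\<^sub>R c b)) (at 0)"
  proof (rule has_vector_derivative_transform_within_open)
    have "open ((\<lambda>s. x + s *\<^sub>R v) -` \<Omega>)"
      by (intro continuous_open_vimage \<Omega> continuous_intros)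
    then show "open {s. x + s *\<^sub>R v \<in> \<Omega>}" by (simp add: vimage_def)
  qed (use \<Omega> g in auto)
  then show ?thesis unfolding partial_deriv_def by (rule vector_derivative_at)
qed

lemma quat_hessian_eq_quatize:
  assumes \<Omega>: "open \<Omega>" "x \<in> \<Omega>" and f: "Ck 2 \<Omega> f"
  shows "quat_hessian f x = quatize (hess f x)"
proof -
  have C: "f differentiable (at y)" "dd v f differentiable (at y)" if "y \<in> \<Omega>" for v y
    using f that by (auto simp: numeral_2_eq_2)
  have pd: "partial_deriv v (\<lambda>y. of_real (f y) :: quat) y = of_real (dd v f y)" if "y \<in> \<Omega>" for v y
    using partial_deriv_sum[OF \<Omega>(1) that, of "\<lambda>b. if b = 1 then f else (\<lambda>_. 0)" "\<lambda>y. of_real (f y)" "\<lambda>b. if b = 1 then 1 else 0" v] C(1)[OF that]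
    by (simp add: sum_4 of_real_def)
  have dq: "d_q j (\<lambda>y. of_real (f y)) y = (\<Sum>b\<in>UNIV. dd (dirv (j, b)) f y *\<^sub>R qcnj (quat_unit b))" if "y \<in> \<Omega>" for j y
    unfolding d_q_def pd[OF that] sum_4 dirv_def
    by (simp add: quat_eq_iff of_real_def)
  have "d_qbar i (d_q j (\<lambda>y. of_real (f y))) x = quatize (hess f x) $ i $ j" for i j
  proof -
    have p: "partial_deriv v (d_q j (\<lambda>y. of_real (f y))) x = (\<Sum>b\<in>UNIV. dd v (dd (dirv (j, b)) f) x *\<^sub>R qcnj (quat_unit b))" for v
      by (rule partial_deriv_sum[OF \<Omega> C(2)[OF \<Omega>(2)] dq])
    have "d_qbar i (d_q j (\<lambda>y. of_real (f y))) x = (\<Sum>a\<in>UNIV. quat_unit a * partial_deriv (dirv (i, a)) (d_q j (\<lambda>y. of_real (f y))) x)"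
      unfolding d_qbar_def sum_4 by (simp add: dirv_def)
    also have "\<dots> = quatize (hess f x) $ i $ j"
      unfolding p quatize_def hess_def by (simp add: sum_distrib_left mult_scaleR_right del: times_quat.sel)
    finally show ?thesis .
  qed
  then show ?thesis by (simp add: vec_eq_iff quat_hessian_def)
qed

lemma moore_det_hessian:
  assumes "open \<Omega>" "x \<in> \<Omega>" "Ck 2 \<Omega> f"
  shows "moore_det (quat_hessian f x) = mixed (\<lambda>_. f) x"
  unfolding quat_hessian_eq_quatize[OF assms] mixed_def
  using hess_sym[OF assms(1,3,2)] by (intro moore_det_quatize) blast

lemma dd_sum_direction:
  assumes "f differentiable (at x)"
  shows "dd (\<Sum>i\<in>I. a i *\<^sub>R w i) f x = (\<Sum>i\<in>I. a i * dd (w i) f x)"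
proof -
  have "linear (\<lambda>v. dd v f x)" using has_derivative_dd[OF assms] by (rule has_derivative_linear)
  from linear_sum[OF this, of "\<lambda>i. a i *\<^sub>R w i" I] linear_cmul[OF this] show ?thesis by simp
qed

lemma sum_inner_dirv: "(\<Sum>e\<in>UNIV. inner (dirv e) w *\<^sub>R dirv e) = (w :: quat ^ 'n::finite)"
proof -
  have "(\<Sum>e\<in>UNIV. inner (dirv e) w *\<^sub>R dirv e) $ i = w $ i" for i
  proof -
    have "(\<Sum>e\<in>UNIV. inner (dirv e) w *\<^sub>R dirv e) $ i
       = (\<Sum>j\<in>UNIV. \<Sum>a\<in>UNIV. inner (dirv (j, a)) w *\<^sub>R dirv (j, a) $ i)"
      by (simp only: sum_UNIV_prod sum_component vector_scaleR_component)
    also have "\<dots> = (\<Sum>j\<in>UNIV. if j = i then (\<Sum>a\<in>UNIV. QRe (qcnj (quat_unit a) * w $ i) *\<^sub>R quat_unit a) else 0)"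
      unfolding inner_dirv by (intro sum.cong refl) (auto simp: dirv_def axis_def simp del: times_quat.sel)
    also have "\<dots> = w $ i" by (simp add: sum_4 quat_eq_iff)
    finally show ?thesis .
  qed
  then show ?thesis by (simp add: vec_eq_iff)
qed

lemma dd_dd_eq_hess:
  assumes \<Omega>: "open \<Omega>" "x \<in> \<Omega>" and f: "Ck 2 \<Omega> f"
  shows "dd w (dd w f) x = (\<Sum>e\<in>UNIV. \<Sum>e'\<in>UNIV. hess f x e e' * (inner (dirv e) w * inner (dirv e') w))"
proof -
  have C: "f differentiable (at y)" "dd v f differentiable (at y)" if "y \<in> \<Omega>" for v y
    using f that by (auto simp: numeral_2_eq_2)
  have 1: "dd w f y = (\<Sum>e'\<in>UNIV. inner (dirv e') w * dd (dirv e') f y)" if "y \<in> \<Omega>" for y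
    using dd_sum_direction[OF C(1)[OF that], of "\<lambda>e. inner (dirv e) w" dirv UNIV] by (simp only: sum_inner_dirv)
  have 2: "dd w g x = (\<Sum>e\<in>UNIV. inner (dirv e) w * dd (dirv e) g x)" if "g differentiable (at x)" for g
    using dd_sum_direction[OF that, of "\<lambda>e. inner (dirv e) w" dirv UNIV] by (simp only: sum_inner_dirv)
  have "dd w (dd w f) x = dd w (\<lambda>y. \<Sum>e'\<in>UNIV. inner (dirv e') w * dd (dirv e') f y) x"
    by (rule dd_cong[OF \<Omega> 1])
  also have "\<dots> = (\<Sum>e'\<in>UNIV. inner (dirv e') w * dd w (dd (dirv e') f) x)"
    using C(2)[OF \<Omega>(2)] by (subst dd_sum) (auto simp: dd_cmult)
  also have "\<dots> = (\<Sum>e'\<in>UNIV. \<Sum>e\<in>UNIV. hess f x e e' * (inner (dirv e) w * inner (dirv e') w))"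
    unfolding 2[OF C(2)[OF \<Omega>(2)]] sum_distrib_left hess_def by (intro sum.cong refl) simp
  also have "\<dots> = (\<Sum>e\<in>UNIV. \<Sum>e'\<in>UNIV. hess f x e e' * (inner (dirv e) w * inner (dirv e') w))"
    by (rule sum.swap)
  finally show ?thesis .
qed

text \<open>Taylor's formula of second order in both directions; the first order terms
  cancel.\<close>

lemma second_difference:
  assumes \<Omega>: "open \<Omega>" and f: "Ck 2 \<Omega> f"
    and seg: "\<And>t. \<bar>t\<bar> \<le> 1 \<Longrightarrow> x + t *\<^sub>R w \<in> \<Omega>"
    and m: "\<And>t. \<bar>t\<bar> \<le> 1 \<Longrightarrow> dd w (dd w f) (x + t *\<^sub>R w) \<le> m"
  shows "f (x + w) + f (x - w) - 2 * f x \<le> m"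
proof -
  have C: "f differentiable (at y)" "dd v f differentiable (at y)" if "y \<in> \<Omega>" for v y
    using f that by (auto simp: numeral_2_eq_2)
  have half: "f (x + s *\<^sub>R w) \<le> f x + s * dd w f x + m / 2" if s: "s = 1 \<or> s = -1" for s
  proof -
    define D where "D k t = (if k = 0 then f (x + (s * t) *\<^sub>R w) else if k = 1 then s * dd w f (x + (s * t) *\<^sub>R w)
        else dd w (dd w f) (x + (s * t) *\<^sub>R w))" for k :: nat and t
    have D: "D 0 = (\<lambda>t. f (x + (s * t) *\<^sub>R w))" "D (Suc 0) = (\<lambda>t. s * dd w f (x + (s * t) *\<^sub>R w))"
        "D (Suc (Suc 0)) = (\<lambda>t. dd w (dd w f) (x + (s * t) *\<^sub>R w))"
      by (auto simp: D_def fun_eq_iff)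
    have ss: "s * s = 1" "s * (s * z) = z" for z using s by auto
    have "((\<lambda>t. h (x + (s * t) *\<^sub>R w)) has_real_derivative s * dd w h (x + (s * t) *\<^sub>R w)) (at t)"
      if "h differentiable (at (x + (s * t) *\<^sub>R w))" for h t
    proof -
      have "((\<lambda>t. s * t) has_real_derivative s) (at t)" by (auto intro!: derivative_eq_intros)
      from DERIV_chain2[where f = "\<lambda>s. h (x + s *\<^sub>R w)", OF dd_line[OF that] this]
      show ?thesis by (simp add: mult.commute)
    qed
    note line = this
    have "DERIV (D k) t :> D (Suc k) t" if "k < 2" "0 \<le> t" "t \<le> 1" for k t
    proof -
      have y: "x + (s * t) *\<^sub>R w \<in> \<Omega>" using seg[of "s * t"] s that by auto
      show ?thesis
      proof (cases "k = 0")
        case True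
        then show ?thesis using line[OF C(1)[OF y]] by (simp add: D)
      next
        case False
        then have "k = 1" using that by simp
        then show ?thesis using DERIV_cmult[OF line[OF C(2)[OF y, of w]], of s] by (simp add: D ss)
      qed
    qed
    then obtain t where t: "0 < t" "t < 1" "D 0 1 = (\<Sum>k<2. D k 0 / fact k * 1 ^ k) + D 2 t / fact 2 * 1 ^ 2"
      using Maclaurin[of 1 2 D "D 0"] by auto
    have "\<bar>s * t\<bar> \<le> 1" using s t by auto
    then have "D 2 t \<le> m" using m by (simp add: D_def)
    then show ?thesis using t(3) by (simp add: D_def numeral_2_eq_2)
  qed
  from half[of 1] half[of "-1"] show ?thesis by simp
qed

text \<open>The quadratic form of a hyperhermitian matrix scales by the squared norm under right
  multiplication, so the trace over a quaternionic line does not depend on the chosen direction.\<close>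

lemma line_trace_right_mult: "line_trace H (right_mult v l) = (norm l)\<^sup>2 * line_trace H v"
proof -
  let ?A = "quatize H"
  let ?S = "\<Sum>i\<in>UNIV. \<Sum>j\<in>UNIV. qcnj (v $ i) * ?A $ i $ j * v $ j"
  have "(\<Sum>i\<in>UNIV. \<Sum>j\<in>UNIV. qcnj (right_mult v l $ i) * ?A $ i $ j * right_mult v l $ j) = qcnj l * ?S * l"
    unfolding right_mult_def vec_lambda_beta qcnj_mult
    by (simp only: sum_distrib_left sum_distrib_right mult.assoc)
  then have "real_form ?A (right_mult v l) (right_mult v l) = QRe (qcnj l * ?S * l)"
    by (simp only: real_form_def)
  also have "\<dots> = QRe (l * (qcnj l * ?S))"
    by (rule QRe_mult_commute)
  also have "l * (qcnj l * ?S) = l * qcnj l * ?S"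
    by (rule mult.assoc[symmetric])
  also have "l * qcnj l = (norm l)\<^sup>2 *\<^sub>R 1"
    by (simp add: power2_norm_eq_inner quat_eq_iff inner_quat_def)
  also have "QRe ((norm l)\<^sup>2 *\<^sub>R 1 * ?S) = (norm l)\<^sup>2 * real_form ?A v v"
    by (simp only: mult_scaleR_left mult_1_left scaleR_quat.sel real_form_def)
  finally show ?thesis unfolding real_form_quatize .
qed

lemma norm_right_mult: "norm (right_mult v l) = norm v * norm l"
proof -
  have "(norm (right_mult v l))\<^sup>2 = (\<Sum>i\<in>UNIV. (norm (v $ i) * norm l)\<^sup>2)"
    unfolding power2_norm_eq_inner inner_vec_def right_mult_def vec_lambda_beta
    by (simp add: norm_mult flip: power2_norm_eq_inner)
  also have "\<dots> = (norm v * norm l)\<^sup>2"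
    by (simp add: power_mult_distrib power2_norm_eq_inner[of v] inner_vec_def sum_distrib_right power2_norm_eq_inner)
  finally show ?thesis by (simp add: power2_eq_iff_nonneg)
qed

lemma right_mult_right_mult: "right_mult (right_mult v l) p = right_mult v (l * p)"
  by (simp add: right_mult_def vec_eq_iff mult.assoc)

lemma right_mult_minus: "right_mult v (- l) = - right_mult v l"
  by (simp add: right_mult_def vec_eq_iff)

lemma quat_units_distinct: "1 \<noteq> quat_i" "1 \<noteq> quat_j" "1 \<noteq> quat_k" "quat_i \<noteq> quat_j" "quat_i \<noteq> quat_k" "quat_j \<noteq> quat_k"
  by (simp_all add: quat_eq_iff)

lemma mem_box_quat: "x \<in> box l u \<longleftrightarrow> QRe l < QRe x \<and> QRe x < QRe u \<and> QIm1 l < QIm1 x \<and> QIm1 x < QIm1 u \<and>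
    QIm2 l < QIm2 x \<and> QIm2 x < QIm2 u \<and> QIm3 l < QIm3 x \<and> QIm3 x < QIm3 u"
  by (auto simp: mem_box Basis_quat_def inner_quat_def)

lemma borel_measurable_right_mult: "(\<lambda>x :: quat. x * p) \<in> borel_measurable borel"
proof -
  have "linear (\<lambda>x :: quat. x * p)" by (auto intro!: linearI simp: distrib_right)
  then show ?thesis by (intro borel_measurable_continuous_onI linear_continuous_on) (simp add: linear_conv_bounded_linear)
qed

text \<open>Multiplication by \<open>i\<close> or \<open>j\<close> permutes the real coordinates up
  to signs, so it maps boxes to boxes of the same volume.\<close>

lemma lborel_right_mult_ij:
  assumes "p = quat_i \<or> p = quat_j"
  shows "distr lborel borel (\<lambda>x. x * p) = (lborel :: quat measure)"
proof (rule lborel_eqI[symmetric])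
  fix l u :: quat
  assume le: "\<And>b. b \<in> Basis \<Longrightarrow> inner l b \<le> inner u b"
  define l' u' where "l' = (if p = quat_i then Quat (QIm1 l) (- QRe u) (- QIm3 u) (QIm2 l) else Quat (QIm2 l) (QIm3 l) (- QRe u) (- QIm1 u))"
    and "u' = (if p = quat_i then Quat (QIm1 u) (- QRe l) (- QIm3 l) (QIm2 u) else Quat (QIm2 u) (QIm3 u) (- QRe l) (- QIm1 l))"
  have "(\<lambda>x. x * p) -` box l u = box l' u'"
    using assms quat_units_distinct by (auto simp: mem_box_quat l'_def u'_def)
  moreover have "\<And>b. b \<in> Basis \<Longrightarrow> inner l' b \<le> inner u' b"
  proof -
    have "QRe l \<le> QRe u" "QIm1 l \<le> QIm1 u" "QIm2 l \<le> QIm2 u" "QIm3 l \<le> QIm3 u"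
      using le[of 1] le[of quat_i] le[of quat_j] le[of quat_k]
      by (simp_all add: Basis_quat_def inner_quat_def)
    then show "inner l' b \<le> inner u' b" if "b \<in> Basis" for b
      using that by (auto simp: Basis_quat_def inner_quat_def l'_def u'_def)
  qed
  moreover have "(\<Prod>b\<in>Basis. inner (u' - l') b) = (\<Prod>b\<in>Basis. inner (u - l) b)"
    using assms quat_units_distinct by (auto simp: Basis_quat_def inner_quat_def l'_def u'_def)
  ultimately show "emeasure (distr lborel borel (\<lambda>x. x * p)) (box l u) = ennreal (\<Prod>b\<in>Basis. inner (u - l) b)"
    using borel_measurable_right_mult[of p] by (subst emeasure_distr) (auto simp: emeasure_lborel_box_eq)
qed simp

text \<open>The required invariance of Lebesgue measure is closed under products, so it passes from
  \<open>i\<close> and \<open>j\<close> to the group that they generate.\<close>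

definition rot_units :: "quat set" where
  "rot_units = {p. norm p = 1 \<and> distr lborel borel (\<lambda>x. x * p) = (lborel :: quat measure)}"

lemma rot_units_mult:
  assumes "p \<in> rot_units" "q \<in> rot_units"
  shows "p * q \<in> rot_units"
proof -
  have "distr lborel borel (\<lambda>x. x * (p * q)) = distr (distr lborel borel (\<lambda>x. x * p)) borel (\<lambda>x. x * q)"
    using borel_measurable_right_mult[of p] borel_measurable_right_mult[of q]
    by (subst distr_distr) (auto simp: comp_def mult.assoc)
  with assms show ?thesis by (simp add: rot_units_def norm_mult)
qed

lemma unit_mem_rot_units: "quat_unit c \<in> rot_units" "- quat_unit c \<in> rot_units" "qcnj (quat_unit c) \<in> rot_units" "- qcnj (quat_unit c) \<in> rot_units"
proof -
  have ij: "quat_i \<in> rot_units" "quat_j \<in> rot_units"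
    using lborel_right_mult_ij by (auto simp: rot_units_def norm_quat_def inner_quat_def)
  have "- 1 \<in> rot_units" using rot_units_mult[OF ij(1) ij(1)] by (simp add: quat_unit_products)
  moreover have "quat_k \<in> rot_units" using rot_units_mult[OF ij] by (simp add: quat_unit_products)
  moreover have "1 \<in> rot_units" using rot_units_mult[OF \<open>-1 \<in> rot_units\<close> \<open>-1 \<in> rot_units\<close>] by simp
  ultimately have q: "quat_unit c \<in> rot_units" "- 1 \<in> rot_units" for c
    using ij exhaust_4[of c] by auto
  have n: "- quat_unit c \<in> rot_units" for c using rot_units_mult[OF q(2) q(1)] by simp
  have "qcnj (quat_unit c) = quat_unit c \<or> qcnj (quat_unit c) = - quat_unit c"
    using exhaust_4[of c] by (auto simp: quat_eq_iff)
  then show "quat_unit c \<in> rot_units" "- quat_unit c \<in> rot_units" "qcnj (quat_unit c) \<in> rot_units" "- qcnj (quat_unit c) \<in> rot_units"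
    using q(1)[of c] n[of c] by (metis minus_minus)+
qed

lemma sphere_measure_sphere:
  assumes "r > 0"
  shows "emeasure (sphere_measure (0 :: quat) r) (sphere 0 r) = 1"
    "sets (sphere_measure (0 :: quat) r) = sets borel"
proof -
  let ?B = "ball (0 :: quat) 1" and ?U = "uniform_measure lborel (ball (0 :: quat) 1)"
  have B: "emeasure lborel ?B \<noteq> 0" "emeasure lborel ?B \<noteq> \<infinity>"
  proof -
    have "0 < measure lborel ?B" by (rule content_ball_pos) simp
    then show "emeasure lborel ?B \<noteq> 0" "emeasure lborel ?B \<noteq> \<infinity>"
      by (auto simp: measure_def)
  qed
  have m: "(\<lambda>y :: quat. 0 + (r / norm y) *\<^sub>R y) \<in> borel_measurable ?U"
    by simp
  show "sets (sphere_measure (0 :: quat) r) = sets borel" by (simp add: sphere_measure_def)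
  have "emeasure (sphere_measure (0 :: quat) r) (sphere 0 r) = emeasure ?U ((\<lambda>y. 0 + (r / norm y) *\<^sub>R y) -` sphere 0 r \<inter> space ?U)"
    unfolding sphere_measure_def using m by (intro emeasure_distr) auto
  also have "(\<lambda>y :: quat. 0 + (r / norm y) *\<^sub>R y) -` sphere 0 r \<inter> space ?U = - {0}"
    using assms by auto
  also have "emeasure ?U (- {0}) = emeasure lborel (?B \<inter> - {0}) / emeasure lborel ?B"
    by (intro emeasure_uniform_measure) auto
  also have "?B \<inter> - {0} = ?B - {0}" by auto
  also have "emeasure lborel (?B - {0}) = emeasure lborel ?B"
    by (intro emeasure_Diff_null_set) auto
  also have "emeasure lborel ?B / emeasure lborel ?B = 1"
    using B ennreal_divide_self[of "emeasure lborel ?B"] by (simp add: less_top)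
  finally show "emeasure (sphere_measure (0 :: quat) r) (sphere 0 r) = 1" .
qed

text \<open>A multiplication by a unit preserves the unit ball and commutes with the radial
  projection.\<close>

lemma sphere_measure_rot:
  assumes p: "p \<in> rot_units"
  shows "distr (sphere_measure (0 :: quat) r) borel (\<lambda>x. x * p) = sphere_measure 0 r"
proof -
  let ?B = "ball (0 :: quat) 1" and ?U = "uniform_measure lborel (ball (0 :: quat) 1)"
  let ?s = "\<lambda>y :: quat. 0 + (r / norm y) *\<^sub>R y"
  have n: "norm p = 1" and L: "distr lborel borel (\<lambda>x. x * p) = lborel" using p by (auto simp: rot_units_def)
  have s: "?s \<in> borel_measurable borel" by simp
  note rm = borel_measurable_right_mult[of p]
  have U: "distr ?U borel (\<lambda>x. x * p) = ?U"
  proof (rule measure_eqI)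
    fix A assume "A \<in> sets (distr ?U borel (\<lambda>x. x * p))"
    then have A: "A \<in> sets borel" by simp
    have "(\<lambda>x. x * p) -` ?B = ?B" using n by (auto simp: norm_mult)
    then have v: "?B \<inter> (\<lambda>x. x * p) -` A = (\<lambda>x. x * p) -` (?B \<inter> A)" by auto
    have mA: "(\<lambda>x. x * p) -` A \<in> sets borel" using measurable_sets[OF rm, of A] A by simp
    have "emeasure (distr ?U borel (\<lambda>x. x * p)) A = emeasure ?U ((\<lambda>x. x * p) -` A)"
      using A rm by (subst emeasure_distr) auto
    also have "\<dots> = emeasure lborel ((\<lambda>x. x * p) -` (?B \<inter> A)) / emeasure lborel ?B"
      using mA by (subst emeasure_uniform_measure) (auto simp: v)
    also have "emeasure lborel ((\<lambda>x. x * p) -` (?B \<inter> A)) = emeasure (distr lborel borel (\<lambda>x. x * p)) (?B \<inter> A)"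
      using A rm by (subst emeasure_distr) auto
    also have "\<dots> / emeasure lborel ?B = emeasure ?U A"
      unfolding L using A by (subst emeasure_uniform_measure) auto
    finally show "emeasure (distr ?U borel (\<lambda>x. x * p)) A = emeasure ?U A" .
  qed simp
  have "distr (distr ?U borel ?s) borel (\<lambda>x. x * p) = distr (distr ?U borel (\<lambda>x. x * p)) borel ?s"
    using s rm n by (subst (1 2) distr_distr) (auto simp: comp_def norm_mult intro!: distr_cong)
  then show ?thesis unfolding sphere_measure_def U .
qed

text \<open>The averages over small spheres in the quaternionic line do not change if the function
  is replaced by its mean over the eight points obtained from a point by multiplication with
  \<open>\<plusminus> 1, \<plusminus> i, \<plusminus> j, \<plusminus> k\<close>. By Taylor's formula
  that mean exceeds the value at the centre by a positive multiple of \<open>r\<^sup>2 *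
  line_trace\<close>, up to smaller terms. With a negative trace this contradicts the sub-mean value
  inequality.\<close>

lemma quat_psh_imp_line_trace:
  fixes f :: "quat ^ 'n::finite \<Rightarrow> real"
  assumes \<Omega>: "open \<Omega>" "x \<in> \<Omega>" and f: "Ck 2 \<Omega> f" and psh: "quat_psh_on \<Omega> f"
  shows "0 \<le> line_trace (hess f x) v"
proof (rule ccontr)
  let ?T = "line_trace (hess f x) v" and ?N = "real CARD('n \<times> 4)"
  assume "\<not> 0 \<le> ?T"
  then have T: "?T < 0" by simp
  have v: "v \<noteq> 0"
  proof
    assume "v = 0"
    then have "?T = 0" by (simp add: line_trace_def right_mult_def zero_vec_def[symmetric])
    with T show False by simp
  qed
  \<comment> \<open>The error in the four second differences then uses up half of the trace.\<close>
  define \<epsilon> where "\<epsilon> = - ?T / (8 * ?N * ?N * (norm v)\<^sup>2)"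
  have N: "?N > 0" by simp
  have \<epsilon>: "\<epsilon> > 0" unfolding \<epsilon>_def using T v N by (intro divide_pos_pos mult_pos_pos) auto
  have "\<exists>\<delta>>0. \<forall>y. dist y x < \<delta> \<longrightarrow> \<bar>hess f y e e' - hess f x e e'\<bar> < \<epsilon>" for e e'
  proof -
    have "isCont (\<lambda>y. hess f y e e') x"
      using continuous_on_hess[OF f, of e e'] \<Omega>(2) by (simp add: continuous_on_eq_continuous_at[OF \<Omega>(1)])
    from this[unfolded continuous_at_eps_delta, rule_format, OF \<epsilon>] show ?thesis
      by (simp only: dist_real_def)
  qed
  then obtain d where d: "\<And>e e'. d e e' > 0" "\<And>e e' y. dist y x < d e e' \<Longrightarrow> \<bar>hess f y e e' - hess f x e e'\<bar> < \<epsilon>"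
    by metis
  obtain d0 where d0: "d0 > 0" "ball x d0 \<subseteq> \<Omega>" using \<Omega> open_contains_ball by blast
  define \<delta> where "\<delta> = Min (insert d0 (range (\<lambda>p. d (fst p) (snd p))))"
  have \<delta>: "\<delta> > 0" "\<delta> \<le> d0" "\<And>e e'. \<delta> \<le> d e e'"
  proof -
    have fin: "finite (insert d0 (range (\<lambda>p. d (fst p) (snd p))))" by simp
    show "\<delta> > 0" unfolding \<delta>_def using fin d0(1) d(1) by (subst Min_gr_iff) auto
    show "\<delta> \<le> d0" unfolding \<delta>_def by (rule Min_le[OF fin]) simp
    show "\<delta> \<le> d e e'" for e e'
      unfolding \<delta>_def by (rule Min_le[OF fin], rule insertI2, rule range_eqI[of _ _ "(e, e')"]) simp
  qed
  have upper: "dd w (dd w f) y \<le> dd w (dd w f) x + \<epsilon> * ?N * ?N * (norm w)\<^sup>2" if y: "dist y x < \<delta>" for w y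
  proof -
    have y\<Omega>: "y \<in> \<Omega>" using y \<delta>(2) d0(2) by (auto simp: dist_commute)
    have "dd w (dd w f) y - dd w (dd w f) x = (\<Sum>e\<in>UNIV. \<Sum>e'\<in>UNIV. (hess f y e e' - hess f x e e') * (inner (dirv e) w * inner (dirv e') w))"
      unfolding dd_dd_eq_hess[OF \<Omega>(1) y\<Omega> f] dd_dd_eq_hess[OF \<Omega> f] by (simp add: left_diff_distrib sum_subtractf)
    also have "\<dots> \<le> (\<Sum>e\<in>(UNIV :: ('n \<times> 4) set). \<Sum>e'\<in>(UNIV :: ('n \<times> 4) set). \<epsilon> * (norm w * norm w))"
    proof (intro sum_mono)
      fix e e' :: "'n \<times> 4"
      have "\<bar>inner (dirv e) w\<bar> \<le> norm w" for e :: "'n \<times> 4"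
        using Cauchy_Schwarz_ineq2[of "dirv e" w] inner_dirv_dirv[of e e] by (simp add: norm_eq_sqrt_inner)
      then have "\<bar>hess f y e e' - hess f x e e'\<bar> * (\<bar>inner (dirv e) w\<bar> * \<bar>inner (dirv e') w\<bar>) \<le> \<epsilon> * (norm w * norm w)"
        using d(2)[of y e e'] y \<delta>(3)[of e e'] by (intro mult_mono) auto
      then show "(hess f y e e' - hess f x e e') * (inner (dirv e) w * inner (dirv e') w) \<le> \<epsilon> * (norm w * norm w)"
        by (simp add: abs_mult[symmetric])
    qed
    also have "\<dots> = \<epsilon> * ?N * ?N * (norm w)\<^sup>2" by (simp add: power2_eq_square)
    finally show ?thesis by simp
  qed
  define g where "g l = f (x + right_mult v l)" for l
  define U where "U = {l. x + right_mult v l \<in> \<Omega>}"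
  have sub: "subharmonic_on U g"
    using psh v unfolding quat_psh_on_def U_def g_def[abs_def] by blast
  have "0 \<in> U" using \<Omega>(2) by (simp add: U_def right_mult_def zero_vec_def[symmetric])
  have g0: "g 0 = f x" by (simp add: g_def right_mult_def zero_vec_def[symmetric])
  have nv: "norm v > 0" using v by simp
  have ev: "eventually (\<lambda>r. sphere 0 r \<subseteq> U \<and> set_integrable (sphere_measure 0 r) (sphere 0 r) g \<and>
        g 0 \<le> (LINT y : sphere 0 r | sphere_measure 0 r. g y)) (at_right 0)"
    using sub \<open>0 \<in> U\<close> unfolding subharmonic_on_def by blast
  have "eventually (\<lambda>r. r < \<delta> / norm v \<and> 0 < r) (at_right 0)"
    using \<delta>(1) nv by (auto simp: eventually_at_right intro!: exI[of _ "\<delta> / norm v"])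
  from eventually_happens[OF eventually_conj[OF ev this]]
  obtain r where r: "0 < r" "r < \<delta> / norm v" and int: "set_integrable (sphere_measure 0 r) (sphere 0 r) g"
    and mean: "g 0 \<le> (LINT y : sphere 0 r | sphere_measure 0 r. g y)"
    by (auto simp: trivial_limit_at_right_real)
  let ?M = "sphere_measure (0::quat) r"
  have rv: "norm v * r < \<delta>" using r nv by (simp add: field_simps)
  \<comment> \<open>The eight points are the images of l under a group of rotations preserving the sphere measure.\<close>
  have pt: "(\<Sum>c\<in>UNIV. g (l * qcnj (quat_unit c)) + g (l * - qcnj (quat_unit c))) \<le> 8 * g 0 + r\<^sup>2 * ?T / 2"
    if l: "norm l = r" for l
  proof -
    define w where "w c = right_mult (right_mult v l) (qcnj (quat_unit c))" for c
    have nu: "norm (qcnj (quat_unit c)) = 1" for c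
      using unit_mem_rot_units(3)[of c] by (simp add: rot_units_def)
    have nw: "norm (w c) = norm v * r" for c by (simp add: w_def norm_right_mult l nu)
    have "g (l * qcnj (quat_unit c)) + g (l * - qcnj (quat_unit c)) - 2 * g 0
        \<le> dd (w c) (dd (w c) f) x + \<epsilon> * ?N * ?N * (norm v * r)\<^sup>2" for c
    proof -
      have near: "dist (x + t *\<^sub>R w c) x < \<delta>" if "\<bar>t\<bar> \<le> 1" for t
      proof -
        have "dist (x + t *\<^sub>R w c) x = \<bar>t\<bar> * (norm v * r)" by (simp add: dist_norm nw)
        also have "\<dots> \<le> 1 * (norm v * r)" using that r(1) by (intro mult_right_mono) auto
        finally show ?thesis using rv by simp
      qed
      have "f (x + w c) + f (x - w c) - 2 * f x \<le> dd (w c) (dd (w c) f) x + \<epsilon> * ?N * ?N * (norm v * r)\<^sup>2"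
      proof (rule second_difference[OF \<Omega>(1) f])
        fix t :: real assume t: "\<bar>t\<bar> \<le> 1"
        show "x + t *\<^sub>R w c \<in> \<Omega>" using near[OF t] \<delta>(2) d0(2) by (auto simp: dist_commute)
        show "dd (w c) (dd (w c) f) (x + t *\<^sub>R w c) \<le> dd (w c) (dd (w c) f) x + \<epsilon> * ?N * ?N * (norm v * r)\<^sup>2"
          using upper[OF near[OF t], of "w c"] by (simp add: nw)
      qed
      then show ?thesis unfolding g0 by (simp add: g_def w_def right_mult_right_mult right_mult_minus)
    qed
    then have "(\<Sum>c\<in>UNIV. g (l * qcnj (quat_unit c)) + g (l * - qcnj (quat_unit c)) - 2 * g 0)
        \<le> (\<Sum>c\<in>(UNIV :: 4 set). dd (w c) (dd (w c) f) x + \<epsilon> * ?N * ?N * (norm v * r)\<^sup>2)"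
      by (rule sum_mono)
    also have "\<dots> = line_trace (hess f x) (right_mult v l) + 4 * (\<epsilon> * ?N * ?N * (norm v * r)\<^sup>2)"
      unfolding dd_dd_eq_hess[OF \<Omega> f] w_def line_trace_def by (simp add: sum.distrib)
    also have "\<dots> = r\<^sup>2 * ?T + 4 * (\<epsilon> * ?N * ?N * (norm v * r)\<^sup>2)"
      by (simp add: line_trace_right_mult l)
    also have "4 * (\<epsilon> * ?N * ?N * (norm v * r)\<^sup>2) = - (r\<^sup>2 * ?T / 2)"
      using nv N unfolding \<epsilon>_def by (simp add: field_simps power2_eq_square)
    finally show ?thesis by (simp add: sum_subtractf field_simps)
  qed
  have sM: "sets ?M = sets borel" by (rule sphere_measure_sphere(2)[OF r(1)])
  define G where "G y = indicator (sphere 0 r) y * g y" for y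
  have iG: "integrable ?M G" using int by (simp add: set_integrable_def G_def[abs_def])
  have rot: "integrable ?M (\<lambda>y. G (y * p)) \<and> (LINT y|?M. G (y * p)) = (LINT y|?M. G y)" if p: "p \<in> rot_units" for p
  proof -
    have mG: "G \<in> borel_measurable borel" using iG sM by (metis borel_measurable_integrable measurable_cong_sets)
    have mp: "(\<lambda>y. y * p) \<in> measurable ?M borel"
      using borel_measurable_right_mult[of p] sM by (metis measurable_cong_sets)
    show ?thesis
      using integrable_distr_eq[OF mp mG] integral_distr[OF mp mG] sphere_measure_rot[OF p, of r] iG by simp
  qed
  have "8 * g 0 \<le> (\<Sum>c\<in>(UNIV :: 4 set). (LINT y|?M. G y) + (LINT y|?M. G y))"
    using mean by (simp add: set_lebesgue_integral_def G_def[abs_def])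
  also have "\<dots> = (\<Sum>c\<in>UNIV. (LINT y|?M. G (y * qcnj (quat_unit c))) + (LINT y|?M. G (y * - qcnj (quat_unit c))))"
    using rot[OF unit_mem_rot_units(3)] rot[OF unit_mem_rot_units(4)] by simp
  also have "\<dots> = (LINT y|?M. (\<Sum>c\<in>UNIV. G (y * qcnj (quat_unit c)) + G (y * - qcnj (quat_unit c))))"
    using rot[OF unit_mem_rot_units(3)] rot[OF unit_mem_rot_units(4)]
    by (simp add: Bochner_Integration.integral_sum Bochner_Integration.integral_add del: mult_minus_right)
  also have "\<dots> \<le> (LINT y|?M. indicator (sphere 0 r) y * (8 * g 0 + r\<^sup>2 * ?T / 2))"
  proof (rule integral_mono)
    show "integrable ?M (\<lambda>y. \<Sum>c\<in>UNIV. G (y * qcnj (quat_unit c)) + G (y * - qcnj (quat_unit c)))"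
      using rot[OF unit_mem_rot_units(3)] rot[OF unit_mem_rot_units(4)] by (simp del: mult_minus_right)
    show "integrable ?M (\<lambda>y. indicator (sphere 0 r) y * (8 * g 0 + r\<^sup>2 * ?T / 2))"
      using sM sphere_measure_sphere(1)[OF r(1)]
      by (intro integrable_mult_left integrable_real_indicator) auto
    fix y
    have nu: "norm (y * qcnj (quat_unit c)) = norm y" "norm (y * - qcnj (quat_unit c)) = norm y" for c
      using unit_mem_rot_units(3,4)[of c] by (simp_all only: rot_units_def norm_mult mem_Collect_eq mult_1_right)
    show "(\<Sum>c\<in>UNIV. G (y * qcnj (quat_unit c)) + G (y * - qcnj (quat_unit c))) \<le> indicator (sphere 0 r) y * (8 * g 0 + r\<^sup>2 * ?T / 2)"
    proof (cases "norm y = r")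
      case True
      have "G (y * qcnj (quat_unit c)) = g (y * qcnj (quat_unit c))" "G (y * - qcnj (quat_unit c)) = g (y * - qcnj (quat_unit c))" for c
        unfolding G_def using nu[of c] True by (simp_all del: mult_minus_right)
      then show ?thesis using pt[OF True] True by (simp del: mult_minus_right)
    next
      case False
      have "G (y * qcnj (quat_unit c)) = 0" "G (y * - qcnj (quat_unit c)) = 0" for c
        unfolding G_def using nu[of c] False by (simp_all del: mult_minus_right)
      then show ?thesis using False by (simp del: mult_minus_right)
    qed
  qed
  also have "\<dots> = 8 * g 0 + r\<^sup>2 * ?T / 2"
    using sphere_measure_sphere(1)[OF r(1)] sM by (simp add: measure_def)
  finally have "0 \<le> r\<^sup>2 * ?T" by simp
  then show False using T r(1) by (simp add: zero_le_mult_iff)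
qed

lemma quat_psh_imp_psh2:
  assumes "open \<Omega>" "C2_on \<Omega> f" "quat_psh_on \<Omega> f"
  shows "psh2 \<Omega> f"
  unfolding psh2_def
proof (intro conjI ballI allI)
  show C: "Ck 2 \<Omega> f" by (rule C2_on_imp_Ck[OF assms(1,2)])
  show "0 \<le> line_trace (hess f x) v" if "x \<in> \<Omega>" for x v
    by (rule quat_psh_imp_line_trace[OF assms(1) that C assms(3)])
qed

section \<open>Positive functionals on test functions\<close>

lemma test_function_onI:
  assumes "continuous_on UNIV \<phi>" "compact K" "K \<subseteq> \<Omega>" "\<And>x. x \<notin> K \<Longrightarrow> \<phi> x = 0"
  shows "test_function_on \<Omega> \<phi>"
proof -
  have "closure {x. \<phi> x \<noteq> 0} \<subseteq> K"
    using assms by (intro closure_minimal) (auto simp: compact_imp_closed)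
  moreover from this have "compact (closure {x. \<phi> x \<noteq> 0})"
    using assms(2) closed_closure compact_Int_closed by (metis inf.absorb_iff2)
  ultimately show ?thesis using assms(1,3) by (auto simp: test_function_on_def)
qed

lemma test_function_onE:
  assumes "test_function_on \<Omega> \<phi>"
  obtains K where "continuous_on UNIV \<phi>" "compact K" "K \<subseteq> \<Omega>" "\<And>x. x \<notin> K \<Longrightarrow> \<phi> x = 0"
  using assms closure_subset[of "{x. \<phi> x \<noteq> 0}"] unfolding test_function_on_def by blast

lemma test_function_on_eq_0: "test_function_on \<Omega> \<phi> \<Longrightarrow> x \<notin> \<Omega> \<Longrightarrow> \<phi> x = 0"
  by (meson test_function_onE subsetD)

lemma test_function_on_dominated:
  assumes "test_function_on \<Omega> \<phi>" "continuous_on UNIV \<psi>" "\<And>x. \<phi> x = 0 \<Longrightarrow> \<psi> x = 0"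
  shows "test_function_on \<Omega> \<psi>"
  using assms by (meson test_function_onE test_function_onI)

lemma test_function_on_add:
  assumes "test_function_on \<Omega> \<phi>" "test_function_on \<Omega> \<psi>"
  shows "test_function_on \<Omega> (\<lambda>x. \<phi> x + \<psi> x)"
proof -
  obtain K where K: "continuous_on UNIV \<phi>" "compact K" "K \<subseteq> \<Omega>" "\<And>x. x \<notin> K \<Longrightarrow> \<phi> x = 0"
    using test_function_onE[OF assms(1)] by metis
  obtain L where L: "continuous_on UNIV \<psi>" "compact L" "L \<subseteq> \<Omega>" "\<And>x. x \<notin> L \<Longrightarrow> \<psi> x = 0"
    using test_function_onE[OF assms(2)] by metis
  show ?thesis
    by (rule test_function_onI[of _ "K \<union> L"]) (use K L in \<open>auto intro: continuous_on_add\<close>)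
qed

lemma test_function_on_cmult:
  assumes "test_function_on \<Omega> \<phi>"
  shows "test_function_on \<Omega> (\<lambda>x. c * \<phi> x)"
  using assms by (intro test_function_on_dominated[OF assms] continuous_on_mult continuous_on_const)
    (auto simp: test_function_on_def)

locale positive_functional =
  fixes \<Omega> :: "'a::euclidean_space set" and I :: "('a \<Rightarrow> real) \<Rightarrow> real"
  assumes \<Omega>: "open \<Omega>"
    and add: "test_function_on \<Omega> \<phi> \<Longrightarrow> test_function_on \<Omega> \<psi> \<Longrightarrow> I (\<lambda>x. \<phi> x + \<psi> x) = I \<phi> + I \<psi>"
    and cmult: "test_function_on \<Omega> \<phi> \<Longrightarrow> I (\<lambda>x. c * \<phi> x) = c * I \<phi>"
    and pos: "test_function_on \<Omega> \<phi> \<Longrightarrow> (\<And>x. 0 \<le> \<phi> x) \<Longrightarrow> 0 \<le> I \<phi>"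
begin

lemma mono:
  assumes "test_function_on \<Omega> \<phi>" "test_function_on \<Omega> \<psi>" "\<And>x. \<phi> x \<le> \<psi> x"
  shows "I \<phi> \<le> I \<psi>"
proof -
  have t: "test_function_on \<Omega> (\<lambda>x. (-1) * \<phi> x)" by (rule test_function_on_cmult[OF assms(1)])
  have "0 \<le> I (\<lambda>x. \<psi> x + (-1) * \<phi> x)"
    using assms(3) by (intro pos test_function_on_add assms(2) t) simp
  then show ?thesis using add[OF assms(2) t] cmult[OF assms(1), of "-1"] by simp
qed

lemma I_0: "I (\<lambda>_. 0) = 0"
proof -
  have "test_function_on \<Omega> (\<lambda>_. 0)" by (rule test_function_onI[of _ "{}"]) auto
  from cmult[OF this, of 0] show ?thesis by simp
qed

lemma sum:
  assumes "finite J" "\<And>j. j \<in> J \<Longrightarrow> test_function_on \<Omega> (\<phi> j)"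
  shows "test_function_on \<Omega> (\<lambda>x. \<Sum>j\<in>J. \<phi> j x) \<and> I (\<lambda>x. \<Sum>j\<in>J. \<phi> j x) = (\<Sum>j\<in>J. I (\<phi> j))"
  using assms
proof (induction J rule: finite_induct)
  case empty
  show ?case using I_0 by (auto intro: test_function_onI[of _ "{}"])
next
  case (insert j J)
  then show ?case using add[of "\<phi> j" "\<lambda>x. \<Sum>j\<in>J. \<phi> j x"] test_function_on_add[of \<Omega> "\<phi> j" "\<lambda>x. \<Sum>j\<in>J. \<phi> j x"] by simp
qed

text \<open>The test functions between \<open>0\<close> and the indicator of \<open>U\<close>. They
  vanish outside \<open>\<Omega>\<close>, so that \<open>mass\<close> is defined for subsets of the
  whole space and concentrated on \<open>\<Omega>\<close>.\<close>

definition adm :: "'a set \<Rightarrow> ('a \<Rightarrow> real) set" where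
  "adm U = {\<phi>. test_function_on \<Omega> \<phi> \<and> (\<forall>x. 0 \<le> \<phi> x \<and> \<phi> x \<le> 1) \<and> (\<forall>x. x \<notin> U \<longrightarrow> \<phi> x = 0)}"

definition mass :: "'a set \<Rightarrow> ennreal" where
  "mass U = (SUP \<phi>\<in>adm U. ennreal (I \<phi>))"

definition outer :: "'a set \<Rightarrow> ennreal" where
  "outer X = (INF U\<in>{U. open U \<and> X \<subseteq> U}. mass U)"

lemma le_mass: "\<phi> \<in> adm U \<Longrightarrow> ennreal (I \<phi>) \<le> mass U"
  unfolding mass_def by (rule SUP_upper)

lemma mass_mono: "U \<subseteq> V \<Longrightarrow> mass U \<le> mass V"
  unfolding mass_def by (rule SUP_subset_mono) (auto simp: adm_def)

lemma outer_le: "open U \<Longrightarrow> X \<subseteq> U \<Longrightarrow> outer X \<le> mass U"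
  unfolding outer_def by (rule INF_lower) auto

lemma outer_open: "open U \<Longrightarrow> outer U = mass U"
  by (rule antisym[OF outer_le]) (auto simp: outer_def intro!: INF_greatest mass_mono)

lemma outer_mono: "X \<subseteq> Y \<Longrightarrow> outer X \<le> outer Y"
  unfolding outer_def by (rule INF_superset_mono) auto

lemma adm_nonempty: "adm U \<noteq> {}"
proof -
  have "test_function_on \<Omega> (\<lambda>_. 0)" by (rule test_function_onI[of _ "{}"]) auto
  then have "(\<lambda>_. 0) \<in> adm U" by (simp add: adm_def)
  then show ?thesis by blast
qed

lemma mass_empty: "mass {} = 0"
proof -
  have "ennreal (I \<phi>) = 0" if "\<phi> \<in> adm {}" for \<phi>
  proof -
    have "\<phi> = (\<lambda>_. 0)" using that by (auto simp: adm_def)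
    then show ?thesis using I_0 by simp
  qed
  then show ?thesis unfolding mass_def
    by (intro antisym SUP_least) auto
qed

lemma adm_continuous: "\<phi> \<in> adm U \<Longrightarrow> continuous_on UNIV \<phi>"
  by (simp add: adm_def test_function_on_def)

text \<open>Cutting an admissible function off at a small level makes its support a compact part of the
  open set, at a cost that tends to zero with the level.\<close>

lemma shrink:
  assumes "\<phi> \<in> adm U"
  obtains c where "c \<ge> 0" "\<And>e. 0 < e \<Longrightarrow> (\<lambda>x. max 0 (\<phi> x - e)) \<in> adm U"
    "\<And>e. 0 < e \<Longrightarrow> compact {x. e \<le> \<phi> x}" "\<And>e. 0 < e \<Longrightarrow> I \<phi> \<le> I (\<lambda>x. max 0 (\<phi> x - e)) + e * c"
proof -
  have t: "test_function_on \<Omega> \<phi>" and b: "\<And>x. 0 \<le> \<phi> x" "\<And>x. \<phi> x \<le> 1" and 0: "\<And>x. x \<notin> U \<Longrightarrow> \<phi> x = 0"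
    using assms by (auto simp: adm_def)
  obtain K where K: "continuous_on UNIV \<phi>" "compact K" "K \<subseteq> \<Omega>" "\<And>x. x \<notin> K \<Longrightarrow> \<phi> x = 0"
    using test_function_onE[OF t] by metis
  obtain \<theta> L where \<theta>: "Ck 2 UNIV \<theta>" "compact L" "L \<subseteq> \<Omega>" "\<And>x. 0 \<le> \<theta> x" "\<And>x. x \<in> K \<Longrightarrow> 1 \<le> \<theta> x"
      "\<And>x. x \<notin> L \<Longrightarrow> \<theta> x = 0"
    using exists_bump[OF \<Omega> K(2,3)] by metis
  have t\<theta>: "test_function_on \<Omega> \<theta>"
    by (rule test_function_onI[OF Ck_continuous[OF \<theta>(1)] \<theta>(2,3,6)])
  show ?thesis
  proof (rule that[of "I \<theta>"])
    show "0 \<le> I \<theta>" by (rule pos[OF t\<theta> \<theta>(4)])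
    fix e :: real assume e: "0 < e"
    have te: "test_function_on \<Omega> (\<lambda>x. max 0 (\<phi> x - e))"
      by (rule test_function_on_dominated[OF t]) (use K(1) e in \<open>auto intro!: continuous_intros\<close>)
    show "(\<lambda>x. max 0 (\<phi> x - e)) \<in> adm U"
    proof -
      have "\<phi> x - e \<le> 1" for x using b(2)[of x] e by linarith
      then show ?thesis using te 0 e by (auto simp: adm_def)
    qed
    have "{x. e \<le> \<phi> x} = K \<inter> {x. e \<le> \<phi> x}" using K(4) e by force
    moreover have "closed {x. e \<le> \<phi> x}" by (rule closed_Collect_le[OF continuous_on_const K(1)])
    ultimately show "compact {x. e \<le> \<phi> x}" using compact_Int_closed[OF K(2)] by metis
    have "\<phi> x \<le> max 0 (\<phi> x - e) + e * \<theta> x" for x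
    proof (cases "x \<in> K")
      case True
      then have "e * 1 \<le> e * \<theta> x" using e \<theta>(5) by (intro mult_left_mono) auto
      then show ?thesis by simp
    next
      case False
      then show ?thesis using K(4)[of x] e \<theta>(4)[of x] by simp
    qed
    then have "I \<phi> \<le> I (\<lambda>x. max 0 (\<phi> x - e) + e * \<theta> x)"
      by (intro mono t test_function_on_add te test_function_on_cmult t\<theta>)
    also have "\<dots> = I (\<lambda>x. max 0 (\<phi> x - e)) + e * I \<theta>"
      by (simp add: add[OF te test_function_on_cmult[OF t\<theta>]] cmult[OF t\<theta>])
    finally show "I \<phi> \<le> I (\<lambda>x. max 0 (\<phi> x - e)) + e * I \<theta>" .
  qed
qed

text \<open>An estimate for all cut-off functions carries over to \<open>\<phi>\<close>, because
  their values under the functional tend to that of \<open>\<phi>\<close>.\<close>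

lemma le_mass_of_shrinking:
  assumes "\<phi> \<in> adm U" and le: "\<And>e. 0 < e \<Longrightarrow> ennreal (I (\<lambda>x. max 0 (\<phi> x - e))) + a \<le> b"
  shows "ennreal (I \<phi>) + a \<le> b"
proof (rule ennreal_le_epsilon)
  fix d :: real assume d: "0 < d"
  obtain c where c: "c \<ge> 0" "\<And>e. 0 < e \<Longrightarrow> (\<lambda>x. max 0 (\<phi> x - e)) \<in> adm U"
    "\<And>e. 0 < e \<Longrightarrow> compact {x. e \<le> \<phi> x}" "\<And>e. 0 < e \<Longrightarrow> I \<phi> \<le> I (\<lambda>x. max 0 (\<phi> x - e)) + e * c"
    using shrink[OF assms(1)] by metis
  define e where "e = d / (c + 1)"
  have e: "e > 0" using d c(1) by (simp add: e_def)
  have "e * c \<le> d" using d c(1) by (simp add: e_def field_simps)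
  then have "I \<phi> \<le> I (\<lambda>x. max 0 (\<phi> x - e)) + d" using c(4)[OF e] by linarith
  moreover have "0 \<le> I (\<lambda>x. max 0 (\<phi> x - e))" using c(2)[OF e] by (intro pos) (auto simp: adm_def)
  ultimately have "ennreal (I \<phi>) \<le> ennreal (I (\<lambda>x. max 0 (\<phi> x - e))) + ennreal d"
    using d by (metis ennreal_leI ennreal_plus less_imp_le)
  then have "ennreal (I \<phi>) + a \<le> (ennreal (I (\<lambda>x. max 0 (\<phi> x - e))) + ennreal d) + a"
    by (rule add_right_mono)
  also have "\<dots> = (ennreal (I (\<lambda>x. max 0 (\<phi> x - e))) + a) + ennreal d" by (simp add: add_ac)
  also have "\<dots> \<le> b + ennreal d" using le[OF e] by (rule add_right_mono)
  finally show "ennreal (I \<phi>) + a \<le> b + ennreal d" .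
qed

text \<open>A continuous function that is positive exactly on \<open>U\<close>; the case distinction
  is due to the distance from the empty set being zero.\<close>

definition depth :: "'a set \<Rightarrow> 'a \<Rightarrow> real" where
  "depth U x = (if U = UNIV then 1 else infdist x (- U))"

lemma depth_properties:
  assumes "open U"
  shows "continuous_on UNIV (depth U)" "0 \<le> depth U x" "x \<notin> U \<Longrightarrow> depth U x = 0" "x \<in> U \<Longrightarrow> 0 < depth U x"
proof -
  show "continuous_on UNIV (depth U)"
    by (cases "U = UNIV") (auto simp: depth_def[abs_def] intro!: continuous_intros)
  show "0 \<le> depth U x" by (simp add: depth_def infdist_nonneg)
  show "x \<notin> U \<Longrightarrow> depth U x = 0" by (auto simp: depth_def)
  show "0 < depth U x" if "x \<in> U"
  proof (cases "U = UNIV")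
    case False
    then have "- U \<noteq> {}" "closed (- U)" using assms by auto
    then have "infdist x (- U) \<noteq> 0" using that in_closed_iff_infdist_zero by blast
    then show ?thesis using False infdist_nonneg[of x "- U"] by (simp add: depth_def)
  qed (simp add: depth_def)
qed

text \<open>A cut-off function lives on a compact set, on which the first \<open>k\<close> of the
  functions \<open>k * depth (U i)\<close> add up to more than one if \<open>k\<close> is large.
  Cutting \<open>\<phi>\<close> off at these functions gives pieces subordinate to finitely many
  \<open>U i\<close>, whose sum dominates \<open>\<phi>\<close> on that compact set.\<close>

lemma mass_countable_subadditive:
  fixes U :: "nat \<Rightarrow> 'a set"
  assumes U: "\<And>i. open (U i)"
  shows "mass (\<Union>i. U i) \<le> (\<Sum>i. mass (U i))"
  unfolding mass_def[of "\<Union>i. U i"]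
proof (rule SUP_least)
  fix \<phi> assume \<phi>: "\<phi> \<in> adm (\<Union>i. U i)"
  have t: "test_function_on \<Omega> \<phi>" and b: "\<And>x. 0 \<le> \<phi> x" "\<And>x. \<phi> x \<le> 1" and 0: "\<And>x. x \<notin> (\<Union>i. U i) \<Longrightarrow> \<phi> x = 0"
    using \<phi> by (auto simp: adm_def)
  have c\<phi>: "continuous_on UNIV \<phi>" by (rule adm_continuous[OF \<phi>])
  have "ennreal (I \<phi>) + 0 \<le> (\<Sum>i. mass (U i))"
  proof (rule le_mass_of_shrinking[OF \<phi>])
    fix e :: real assume e: "0 < e"
    define W where "W k = {x. 1 < (\<Sum>i<k. real k * depth (U i) x)}" for k
    have comp: "compact {x. e \<le> \<phi> x}" and ad: "(\<lambda>x. max 0 (\<phi> x - e)) \<in> adm (\<Union>i. U i)"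
      using shrink[OF \<phi>] e by metis+
    have oW: "open (W k)" for k
      unfolding W_def by (intro open_Collect_less continuous_intros depth_properties U)
    have mW: "W k \<subseteq> W l" if "k \<le> l" for k l
    proof
      fix x assume "x \<in> W k"
      then have "1 < (\<Sum>i<k. real k * depth (U i) x)" by (simp add: W_def)
      also have "\<dots> \<le> (\<Sum>i<k. real l * depth (U i) x)"
        using that depth_properties(2)[OF U] by (intro sum_mono mult_right_mono) auto
      also have "\<dots> \<le> (\<Sum>i<l. real l * depth (U i) x)"
        using that depth_properties(2)[OF U] by (intro sum_mono2) auto
      finally show "x \<in> W l" by (simp add: W_def)
    qed
    have cover: "{x. e \<le> \<phi> x} \<subseteq> (\<Union>k. W k)"
    proof
      fix x assume "x \<in> {x. e \<le> \<phi> x}"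
      then obtain i where i: "x \<in> U i" using 0[of x] e by fastforce
      have d: "0 < depth (U i) x" by (rule depth_properties(4)[OF U i])
      obtain k where k: "real k > max (1 / depth (U i) x) (real i)" using reals_Archimedean2 by blast
      then have "1 < real k * depth (U i) x" using d by (simp add: field_simps)
      also have "\<dots> \<le> (\<Sum>i<k. real k * depth (U i) x)"
        using k depth_properties(2)[OF U] by (intro member_le_sum) auto
      finally show "x \<in> (\<Union>k. W k)" by (auto simp: W_def)
    qed
    obtain F where F: "finite F" "{x. e \<le> \<phi> x} \<subseteq> (\<Union>k\<in>F. W k)"
      using compactE_image[OF comp oW cover] by metis
    define k where "k = Max (insert 0 F)"
    have k: "{x. e \<le> \<phi> x} \<subseteq> W k"
    proof -
      have "W l \<subseteq> W k" if "l \<in> F" for l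
        using that F(1) by (intro mW) (simp add: k_def)
      then show ?thesis using F(2) by blast
    qed
    define \<psi> where "\<psi> i x = min (\<phi> x) (real k * depth (U i) x)" for i x
    have t\<psi>: "test_function_on \<Omega> (\<psi> i)" for i
    proof (rule test_function_on_dominated[OF t])
      show "continuous_on UNIV (\<psi> i)"
        unfolding \<psi>_def[abs_def] by (intro continuous_intros c\<phi> depth_properties U)
      show "\<psi> i x = 0" if "\<phi> x = 0" for x
        using that depth_properties(2)[OF U] by (simp add: \<psi>_def)
    qed
    have a\<psi>: "\<psi> i \<in> adm (U i)" for i
      using t\<psi> b depth_properties(2,3)[OF U] by (auto simp: adm_def \<psi>_def min_le_iff_disj)
    have le: "max 0 (\<phi> x - e) \<le> (\<Sum>i<k. \<psi> i x)" for x
    proof (cases "e \<le> \<phi> x")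
      case False
      moreover have "0 \<le> (\<Sum>i<k. \<psi> i x)"
        using a\<psi> by (intro sum_nonneg) (auto simp: adm_def)
      ultimately show ?thesis by simp
    next
      case True
      have "\<phi> x \<le> (\<Sum>i<k. \<psi> i x)"
      proof (cases "\<exists>i<k. \<phi> x \<le> real k * depth (U i) x")
        case True
        then obtain i where "i < k" "\<psi> i x = \<phi> x" by (auto simp: \<psi>_def)
        then show ?thesis
          using member_le_sum[of i "{..<k}" "\<lambda>i. \<psi> i x"] a\<psi> by (auto simp: adm_def)
      next
        case False
        then have "(\<Sum>i<k. \<psi> i x) = (\<Sum>i<k. real k * depth (U i) x)"
          by (intro sum.cong) (auto simp: \<psi>_def)
        moreover have "1 < (\<Sum>i<k. real k * depth (U i) x)" using True k by (auto simp: W_def)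
        ultimately show ?thesis using b(2)[of x] by linarith
      qed
      then show ?thesis using True e by simp
    qed
    have "I (\<lambda>x. max 0 (\<phi> x - e)) \<le> I (\<lambda>x. \<Sum>i<k. \<psi> i x)"
      using ad sum[of "{..<k}" \<psi>] t\<psi> le by (intro mono) (auto simp: adm_def)
    also have "\<dots> = (\<Sum>i<k. I (\<psi> i))" using sum[of "{..<k}" \<psi>] t\<psi> by simp
    finally have "ennreal (I (\<lambda>x. max 0 (\<phi> x - e))) \<le> ennreal (\<Sum>i<k. I (\<psi> i))" by (rule ennreal_leI)
    also have "\<dots> = (\<Sum>i<k. ennreal (I (\<psi> i)))"
      using a\<psi> by (intro sum_ennreal[symmetric] pos) (auto simp: adm_def)
    also have "\<dots> \<le> (\<Sum>i<k. mass (U i))" by (intro sum_mono le_mass a\<psi>)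
    also have "\<dots> \<le> (\<Sum>i. mass (U i))" by (rule sum_le_suminf) auto
    finally show "ennreal (I (\<lambda>x. max 0 (\<phi> x - e))) + 0 \<le> (\<Sum>i. mass (U i))" by simp
  qed
  then show "ennreal (I \<phi>) \<le> (\<Sum>i. mass (U i))" by simp
qed

lemma outer_measure_space_outer: "outer_measure_space (Pow UNIV) outer"
  unfolding outer_measure_space_def
proof (intro conjI)
  show "positive (Pow UNIV) outer"
    by (simp add: positive_def outer_open mass_empty)
  show "increasing (Pow UNIV) outer"
    by (auto simp: increasing_def intro: outer_mono)
  show "countably_subadditive (Pow UNIV) outer"
    unfolding countably_subadditive_def
  proof (intro allI impI)
    fix A :: "nat \<Rightarrow> 'a set"
    show "outer (\<Union>i. A i) \<le> (\<Sum>i. outer (A i))"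
    proof (rule ennreal_le_epsilon)
      fix e :: real assume e: "0 < e" and fin: "(\<Sum>i. outer (A i)) < top"
      have "\<exists>U. open U \<and> A i \<subseteq> U \<and> mass U \<le> outer (A i) + ennreal (e * (1/2) ^ Suc i)" for i
      proof -
        have "outer (A i) < top"
          using fin sum_le_suminf[of "\<lambda>i. outer (A i)" "{i}"] by (auto simp: less_top[symmetric] top_unique)
        then have "outer (A i) < outer (A i) + ennreal (e * (1/2) ^ Suc i)"
          using e by (cases "outer (A i)") (auto simp flip: ennreal_plus intro!: ennreal_lessI add_nonneg_pos)
        then obtain U where "U \<in> {U. open U \<and> A i \<subseteq> U}" "mass U < outer (A i) + ennreal (e * (1/2) ^ Suc i)"
          unfolding outer_def[of "A i"] INF_less_iff by blast
        then show ?thesis by (auto intro: less_imp_le)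
      qed
      then obtain U where U: "\<And>i. open (U i)" "\<And>i. A i \<subseteq> U i" "\<And>i. mass (U i) \<le> outer (A i) + ennreal (e * (1/2) ^ Suc i)"
        by metis
      have "outer (\<Union>i. A i) \<le> mass (\<Union>i. U i)"
        using U(1,2) by (intro outer_le) auto
      also have "\<dots> \<le> (\<Sum>i. mass (U i))" by (rule mass_countable_subadditive[OF U(1)])
      also have "\<dots> \<le> (\<Sum>i. outer (A i) + ennreal (e * (1/2) ^ Suc i))"
        by (intro suminf_le U(3)) auto
      also have "\<dots> = (\<Sum>i. outer (A i)) + (\<Sum>i. ennreal (e * (1/2) ^ Suc i))"
        by (intro suminf_add[symmetric]) auto
      also have "(\<Sum>i. ennreal (e * (1/2) ^ Suc i)) = ennreal e"
      proof -
        have "(\<lambda>i. e * (1/2) ^ Suc i) sums (e * 1)" by (intro sums_mult power_half_series)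
        then show ?thesis using e by (subst suminf_ennreal_eq) (auto intro: sums_ennreal[THEN iffD2])
      qed
      finally show "outer (\<Union>i. A i) \<le> (\<Sum>i. outer (A i)) + ennreal e" .
    qed
  qed
qed

lemma outer_subadditive:
  assumes "X \<inter> Y = {}"
  shows "outer (X \<union> Y) \<le> outer X + outer Y"
proof -
  interpret P: sigma_algebra "UNIV :: 'a set" "Pow UNIV" by (rule sigma_algebra_Pow)
  have "subadditive (Pow UNIV) outer"
    using outer_measure_space_outer unfolding outer_measure_space_def
    by (metis P.countably_subadditive_subadditive)
  then show ?thesis using assms by (simp add: subadditive_def)
qed

text \<open>If \<open>\<phi>\<close> is subordinate to \<open>U \<inter> V\<close>, then after
  cutting off it can be added to any function subordinate to the complement in \<open>V\<close> of a
  compact superlevel set, and the sum is still subordinate to \<open>V\<close>. That complement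
  contains \<open>V - U\<close>.\<close>

lemma open_caratheodory:
  assumes U: "open U"
  shows "U \<in> lambda_system UNIV (Pow UNIV) outer"
proof -
  have "outer (U \<inter> X) + outer ((UNIV - U) \<inter> X) = outer X" for X
  proof (rule antisym)
    show "outer X \<le> outer (U \<inter> X) + outer ((UNIV - U) \<inter> X)"
    proof -
      have "U \<inter> X \<union> (UNIV - U) \<inter> X = X" "U \<inter> X \<inter> ((UNIV - U) \<inter> X) = {}" by auto
      then show ?thesis using outer_subadditive[of "U \<inter> X" "(UNIV - U) \<inter> X"] by simp
    qed
    show "outer (U \<inter> X) + outer ((UNIV - U) \<inter> X) \<le> outer X"
      unfolding outer_def[of X]
    proof (rule INF_greatest)
      fix V assume "V \<in> {V. open V \<and> X \<subseteq> V}"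
      then have V: "open V" "X \<subseteq> V" by auto
      have "outer (U \<inter> X) + outer ((UNIV - U) \<inter> X) \<le> mass (U \<inter> V) + outer (V - U)"
        using U V by (intro add_mono outer_le outer_mono) auto
      also have "\<dots> \<le> mass V"
      proof -
        have "ennreal (I \<phi>) + outer (V - U) \<le> mass V" if \<phi>: "\<phi> \<in> adm (U \<inter> V)" for \<phi>
        proof (rule le_mass_of_shrinking[OF \<phi>])
          fix e :: real assume e: "0 < e"
          let ?K = "{x. e \<le> \<phi> x}" and ?\<phi> = "\<lambda>x. max 0 (\<phi> x - e)"
          have comp: "compact ?K" and ad: "?\<phi> \<in> adm (U \<inter> V)" using shrink[OF \<phi>] e by metis+
          have KU: "?K \<subseteq> U" using \<phi> e by (force simp: adm_def)
          have o: "open (V - ?K)" using V(1) comp by (intro open_Diff compact_imp_closed)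
          have "ennreal (I ?\<phi>) + ennreal (I \<psi>) \<le> mass V" if \<psi>: "\<psi> \<in> adm (V - ?K)" for \<psi>
          proof -
            have "(\<lambda>x. ?\<phi> x + \<psi> x) \<in> adm V"
              unfolding adm_def
            proof (intro CollectI conjI allI impI)
              show "test_function_on \<Omega> (\<lambda>x. ?\<phi> x + \<psi> x)"
                using ad \<psi> by (intro test_function_on_add) (auto simp: adm_def)
              fix x
              show "0 \<le> ?\<phi> x + \<psi> x" using \<psi> by (auto simp: adm_def)
              show "?\<phi> x + \<psi> x \<le> 1"
              proof (cases "x \<in> ?K")
                case True
                then have "\<psi> x = 0" using \<psi> by (auto simp: adm_def)
                then show ?thesis using ad by (auto simp: adm_def)
              next
                case False
                then have "?\<phi> x = 0" by auto
                then show ?thesis using \<psi> by (auto simp: adm_def)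
              qed
              assume "x \<notin> V"
              then show "?\<phi> x + \<psi> x = 0" using ad \<psi> by (auto simp: adm_def)
            qed
            from le_mass[OF this] show ?thesis
              using ad \<psi> add[of ?\<phi> \<psi>] pos[of ?\<phi>] pos[of \<psi>] by (simp add: adm_def)
          qed
          then have "(SUP \<psi>\<in>adm (V - ?K). ennreal (I ?\<phi>) + ennreal (I \<psi>)) \<le> mass V"
            by (rule SUP_least)
          then have "ennreal (I ?\<phi>) + mass (V - ?K) \<le> mass V"
            unfolding mass_def[of "V - ?K"] ennreal_SUP_add_right[OF adm_nonempty] .
          moreover have "outer (V - U) \<le> mass (V - ?K)"
            using KU by (intro outer_le o) auto
          ultimately show "ennreal (I ?\<phi>) + outer (V - U) \<le> mass V"
            by (meson add_left_mono order_trans)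
        qed
        then have "(SUP \<phi>\<in>adm (U \<inter> V). ennreal (I \<phi>) + outer (V - U)) \<le> mass V"
          by (rule SUP_least)
        then show ?thesis
          unfolding mass_def[of "U \<inter> V"] ennreal_SUP_add_left[OF adm_nonempty] .
      qed
      finally show "outer (U \<inter> X) + outer ((UNIV - U) \<inter> X) \<le> mass V" .
    qed
  qed
  then show ?thesis by (simp add: lambda_system_def)
qed

definition riesz_measure :: "'a measure" where
  "riesz_measure = measure_of UNIV (sets borel) outer"

text \<open>Open sets satisfy Caratheodory's condition, so all Borel sets do, and on them the outer
  measure is a measure.\<close>

lemma riesz_measure_outer: "space riesz_measure = UNIV" "sets riesz_measure = sets borel" "A \<in> sets borel \<Longrightarrow> emeasure riesz_measure A = outer A"
proof -
  interpret P: sigma_algebra "UNIV :: 'a set" "Pow UNIV" by (rule sigma_algebra_Pow)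
  have L: "measure_space UNIV (lambda_system UNIV (Pow UNIV) outer) outer"
    by (rule P.caratheodory_lemma[OF outer_measure_space_outer])
  then have "sigma_algebra UNIV (lambda_system UNIV (Pow UNIV) outer)" by (simp add: measure_space_def)
  then have "sigma_sets UNIV {U :: 'a set. open U} \<subseteq> lambda_system UNIV (Pow UNIV) outer"
    by (rule sigma_algebra.sigma_sets_subset) (use open_caratheodory in blast)
  then have "sets (borel :: 'a measure) \<subseteq> lambda_system UNIV (Pow UNIV) outer"
    by (simp add: borel_def)
  with L have ms: "measure_space UNIV (sets (borel :: 'a measure)) outer"
    using measure_down[OF L] sets.sigma_algebra_axioms[of "borel :: 'a measure"] by simp
  show "space riesz_measure = UNIV" "sets riesz_measure = sets borel"
    unfolding riesz_measure_def using sets.sigma_sets_eq[of "borel :: 'a measure"] by auto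
  show "A \<in> sets borel \<Longrightarrow> emeasure riesz_measure A = outer A"
    using emeasure_measure_of_sigma[of UNIV "sets (borel :: 'a measure)" outer A] ms
    unfolding riesz_measure_def measure_space_def by blast
qed

lemma outer_compact_finite:
  assumes K: "compact K" "K \<subseteq> \<Omega>"
  obtains U where "open U" "K \<subseteq> U" "mass U < top"
proof -
  obtain \<theta> L where \<theta>: "Ck 2 UNIV \<theta>" "compact L" "L \<subseteq> \<Omega>" "\<And>x. 0 \<le> \<theta> x" "\<And>x. x \<in> K \<Longrightarrow> 1 \<le> \<theta> x"
      "\<And>x. x \<notin> L \<Longrightarrow> \<theta> x = 0"
    using exists_bump[OF \<Omega> K] by metis
  have t\<theta>: "test_function_on \<Omega> \<theta>"
    by (rule test_function_onI[OF Ck_continuous[OF \<theta>(1)] \<theta>(2,3,6)])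
  define U where "U = {x. 1/2 < \<theta> x}"
  have "open U" unfolding U_def by (rule open_Collect_less[OF continuous_on_const Ck_continuous[OF \<theta>(1)]])
  moreover have "K \<subseteq> U" using \<theta>(5) by (force simp: U_def)
  moreover have "mass U \<le> ennreal (2 * I \<theta>)"
    unfolding mass_def
  proof (intro SUP_least ennreal_leI)
    fix \<phi> assume \<phi>: "\<phi> \<in> adm U"
    have "\<phi> x \<le> 2 * \<theta> x" for x
    proof (cases "x \<in> U")
      case True
      have "\<phi> x \<le> 1" using \<phi> by (auto simp: adm_def)
      then show ?thesis using True unfolding U_def by (simp; linarith)
    next
      case False
      then show ?thesis using \<phi> \<theta>(4)[of x] by (auto simp: adm_def)
    qed
    then show "I \<phi> \<le> 2 * I \<theta>"
      using \<phi> mono[OF _ test_function_on_cmult[OF t\<theta>, of 2], of \<phi>] cmult[OF t\<theta>, of 2] by (auto simp: adm_def)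
  qed
  ultimately show thesis using that by (meson ennreal_less_top order_le_less_trans)
qed

text \<open>A nonnegative test function is sliced at the levels that are multiples of \<delta>.  The slice between
  two levels, divided by \<delta>, lies between the indicators of the two superlevel sets, and so do both
  its integral and its value under the functional.\<close>

lemma representation_nonneg:
  assumes t: "test_function_on \<Omega> \<phi>" and p: "\<And>x. 0 \<le> \<phi> x"
  shows "integrable riesz_measure \<phi> \<and> I \<phi> = (LINT x|riesz_measure. \<phi> x)"
proof -
  obtain K where K: "continuous_on UNIV \<phi>" "compact K" "K \<subseteq> \<Omega>" "\<And>x. x \<notin> K \<Longrightarrow> \<phi> x = 0"
    using test_function_onE[OF t] by metis
  obtain U where U: "open U" "K \<subseteq> U" "mass U < top" using outer_compact_finite[OF K(2,3)] by metis
  have mb: "h \<in> borel_measurable riesz_measure" if "continuous_on UNIV h" for h :: "'a \<Rightarrow> real"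
    using borel_measurable_continuous_onI[OF that] riesz_measure_outer(2) by (metis measurable_cong_sets)
  have Uf: "emeasure riesz_measure U < top" using U riesz_measure_outer(3)[of U] by (simp add: outer_open)
  have ii: "integrable riesz_measure (\<lambda>x. c * indicator U x)" for c :: real
    using U Uf riesz_measure_outer(2) by (intro integrable_mult_right integrable_real_indicator) auto
  have int: "integrable riesz_measure h" if "continuous_on UNIV h" "\<And>x. \<bar>h x\<bar> \<le> c" "\<And>x. x \<notin> K \<Longrightarrow> h x = 0" for h and c :: real
  proof (rule Bochner_Integration.integrable_bound[OF ii[of c] mb[OF that(1)]])
    show "AE x in riesz_measure. norm (h x) \<le> norm (c * indicator U x)"
      using that(2,3) U(2) by (intro AE_I2) (auto simp: indicator_def intro: order_trans[OF _ abs_ge_self])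
  qed
  obtain B where B: "\<And>x. \<phi> x \<le> B" "B > 0"
  proof -
    have "bounded (\<phi> ` K)"
      using K by (intro compact_imp_bounded compact_continuous_image) (auto intro: continuous_on_subset)
    then obtain B where B: "\<And>x. x \<in> K \<Longrightarrow> \<bar>\<phi> x\<bar> \<le> B" "B > 0" by (auto simp: bounded_pos)
    then have "\<phi> x \<le> B" for x using K(4)[of x] by (cases "x \<in> K") (force intro: order_trans[OF abs_ge_self])+
    then show thesis using B(2) that by blast
  qed
  have i\<phi>: "integrable riesz_measure \<phi>" using int[OF K(1) _ K(4), of B] B p by auto
  have bound: "\<bar>I \<phi> - (LINT x|riesz_measure. \<phi> x)\<bar> \<le> \<delta> * measure riesz_measure U" if \<delta>: "\<delta> > 0" for \<delta>
  proof -
    define lev where "lev j = {x. real j * \<delta> < \<phi> x}" for j :: nat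
    define sl where "sl j x = min (max (\<phi> x - real j * \<delta>) 0) \<delta>" for j :: nat and x
    have olev: "open (lev j)" for j unfolding lev_def by (rule open_Collect_less[OF continuous_on_const K(1)])
    have levU: "lev j \<subseteq> U" for j
    proof
      fix x assume "x \<in> lev j"
      moreover have "0 \<le> real j * \<delta>" using \<delta> by simp
      ultimately have "\<phi> x \<noteq> 0" by (auto simp: lev_def)
      then show "x \<in> U" using K(4) U(2) by blast
    qed
    have levf: "emeasure riesz_measure (lev j) < top" for j
      using emeasure_mono[OF levU, of riesz_measure j] U(1) Uf riesz_measure_outer(2) by (auto intro: order_le_less_trans)
    have csl: "continuous_on UNIV (sl j)" for j
      unfolding sl_def[abs_def] by (intro continuous_intros K(1))
    have sl0: "sl j x = 0" if "\<phi> x = 0" for j x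
      using that \<delta> by (simp add: sl_def)
    have tsl: "test_function_on \<Omega> (sl j)" for j
      by (rule test_function_on_dominated[OF t csl sl0])
    have isl: "integrable riesz_measure (sl j)" for j
      using \<delta> sl0 K(4) by (intro int[OF csl, of j \<delta>]) (auto simp: sl_def)
    have lower: "\<delta> * indicator (lev (Suc j)) x \<le> sl j x" for j x
      using \<delta> by (auto simp: indicator_def lev_def sl_def algebra_simps)
    have upper: "sl j x \<le> \<delta> * indicator (lev j) x" for j x
      using \<delta> by (auto simp: indicator_def lev_def sl_def)
    let ?m = "\<lambda>j. measure riesz_measure (lev j)"
    have il: "integrable riesz_measure (\<lambda>x. \<delta> * indicator (lev j) x)" for j
      using olev levf riesz_measure_outer(2) by (intro integrable_mult_right integrable_real_indicator) auto
    have li: "(LINT x|riesz_measure. \<delta> * indicator (lev j) x) = \<delta> * ?m j" for j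
      by (simp add: riesz_measure_outer(1))
    have int_bounds: "\<delta> * ?m (Suc j) \<le> (LINT x|riesz_measure. sl j x)" "(LINT x|riesz_measure. sl j x) \<le> \<delta> * ?m j" for j
      unfolding li[symmetric] by (intro integral_mono il isl lower upper)+
    have em: "mass (lev j) = ennreal (?m j)" for j
      using riesz_measure_outer(3)[of "lev j"] olev levf[of j] by (simp add: outer_open emeasure_eq_ennreal_measure less_top)
    have I_upper: "I (sl j) \<le> \<delta> * ?m j" for j
    proof -
      have "(\<lambda>x. (1 / \<delta>) * sl j x) \<in> adm (lev j)"
        unfolding adm_def
      proof (intro CollectI conjI allI impI)
        show "test_function_on \<Omega> (\<lambda>x. (1 / \<delta>) * sl j x)" by (rule test_function_on_cmult[OF tsl])
        fix x
        show "0 \<le> 1 / \<delta> * sl j x" using \<delta> by (simp add: sl_def)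
        show "1 / \<delta> * sl j x \<le> 1" using \<delta> by (simp add: sl_def)
        assume "x \<notin> lev j"
        then show "1 / \<delta> * sl j x = 0" using \<delta> by (simp add: sl_def lev_def)
      qed
      from le_mass[OF this] have "(1 / \<delta>) * I (sl j) \<le> ?m j"
        unfolding em cmult[OF tsl] by (simp add: ennreal_le_iff)
      then show ?thesis using \<delta> by (simp add: field_simps)
    qed
    have I_lower: "\<delta> * ?m (Suc j) \<le> I (sl j)" for j
    proof -
      have p: "0 \<le> I (sl j)" using \<delta> by (intro pos tsl) (simp add: sl_def)
      have "ennreal (?m (Suc j)) \<le> ennreal (I (sl j) / \<delta>)"
        unfolding em[symmetric] mass_def
      proof (intro SUP_least ennreal_leI)
        fix \<psi> assume \<psi>: "\<psi> \<in> adm (lev (Suc j))"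
        have "\<delta> * \<psi> x \<le> sl j x" for x
        proof -
          have "\<psi> x \<le> indicator (lev (Suc j)) x" using \<psi> by (auto simp: adm_def indicator_def)
          then have "\<delta> * \<psi> x \<le> \<delta> * indicator (lev (Suc j)) x" using \<delta> by (intro mult_left_mono) auto
          then show ?thesis using lower order_trans by blast
        qed
        then have "\<delta> * I \<psi> \<le> I (sl j)"
          using \<psi> mono[OF test_function_on_cmult[of \<Omega> \<psi> \<delta>] tsl[of j]] cmult[of \<psi> \<delta>] by (auto simp: adm_def)
        then show "I \<psi> \<le> I (sl j) / \<delta>" using \<delta> by (simp add: field_simps)
      qed
      then have "?m (Suc j) \<le> I (sl j) / \<delta>" using p \<delta> by (simp add: ennreal_le_iff)
      then show ?thesis using \<delta> by (simp add: field_simps)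
    qed
    obtain n where n: "B < real n * \<delta>" using ex_less_of_nat_mult[OF \<delta>] by blast
    have "(\<Sum>j<k. sl j x) = min (\<phi> x) (real k * \<delta>)" for k x
    proof (induction k)
      case 0
      then show ?case using p[of x] by simp
    next
      case (Suc k)
      have "0 \<le> real k * \<delta>" using \<delta> by simp
      with Suc show ?case using \<delta> p[of x] by (simp add: sl_def algebra_simps min_def max_def)
    qed
    then have dec: "\<phi> = (\<lambda>x. \<Sum>j<n. sl j x)"
      using B(1) n by (auto simp: fun_eq_iff min_def) (meson less_le_not_le order_trans)
    have "I \<phi> = (\<Sum>j<n. I (sl j))"
      using sum[of "{..<n}" sl] tsl by (subst dec) simp
    moreover have "(LINT x|riesz_measure. \<phi> x) = (\<Sum>j<n. LINT x|riesz_measure. sl j x)"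
      using isl by (subst dec) (simp add: Bochner_Integration.integral_sum)
    ultimately have "\<bar>I \<phi> - (LINT x|riesz_measure. \<phi> x)\<bar> \<le> (\<Sum>j<n. \<bar>I (sl j) - (LINT x|riesz_measure. sl j x)\<bar>)"
      by (simp add: sum_subtractf[symmetric] sum_abs)
    also have "\<dots> \<le> (\<Sum>j<n. \<delta> * ?m j - \<delta> * ?m (Suc j))"
      using I_upper I_lower int_bounds by (intro sum_mono) (smt (verit))
    also have "\<dots> = \<delta> * ?m 0 - \<delta> * ?m n"
      by (induction n) auto
    also have "\<dots> \<le> \<delta> * ?m 0" using \<delta> by simp
    also have "\<dots> \<le> \<delta> * measure riesz_measure U"
    proof -
      have "?m 0 \<le> measure riesz_measure U"
        using emeasure_mono[OF levU[of 0], of riesz_measure] U(1) Uf riesz_measure_outer(2) levf[of 0]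
        by (simp add: emeasure_eq_ennreal_measure less_top ennreal_le_iff)
      then show ?thesis using \<delta> by simp
    qed
    finally show ?thesis .
  qed
  have "\<bar>I \<phi> - (LINT x|riesz_measure. \<phi> x)\<bar> \<le> 0"
  proof (rule field_le_epsilon)
    fix e :: real assume e: "e > 0"
    let ?d = "e / (measure riesz_measure U + 1)"
    have m1: "measure riesz_measure U + 1 > 0" by (intro add_nonneg_pos) auto
    have d: "?d > 0" using e m1 by (rule divide_pos_pos)
    from bound[OF this] have "\<bar>I \<phi> - (LINT x|riesz_measure. \<phi> x)\<bar> \<le> ?d * measure riesz_measure U" .
    also have "\<dots> \<le> ?d * (measure riesz_measure U + 1)" using d by (intro mult_left_mono) auto
    also have "\<dots> = e" using m1 by simp
    finally show "\<bar>I \<phi> - (LINT x|riesz_measure. \<phi> x)\<bar> \<le> 0 + e" by simp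
  qed
  with i\<phi> show ?thesis by simp
qed

theorem Riesz_representation:
  "\<exists>\<mu>. locally_finite_borel_measure_on \<Omega> \<mu> \<and> (\<forall>\<phi>. test_function_on \<Omega> \<phi> \<longrightarrow> I \<phi> = (LINT x|\<mu>. \<phi> x))"
proof (intro exI conjI allI impI)
  let ?\<mu> = "restrict_space riesz_measure \<Omega>"
  have \<Omega>M: "\<Omega> \<inter> space riesz_measure \<in> sets riesz_measure" using \<Omega> riesz_measure_outer(1,2) by simp
  show "locally_finite_borel_measure_on \<Omega> ?\<mu>"
    unfolding locally_finite_borel_measure_on_def
  proof (intro conjI allI impI)
    show "sets ?\<mu> = sets (restrict_space borel \<Omega>)"
      by (rule sets_restrict_space_cong[OF riesz_measure_outer(2)])
    fix K assume K: "compact K \<and> K \<subseteq> \<Omega>"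
    obtain U where "open U" "K \<subseteq> U" "mass U < top" using outer_compact_finite K by metis
    moreover have "emeasure ?\<mu> K = outer K"
      using K riesz_measure_outer(3)[of K] \<Omega>M by (subst emeasure_restrict_space) (auto simp: borel_compact)
    ultimately show "emeasure ?\<mu> K < \<infinity>" using outer_le[of U K] by (auto intro: order_le_less_trans)
  qed
  fix \<phi> assume t: "test_function_on \<Omega> \<phi>"
  have c: "continuous_on UNIV \<phi>" using t by (simp add: test_function_on_def)
  define \<phi>p where "\<phi>p x = max 0 (\<phi> x)" for x
  define \<phi>m where "\<phi>m x = max 0 (- \<phi> x)" for x
  have tpm: "test_function_on \<Omega> \<phi>p" "test_function_on \<Omega> \<phi>m"
    by (intro test_function_on_dominated[OF t]; auto simp: \<phi>p_def[abs_def] \<phi>m_def[abs_def] intro!: continuous_intros c)+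
  have r: "integrable riesz_measure \<phi>p \<and> I \<phi>p = (LINT x|riesz_measure. \<phi>p x)" "integrable riesz_measure \<phi>m \<and> I \<phi>m = (LINT x|riesz_measure. \<phi>m x)"
    by (intro representation_nonneg tpm; simp add: \<phi>p_def \<phi>m_def)+
  have eq: "\<phi> = (\<lambda>x. \<phi>p x + (-1) * \<phi>m x)" by (auto simp: fun_eq_iff \<phi>p_def \<phi>m_def max_def)
  have "I \<phi> = I (\<lambda>x. \<phi>p x + (-1) * \<phi>m x)" using eq by (rule arg_cong)
  also have "\<dots> = I \<phi>p + (-1) * I \<phi>m"
    using add[OF tpm(1) test_function_on_cmult[OF tpm(2), of "-1"]] cmult[OF tpm(2), of "-1"] by simp
  also have "\<dots> = (LINT x|riesz_measure. \<phi>p x + (-1) * \<phi>m x)"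
    using r by simp
  also have "\<dots> = (LINT x|riesz_measure. \<phi> x)" using eq[symmetric] by (rule arg_cong)
  also have "(LINT x|riesz_measure. \<phi> x) = (LINT x|riesz_measure. indicator \<Omega> x *\<^sub>R \<phi> x)"
  proof -
    have "\<phi> x = indicator \<Omega> x *\<^sub>R \<phi> x" for x
      using test_function_on_eq_0[OF t] by (cases "x \<in> \<Omega>") auto
    then show ?thesis by (metis (no_types))
  qed
  also have "\<dots> = (LINT x|?\<mu>. \<phi> x)" by (rule integral_restrict_space[OF \<Omega>M, symmetric])
  finally show "I \<phi> = (LINT x|?\<mu>. \<phi> x)" .
qed

end

section \<open>Uniqueness of the representing measure\<close>

text \<open>Every open set is a countable union of compact boxes.\<close>

lemma sets_restrict_borel_eq:
  assumes "open (\<Omega> :: 'a::euclidean_space set)"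
  shows "sets (restrict_space borel \<Omega>) = sigma_sets \<Omega> {K. compact K \<and> K \<subseteq> \<Omega>}"
proof
  have "sets (restrict_space borel \<Omega>) = (\<inter>) \<Omega> ` sigma_sets UNIV {U. open U}"
    by (simp add: sets_restrict_space borel_def)
  also have "\<dots> = sigma_sets \<Omega> ((\<inter>) \<Omega> ` {U. open U})"
    using assms by (intro sigma_sets_Int) auto
  also have "\<dots> \<subseteq> sigma_sets \<Omega> {K. compact K \<and> K \<subseteq> \<Omega>}"
  proof (rule sigma_sets_mono, safe)
    fix U :: "'a set" assume "open U"
    then have "open (\<Omega> \<inter> U)" using assms by auto
    then obtain D where D: "countable D" "D \<subseteq> Pow (\<Omega> \<inter> U)" "\<And>X. X \<in> D \<Longrightarrow> \<exists>a b. X = cbox a b" "\<Union>D = \<Omega> \<inter> U"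
      using open_countable_Union_open_cbox by metis
    have "X \<in> {K. compact K \<and> K \<subseteq> \<Omega>}" if "X \<in> D" for X
      using D(2) D(3)[OF that] that by auto
    then have "\<Union>D \<in> sigma_sets \<Omega> {K. compact K \<and> K \<subseteq> \<Omega>}"
      using D(1) by (intro sigma_sets_UNION) (auto intro!: sigma_sets.Basic)
    then show "\<Omega> \<inter> U \<in> sigma_sets \<Omega> {K. compact K \<and> K \<subseteq> \<Omega>}" by (simp add: D(4))
  qed
  finally show "sets (restrict_space borel \<Omega>) \<subseteq> sigma_sets \<Omega> {K. compact K \<and> K \<subseteq> \<Omega>}" .
  have "{K. compact K \<and> K \<subseteq> \<Omega>} \<subseteq> sets (restrict_space borel \<Omega>)"
    using assms by (auto simp: sets_restrict_space_iff borel_compact)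
  from sets.sigma_sets_subset[OF this]
  show "sigma_sets \<Omega> {K. compact K \<and> K \<subseteq> \<Omega>} \<subseteq> sets (restrict_space borel \<Omega>)"
    by (simp add: space_restrict_space)
qed

text \<open>Tent functions over \<open>K\<close> of increasing steepness decrease to its indicator
  and have their supports in one compact neighbourhood.\<close>

lemma compact_integral_limit:
  fixes K :: "'a::euclidean_space set"
  assumes \<Omega>: "open \<Omega>" and K: "compact K" "K \<subseteq> \<Omega>" "K \<noteq> {}"
  obtains \<phi> where "\<And>n. test_function_on \<Omega> (\<phi> n)"
    "\<And>\<mu>. locally_finite_borel_measure_on \<Omega> \<mu> \<Longrightarrow> (\<lambda>n. LINT x|\<mu>. \<phi> n x) \<longlonglongrightarrow> measure \<mu> K"
proof -
  obtain e where e: "e > 0" "{x. infdist x K \<le> e} \<subseteq> \<Omega>"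
    using compact_in_open_separated[OF K(3,1) \<Omega> K(2)] by metis
  define L where "L = {x. infdist x K \<le> e}"
  have L: "compact L" "L \<subseteq> \<Omega>" using e K by (auto simp: L_def intro: compact_infdist_le)
  define \<phi> where "\<phi> n x = max 0 (1 - (real n + 1 / e) * infdist x K)" for n x
  have c: "continuous_on UNIV (\<phi> n)" for n
    unfolding \<phi>_def[abs_def] by (intro continuous_intros)
  have b: "0 \<le> \<phi> n x" "\<phi> n x \<le> indicator L x" for n x
  proof -
    show "0 \<le> \<phi> n x" by (simp add: \<phi>_def)
    show "\<phi> n x \<le> indicator L x"
    proof (cases "x \<in> L")
      case True
      then show ?thesis using e(1) by (simp add: \<phi>_def infdist_nonneg)
    next
      case False
      then have "1 \<le> (1 / e) * infdist x K" using e(1) by (simp add: L_def field_simps)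
      also have "\<dots> \<le> (real n + 1 / e) * infdist x K" by (intro mult_right_mono) (auto simp: infdist_nonneg)
      finally show ?thesis using False by (simp add: \<phi>_def)
    qed
  qed
  show thesis
  proof (rule that[of \<phi>])
    show "test_function_on \<Omega> (\<phi> n)" for n
      by (rule test_function_onI[OF c L]) (metis b antisym indicator_simps(2))
    fix \<mu> assume \<mu>: "locally_finite_borel_measure_on \<Omega> \<mu>"
    have s: "sets \<mu> = sets (restrict_space borel \<Omega>)" using \<mu> by (simp add: locally_finite_borel_measure_on_def)
    have cs: "X \<in> sets \<mu>" if "compact X" "X \<subseteq> \<Omega>" for X
      using that \<Omega> s by (auto simp: sets_restrict_space_iff borel_compact)
    have m: "\<phi> n \<in> borel_measurable \<mu>" for n
      using measurable_restrict_space1[OF borel_measurable_continuous_onI[OF c[of n]], of \<Omega>] measurable_cong_sets[OF s] by blast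
    have sp: "space \<mu> = \<Omega>" using sets_eq_imp_space_eq[OF s] by (simp add: space_restrict_space)
    have "(\<lambda>n. LINT x|\<mu>. \<phi> n x) \<longlonglongrightarrow> (LINT x|\<mu>. indicator K x)"
    proof (rule integral_dominated_convergence[where w = "indicator L"])
      show "(\<lambda>x. indicator K x :: real) \<in> borel_measurable \<mu>" using cs[OF K(1,2)] by simp
      show "integrable \<mu> (indicator L :: 'a \<Rightarrow> real)"
        using cs[OF L] \<mu> L by (intro integrable_real_indicator) (auto simp: locally_finite_borel_measure_on_def)
      show "AE x in \<mu>. (\<lambda>n. \<phi> n x) \<longlonglongrightarrow> indicator K x"
      proof (rule AE_I2)
        fix x
        show "(\<lambda>n. \<phi> n x) \<longlonglongrightarrow> indicator K x"
        proof (cases "x \<in> K")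
          case True
          then show ?thesis by (simp add: \<phi>_def)
        next
          case False
          then have d: "infdist x K > 0"
            using K in_closed_iff_infdist_zero[OF compact_imp_closed[OF K(1)] K(3), of x] infdist_nonneg[of x K] by auto
          obtain n where n: "1 / infdist x K < real n" using reals_Archimedean2 by blast
          have "\<phi> k x = 0" if "k \<ge> n" for k
          proof -
            have "1 \<le> real k * infdist x K" using n that d by (simp add: field_simps) (meson le_less_trans less_eq_real_def mult_right_mono of_nat_le_iff order_trans)
            also have "\<dots> \<le> (real k + 1 / e) * infdist x K" using d e(1) by (intro mult_right_mono) auto
            finally show ?thesis by (simp add: \<phi>_def)
          qed
          then have "eventually (\<lambda>k. \<phi> k x = indicator K x) sequentially"
            using False by (intro eventually_sequentiallyI[of n]) simp
          then show ?thesis by (rule tendsto_eventually)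
        qed
      qed
      show "AE x in \<mu>. norm (\<phi> n x) \<le> indicator L x" for n
        using b by (intro AE_I2) auto
    qed (rule m)
    also have "(LINT x|\<mu>. indicator K x) = measure \<mu> K"
      using K(2) sp by (simp add: Int_absorb2)
    finally show "(\<lambda>n. LINT x|\<mu>. \<phi> n x) \<longlonglongrightarrow> measure \<mu> K" .
  qed
qed

text \<open>The measures agree on compact sets, which are stable under intersections and generate
  the Borel sets of \<open>\<Omega>\<close>.\<close>

lemma measure_eqI_test_functions:
  fixes \<Omega> :: "'a::euclidean_space set"
  assumes \<Omega>: "open \<Omega>" and \<mu>: "locally_finite_borel_measure_on \<Omega> \<mu>" and \<nu>: "locally_finite_borel_measure_on \<Omega> \<nu>"
    and eq: "\<And>\<phi>. test_function_on \<Omega> \<phi> \<Longrightarrow> (LINT x|\<mu>. \<phi> x) = (LINT x|\<nu>. \<phi> x)"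
  shows "\<mu> = \<nu>"
proof -
  let ?E = "{K. compact K \<and> K \<subseteq> \<Omega>}"
  obtain D where D: "countable D" "D \<subseteq> Pow \<Omega>" "\<And>X. X \<in> D \<Longrightarrow> \<exists>a b. X = cbox a b" "\<Union>D = \<Omega>"
    using open_countable_Union_open_cbox[OF \<Omega>] by metis
  have fin: "emeasure \<mu> K < \<infinity>" "emeasure \<nu> K < \<infinity>" if "K \<in> ?E" for K
    using \<mu> \<nu> that by (auto simp: locally_finite_borel_measure_on_def)
  have DE: "D \<subseteq> ?E" using D(2,3) by fastforce
  show ?thesis
  proof (rule measure_eqI_generator_eq_countable[of ?E \<Omega> \<mu> \<nu> D])
    show "Int_stable ?E" by (auto simp: Int_stable_def compact_Int)
    show "?E \<subseteq> Pow \<Omega>" by auto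
    show "sets \<mu> = sigma_sets \<Omega> ?E" "sets \<nu> = sigma_sets \<Omega> ?E"
      using \<mu> \<nu> sets_restrict_borel_eq[OF \<Omega>] by (auto simp: locally_finite_borel_measure_on_def)
    show "D \<subseteq> ?E" by (rule DE)
    show "\<Union>D = \<Omega>" "countable D" by (rule D)+
    show "emeasure \<mu> a \<noteq> \<infinity>" if "a \<in> D" for a
      using fin(1)[OF subsetD[OF DE that]] by simp
    fix K assume K: "K \<in> ?E"
    then have K1: "compact K" and K2: "K \<subseteq> \<Omega>" by auto
    show "emeasure \<mu> K = emeasure \<nu> K"
    proof (cases "K = {}")
      case False
      obtain \<phi> where \<phi>: "\<And>n. test_function_on \<Omega> (\<phi> n)"
        "\<And>\<mu>. locally_finite_borel_measure_on \<Omega> \<mu> \<Longrightarrow> (\<lambda>n. LINT x|\<mu>. \<phi> n x) \<longlonglongrightarrow> measure \<mu> K"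
        using compact_integral_limit[OF \<Omega> K1 K2 False] by metis
      have "measure \<mu> K = measure \<nu> K"
        using LIMSEQ_unique[OF \<phi>(2)[OF \<mu>]] \<phi>(2)[OF \<nu>] eq[OF \<phi>(1)] by simp
      then show ?thesis using fin[OF K] by (simp add: emeasure_eq_ennreal_measure less_top)
    qed simp
  qed
qed

section \<open>Convergence of the Monge-Ampere measures\<close>

text \<open>The quotient of \<open>\<phi>\<close> by a cut-off function is approximated by a
  polynomial on the support of that function; multiplying back makes the approximants vanish outside
  one compact set.\<close>

lemma C2_dense_in_test_functions:
  fixes \<phi> :: "'a::euclidean_space \<Rightarrow> real"
  assumes \<Omega>: "open \<Omega>" and t: "test_function_on \<Omega> \<phi>"
  obtains K where "compact K" "K \<subseteq> \<Omega>" "\<And>x. x \<notin> K \<Longrightarrow> \<phi> x = 0"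
    "\<And>e. 0 < e \<Longrightarrow> \<exists>\<psi>. Ck 2 UNIV \<psi> \<and> (\<forall>x. x \<notin> K \<longrightarrow> \<psi> x = 0) \<and> (\<forall>x. \<bar>\<phi> x - \<psi> x\<bar> \<le> e)"
proof -
  obtain S where S: "continuous_on UNIV \<phi>" "compact S" "S \<subseteq> \<Omega>" "\<And>x. x \<notin> S \<Longrightarrow> \<phi> x = 0"
    using test_function_onE[OF t] by metis
  obtain b K where b: "Ck 2 UNIV b" "compact K" "K \<subseteq> \<Omega>" "S \<subseteq> K" "\<And>x. 0 \<le> b x" "\<And>x. x \<in> S \<Longrightarrow> 1 \<le> b x"
      "\<And>x. x \<notin> K \<Longrightarrow> b x = 0"
    using exists_bump[OF \<Omega> S(2,3)] by metis
  define h where "h x = \<phi> x / max 1 (b x)" for x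
  have ch: "continuous_on K h"
    unfolding h_def[abs_def]
    by (intro continuous_intros continuous_on_subset[OF S(1)] continuous_on_subset[OF Ck_continuous[OF b(1)]]) auto
  have \<phi>h: "\<phi> x = b x * h x" for x
    using S(4)[of x] b(6)[of x] by (cases "x \<in> S") (auto simp: h_def max_def)
  have "bounded (b ` K)"
    using b(2) continuous_on_subset[OF Ck_continuous[OF b(1)]] by (intro compact_imp_bounded compact_continuous_image) auto
  then obtain B where B: "\<And>x. x \<in> K \<Longrightarrow> \<bar>b x\<bar> \<le> B" "B > 0" by (auto simp: bounded_pos)
  show ?thesis
  proof (rule that[OF b(2,3)])
    show "\<phi> x = 0" if "x \<notin> K" for x using S(4) b(4) that by blast
    fix e :: real assume e: "0 < e"
    obtain p where p: "real_polynomial_function p" "\<And>x. x \<in> K \<Longrightarrow> \<bar>h x - p x\<bar> < e / B"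
      using Stone_Weierstrass_real_polynomial_function[OF b(2) ch, of "e / B"] e B(2) by auto
    have "\<bar>\<phi> x - b x * p x\<bar> \<le> e" for x
    proof (cases "x \<in> K")
      case True
      have "\<bar>\<phi> x - b x * p x\<bar> = \<bar>b x\<bar> * \<bar>h x - p x\<bar>" 
        by (simp only: \<phi>h right_diff_distrib[symmetric] abs_mult)
      also have "\<dots> \<le> B * (e / B)" using B(1)[OF True] p(2)[OF True] by (intro mult_mono) auto
      finally show ?thesis using B(2) by simp
    next
      case False
      then show ?thesis using e b(7) by (simp add: \<phi>h)
    qed
    then show "\<exists>\<psi>. Ck 2 UNIV \<psi> \<and> (\<forall>x. x \<notin> K \<longrightarrow> \<psi> x = 0) \<and> (\<forall>x. \<bar>\<phi> x - \<psi> x\<bar> \<le> e)"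
      using b(7) by (intro exI[of _ "\<lambda>x. b x * p x"] conjI Ck_mult b(1) Ck_polynomial p(1)) auto
  qed
qed

lemma approximation_bounded:
  fixes F :: "nat \<Rightarrow> quat ^ 'n::finite \<Rightarrow> real"
  assumes f: "continuous_on \<Omega> f" and F: "C2_psh_approximation \<Omega> f F" and C: "\<And>N. Ck 2 \<Omega> (F N)"
    and L: "compact L" "L \<subseteq> \<Omega>"
  obtains B where "\<And>N x. x \<in> L \<Longrightarrow> \<bar>F N x\<bar> \<le> B"
proof -
  have bdd: "\<exists>B. \<forall>x\<in>L. \<bar>h x\<bar> \<le> B" if "continuous_on \<Omega> h" for h :: "quat ^ 'n \<Rightarrow> real"
    using compact_imp_bounded[OF compact_continuous_image[OF continuous_on_subset[OF that L(2)] L(1)]]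
    by (auto simp: bounded_iff)
  obtain Bf where Bf: "\<And>x. x \<in> L \<Longrightarrow> \<bar>f x\<bar> \<le> Bf" using bdd[OF f] by metis
  have "\<exists>B. \<forall>x\<in>L. \<bar>F N x\<bar> \<le> B" for N by (rule bdd[OF Ck_continuous[OF C]])
  then obtain BF where BF: "\<And>N x. x \<in> L \<Longrightarrow> \<bar>F N x\<bar> \<le> BF N" by metis
  have "uniform_limit L F f sequentially"
    using F L by (simp add: C2_psh_approximation_def)
  then have "eventually (\<lambda>N. \<forall>x\<in>L. dist (F N x) (f x) < 1) sequentially"
    by (rule uniform_limitD) simp
  then obtain N0 where N0: "\<And>N x. N \<ge> N0 \<Longrightarrow> x \<in> L \<Longrightarrow> dist (F N x) (f x) < 1"
    by (auto simp: eventually_sequentially)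
  show thesis
  proof (rule that[of "\<bar>Bf\<bar> + 1 + (\<Sum>N<N0. \<bar>BF N\<bar>)"])
    fix N x assume x: "x \<in> L"
    show "\<bar>F N x\<bar> \<le> \<bar>Bf\<bar> + 1 + (\<Sum>N<N0. \<bar>BF N\<bar>)"
    proof (cases "N \<ge> N0")
      case True
      have "0 \<le> (\<Sum>N<N0. \<bar>BF N\<bar>)" by (intro sum_nonneg) auto
      moreover have "\<bar>F N x - f x\<bar> < 1" using N0[OF True x] by (simp add: dist_real_def)
      ultimately show ?thesis using Bf[OF x] by linarith
    next
      case False
      then have "\<bar>BF N\<bar> \<le> (\<Sum>N<N0. \<bar>BF N\<bar>)" by (intro member_le_sum[of N "{..<N0}" "\<lambda>N. \<bar>BF N\<bar>"]) auto
      then show ?thesis using BF[OF x, of N] by simp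
    qed
  qed
qed

definition ma_integral :: "(quat ^ 'n::finite \<Rightarrow> real) \<Rightarrow> (quat ^ 'n \<Rightarrow> real) \<Rightarrow> real" where
  "ma_integral u \<phi> = (LINT x|lborel. \<phi> x * mixed (\<lambda>_. u) x)"

lemma ma_integral_eq:
  assumes \<Omega>: "open \<Omega>" and u: "psh2 \<Omega> u" and t: "test_function_on \<Omega> \<phi>"
  shows "(LINT x : \<Omega> | lborel. \<phi> x * moore_det (quat_hessian u x)) = ma_integral u \<phi>"
proof -
  have C: "Ck 2 \<Omega> u" using u by (simp add: psh2_def)
  have eq: "indicator \<Omega> x *\<^sub>R (\<phi> x * moore_det (quat_hessian u x)) = \<phi> x * mixed (\<lambda>_. u) x" for x
  proof (cases "x \<in> \<Omega>")
    case True
    then show ?thesis by (simp add: moore_det_hessian[OF \<Omega> True C])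
  next
    case False
    then show ?thesis by (simp add: test_function_on_eq_0[OF t False])
  qed
  show ?thesis unfolding set_lebesgue_integral_def ma_integral_def eq ..
qed

lemma integrable_ma:
  assumes u: "psh2 \<Omega> u" and t: "test_function_on \<Omega> \<phi>"
  shows "integrable lborel (\<lambda>x. \<phi> x * mixed (\<lambda>_. u) x)"
proof -
  obtain K where K: "continuous_on UNIV \<phi>" "compact K" "K \<subseteq> \<Omega>" "\<And>x. x \<notin> K \<Longrightarrow> \<phi> x = 0"
    using test_function_onE[OF t] by metis
  show ?thesis
    using u by (intro integrable_supported[OF K(2,3) continuous_on_subset[OF K(1)] K(4)] continuous_on_mixed)
      (auto simp: psh2_def)
qed

text \<open>If \<open>\<phi>\<close> is replaced by a close function \<open>\<psi>\<close> of class
  \<open>Ck 2\<close>, the integrals change little, uniformly in \<open>N\<close>, because the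
  masses on \<open>K\<close> are bounded. For \<open>\<psi>\<close> the integrals are a Cauchy
  sequence because they are Lipschitz continuous in the functions.\<close>

lemma ma_integral_convergent:
  fixes F :: "nat \<Rightarrow> quat ^ 'n::finite \<Rightarrow> real"
  assumes \<Omega>: "open \<Omega>" and f: "continuous_on \<Omega> f" and F: "C2_psh_approximation \<Omega> f F"
    and t: "test_function_on \<Omega> \<phi>"
  shows "convergent (\<lambda>N. ma_integral (F N) \<phi>)"
proof -
  have psh: "psh2 \<Omega> (F N)" for N
    using F quat_psh_imp_psh2[OF \<Omega>] by (auto simp: C2_psh_approximation_def)
  then have C: "Ck 2 \<Omega> (F N)" for N by (simp add: psh2_def)
  obtain K where K: "compact K" "K \<subseteq> \<Omega>" "\<And>x. x \<notin> K \<Longrightarrow> \<phi> x = 0"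
    and dense: "\<And>e. 0 < e \<Longrightarrow> \<exists>\<psi>. Ck 2 UNIV \<psi> \<and> (\<forall>x. x \<notin> K \<longrightarrow> \<psi> x = 0) \<and> (\<forall>x. \<bar>\<phi> x - \<psi> x\<bar> \<le> e)"
    using C2_dense_in_test_functions[OF \<Omega> t] by metis
  obtain C0 where C0: "C0 \<ge> 0" "\<And>N. (LINT x|lborel. indicator K x * mixed (\<lambda>_. F N) x) \<le> C0"
  proof -
    obtain L where L: "compact L" "L \<subseteq> \<Omega>" "\<And>B. \<exists>C\<ge>0. mass_bound \<Omega> (UNIV :: 'n set) K L B C"
      using Chern_Levine_Nirenberg[OF \<Omega> K(1,2)] by metis
    obtain B where B: "\<And>N x. x \<in> L \<Longrightarrow> \<bar>F N x\<bar> \<le> B"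
      using approximation_bounded[OF f F C L(1,2)] by metis
    obtain C0 where "C0 \<ge> 0" "mass_bound \<Omega> (UNIV :: 'n set) K L B C0" using L(3) by metis
    then show thesis
    proof (intro that[of C0])
      fix N
      assume m: "mass_bound \<Omega> (UNIV :: 'n set) K L B C0"
      show "(LINT x|lborel. indicator K x * mixed (\<lambda>_. F N) x) \<le> C0"
        by (rule m[unfolded mass_bound_def, rule_format, of "\<lambda>_. F N"]) (simp_all add: psh B)
    qed
  qed
  have "Cauchy (\<lambda>N. ma_integral (F N) \<phi>)"
  proof (rule CauchyI)
    fix e :: real assume e: "0 < e"
    \<comment> \<open>Adding one keeps the denominators positive in case the constant is zero.\<close>
    define d where "d = e / (4 * (C0 + 1))"
    have d: "d > 0" using e C0(1) by (simp add: d_def)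
    have dC: "d * C0 \<le> e / 4"
    proof -
      have "d * C0 \<le> d * (C0 + 1)" using d by simp
      also have "\<dots> = e / 4" using C0(1) by (simp add: d_def field_simps)
      finally show ?thesis .
    qed
    obtain \<psi> where \<psi>: "Ck 2 UNIV \<psi>" "\<And>x. x \<notin> K \<Longrightarrow> \<psi> x = 0" "\<And>x. \<bar>\<phi> x - \<psi> x\<bar> \<le> d"
      using dense[OF d] by metis
    have t\<psi>: "test_function_on \<Omega> \<psi>" by (rule test_function_onI[OF Ck_continuous[OF \<psi>(1)] K(1,2) \<psi>(2)])
    have near: "\<bar>ma_integral (F N) \<phi> - ma_integral (F N) \<psi>\<bar> \<le> e / 4" for N
    proof -
      note i = integrable_ma[OF psh[of N] t] integrable_ma[OF psh[of N] t\<psi>]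
      have iK: "integrable lborel (\<lambda>x. indicator K x * (d * mixed (\<lambda>_. F N) x))"
        using C by (intro integrable_on_compact[OF K(1,2)] continuous_on_mult continuous_on_const continuous_on_mixed)
      have "ma_integral (F N) \<phi> - ma_integral (F N) \<psi> = (LINT x|lborel. (\<phi> x - \<psi> x) * mixed (\<lambda>_. F N) x)"
        unfolding ma_integral_def left_diff_distrib using i by simp
      also have "\<bar>\<dots>\<bar> \<le> (LINT x|lborel. \<bar>(\<phi> x - \<psi> x) * mixed (\<lambda>_. F N) x\<bar>)"
        by (rule integral_abs_bound)
      also have "\<dots> \<le> (LINT x|lborel. indicator K x * (d * mixed (\<lambda>_. F N) x))"
      proof (rule integral_mono[OF _ iK])
        show "integrable lborel (\<lambda>x. \<bar>(\<phi> x - \<psi> x) * mixed (\<lambda>_. F N) x\<bar>)"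
          using i unfolding left_diff_distrib by (intro integrable_abs Bochner_Integration.integrable_diff)
        fix x
        show "\<bar>(\<phi> x - \<psi> x) * mixed (\<lambda>_. F N) x\<bar> \<le> indicator K x * (d * mixed (\<lambda>_. F N) x)"
        proof (cases "x \<in> K")
          case True
          then have "0 \<le> mixed (\<lambda>_. F N) x" using K(2) by (intro mixed_nonneg[OF \<Omega>, where u = "\<lambda>_. F N"] psh) auto
          then show ?thesis using True \<psi>(3)[of x] by (simp add: abs_mult mult_right_mono)
        qed (simp add: K(3) \<psi>(2))
      qed
      also have "\<dots> = d * (LINT x|lborel. indicator K x * mixed (\<lambda>_. F N) x)"
        by (simp add: mult.left_commute)
      also have "\<dots> \<le> d * C0" using C0(2) d by (intro mult_left_mono) auto
      finally show ?thesis using dC by simp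
    qed
    obtain L where L: "compact L" "L \<subseteq> \<Omega>" "\<And>B. \<exists>C\<ge>0. lipschitz_bound \<Omega> \<psi> K L B C"
      using mixed_difference_bound[OF \<Omega> K(1,2) \<psi>(1,2)] by metis
    obtain B where B: "\<And>N x. x \<in> L \<Longrightarrow> \<bar>F N x\<bar> \<le> B"
      using approximation_bounded[OF f F C L(1,2)] by metis
    obtain C1 where C1: "C1 \<ge> 0" "lipschitz_bound \<Omega> \<psi> K L B C1" using L(3) by metis
    define \<eta> where "\<eta> = e / (4 * (C1 + 1))"
    have \<eta>: "\<eta> > 0" using e C1(1) by (simp add: \<eta>_def)
    have \<eta>C: "C1 * \<eta> \<le> e / 4"
    proof -
      have "C1 * \<eta> \<le> (C1 + 1) * \<eta>" using \<eta> by simp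
      also have "\<dots> = e / 4" using C1(1) by (simp add: \<eta>_def field_simps)
      finally show ?thesis .
    qed
    have "uniform_limit K F f sequentially" using F K by (simp add: C2_psh_approximation_def)
    then have "eventually (\<lambda>N. \<forall>x\<in>K. dist (F N x) (f x) < \<eta> / 2) sequentially"
      by (rule uniform_limitD) (use \<eta> in simp)
    then obtain N0 where N0: "\<And>N x. N \<ge> N0 \<Longrightarrow> x \<in> K \<Longrightarrow> \<bar>F N x - f x\<bar> < \<eta> / 2"
      by (auto simp: eventually_sequentially dist_real_def)
    have "norm (ma_integral (F m) \<phi> - ma_integral (F n) \<phi>) < e" if "m \<ge> N0" "n \<ge> N0" for m n
    proof -
      have near_K: "\<bar>F m x - F n x\<bar> \<le> \<eta>" if "x \<in> K" for x
        using N0[OF \<open>m \<ge> N0\<close> that] N0[OF \<open>n \<ge> N0\<close> that] by linarith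
      have "\<bar>ma_integral (F m) \<psi> - ma_integral (F n) \<psi>\<bar> \<le> C1 * \<eta>"
        unfolding ma_integral_def
        by (rule C1(2)[unfolded lipschitz_bound_def, rule_format, OF psh psh B B near_K])
          (use \<eta> in simp_all)
      then have "\<bar>ma_integral (F m) \<phi> - ma_integral (F n) \<phi>\<bar> < e"
        using near[of m] near[of n] \<eta>C e by linarith
      then show ?thesis by simp
    qed
    then show "\<exists>M. \<forall>m\<ge>M. \<forall>n\<ge>M. norm (ma_integral (F m) \<phi> - ma_integral (F n) \<phi>) < e" by blast
  qed
  then show ?thesis by (rule Cauchy_convergent)
qed

lemma C2_psh_approximation_interleave:
  assumes F: "C2_psh_approximation \<Omega> f F" and G: "C2_psh_approximation \<Omega> f G"
  shows "C2_psh_approximation \<Omega> f (\<lambda>N. if even N then F (N div 2) else G (N div 2))"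
  unfolding C2_psh_approximation_def
proof (intro conjI allI impI)
  fix N
  show "C2_on \<Omega> (if even N then F (N div 2) else G (N div 2))"
    "quat_psh_on \<Omega> (if even N then F (N div 2) else G (N div 2))"
    using F G by (auto simp: C2_psh_approximation_def)
next
  fix K assume K: "compact K \<and> K \<subseteq> \<Omega>"
  show "uniform_limit K (\<lambda>N. if even N then F (N div 2) else G (N div 2)) f sequentially"
  proof (rule uniform_limitI)
    fix e :: real assume e: "0 < e"
    have "eventually (\<lambda>N. \<forall>x\<in>K. dist (F N x) (f x) < e) sequentially"
      "eventually (\<lambda>N. \<forall>x\<in>K. dist (G N x) (f x) < e) sequentially"
      using F G K e unfolding C2_psh_approximation_def by (auto intro: uniform_limitD)
    then obtain N1 N2 where N: "\<And>N x. N \<ge> N1 \<Longrightarrow> x \<in> K \<Longrightarrow> dist (F N x) (f x) < e"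
      "\<And>N x. N \<ge> N2 \<Longrightarrow> x \<in> K \<Longrightarrow> dist (G N x) (f x) < e"
      unfolding eventually_sequentially by metis
    show "eventually (\<lambda>N. \<forall>x\<in>K. dist ((if even N then F (N div 2) else G (N div 2)) x) (f x) < e) sequentially"
    proof (rule eventually_sequentiallyI[of "2 * max N1 N2"], intro ballI)
      fix N x assume "2 * max N1 N2 \<le> N" "x \<in> K"
      moreover from this have "N1 \<le> N div 2" "N2 \<le> N div 2" by auto
      ultimately show "dist ((if even N then F (N div 2) else G (N div 2)) x) (f x) < e" using N by auto
    qed
  qed
qed

theorem theorem2p1p10:
  fixes \<Omega> :: "(quat ^ 'n::finite) set"
    and f :: "quat ^ 'n \<Rightarrow> real"
    and F :: "nat \<Rightarrow> quat ^ 'n \<Rightarrow> real"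
  assumes "open \<Omega>" and "connected \<Omega>"
    and "continuous_on \<Omega> f" and "quat_psh_on \<Omega> f"
    and "C2_psh_approximation \<Omega> f F"
  shows "\<exists>\<mu>. locally_finite_borel_measure_on \<Omega> \<mu> \<and>
           densities_converge_weakly \<Omega> (\<lambda>N x. moore_det (quat_hessian (F N) x)) \<mu> \<and>
           (\<forall>G \<nu>. C2_psh_approximation \<Omega> f G \<and>
              locally_finite_borel_measure_on \<Omega> \<nu> \<and>
              densities_converge_weakly \<Omega> (\<lambda>N x. moore_det (quat_hessian (G N) x)) \<nu> \<longrightarrow>
              \<nu> = \<mu>)"
proof -
  note \<Omega> = assms(1) and f = assms(3) and F = assms(5)
  have psh: "psh2 \<Omega> (H N)" if "C2_psh_approximation \<Omega> f H" for H N
    using that quat_psh_imp_psh2[OF \<Omega>] by (auto simp: C2_psh_approximation_def)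
  define I where "I \<phi> = lim (\<lambda>N. ma_integral (F N) \<phi>)" for \<phi>
  have lim: "(\<lambda>N. ma_integral (F N) \<phi>) \<longlonglongrightarrow> I \<phi>" if "test_function_on \<Omega> \<phi>" for \<phi>
    unfolding I_def using ma_integral_convergent[OF \<Omega> f F that] by (simp add: convergent_LIMSEQ_iff)
  have I: "positive_functional \<Omega> I"
  proof (rule positive_functional.intro)
    show "open \<Omega>" by (rule \<Omega>)
    fix \<phi> :: "quat ^ 'n \<Rightarrow> real" assume t: "test_function_on \<Omega> \<phi>"
    show "I (\<lambda>x. \<phi> x + \<psi> x) = I \<phi> + I \<psi>" if t': "test_function_on \<Omega> \<psi>" for \<psi>
    proof (rule LIMSEQ_unique[OF lim[OF test_function_on_add[OF t t']]])
      have "ma_integral (F N) (\<lambda>x. \<phi> x + \<psi> x) = ma_integral (F N) \<phi> + ma_integral (F N) \<psi>" for N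
        using integrable_ma[OF psh[OF F, of N] t] integrable_ma[OF psh[OF F, of N] t']
        by (simp add: ma_integral_def distrib_right)
      then show "(\<lambda>N. ma_integral (F N) (\<lambda>x. \<phi> x + \<psi> x)) \<longlonglongrightarrow> I \<phi> + I \<psi>"
        using tendsto_add[OF lim[OF t] lim[OF t']] by simp
    qed
    show "I (\<lambda>x. c * \<phi> x) = c * I \<phi>" for c
    proof (rule LIMSEQ_unique[OF lim[OF test_function_on_cmult[OF t]]])
      have "ma_integral (F N) (\<lambda>x. c * \<phi> x) = c * ma_integral (F N) \<phi>" for N
        by (simp add: ma_integral_def mult.assoc)
      then show "(\<lambda>N. ma_integral (F N) (\<lambda>x. c * \<phi> x)) \<longlonglongrightarrow> c * I \<phi>"
        using tendsto_mult_left[OF lim[OF t]] by simp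
    qed
    show "0 \<le> I \<phi>" if p: "\<And>x. 0 \<le> \<phi> x"
    proof (rule LIMSEQ_le_const[OF lim[OF t]], intro exI allI impI)
      fix N
      have "0 \<le> \<phi> x * mixed (\<lambda>_. F N) x" for x
      proof (cases "x \<in> \<Omega>")
        case True
        then have "0 \<le> mixed (\<lambda>_. F N) x"
          by (intro mixed_nonneg[OF \<Omega>, where u = "\<lambda>_. F N"] psh[OF F])
        then show ?thesis using p by simp
      next
        case False
        then have "\<phi> x = 0" by (rule test_function_on_eq_0[OF t])
        then show ?thesis by simp
      qed
      then show "0 \<le> ma_integral (F N) \<phi>" by (simp add: ma_integral_def)
    qed
  qed
  obtain \<mu> where \<mu>: "locally_finite_borel_measure_on \<Omega> \<mu>"
    and rep: "\<And>\<phi>. test_function_on \<Omega> \<phi> \<Longrightarrow> I \<phi> = (LINT x|\<mu>. \<phi> x)"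
    using positive_functional.Riesz_representation[OF I] by blast
  show ?thesis
  proof (intro exI[of _ \<mu>] conjI allI impI)
    show "locally_finite_borel_measure_on \<Omega> \<mu>" by (rule \<mu>)
    show "densities_converge_weakly \<Omega> (\<lambda>N x. moore_det (quat_hessian (F N) x)) \<mu>"
      unfolding densities_converge_weakly_def
    proof (intro allI impI)
      fix \<phi> :: "quat ^ 'n \<Rightarrow> real" assume t: "test_function_on \<Omega> \<phi>"
      show "(\<lambda>N. LINT x : \<Omega> | lborel. \<phi> x * moore_det (quat_hessian (F N) x)) \<longlonglongrightarrow> (LINT x|\<mu>. \<phi> x)"
        unfolding ma_integral_eq[OF \<Omega> psh[OF F] t] rep[OF t, symmetric] by (rule lim[OF t])
    qed
    fix G \<nu>
    assume *: "C2_psh_approximation \<Omega> f G \<and> locally_finite_borel_measure_on \<Omega> \<nu> \<and>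
      densities_converge_weakly \<Omega> (\<lambda>N x. moore_det (quat_hessian (G N) x)) \<nu>"
    then have G: "C2_psh_approximation \<Omega> f G" and \<nu>: "locally_finite_borel_measure_on \<Omega> \<nu>"
      and w: "densities_converge_weakly \<Omega> (\<lambda>N x. moore_det (quat_hessian (G N) x)) \<nu>" by auto
    show "\<nu> = \<mu>"
    proof (rule measure_eqI_test_functions[OF \<Omega> \<nu> \<mu>])
      fix \<phi> assume t: "test_function_on \<Omega> \<phi>"
      have limG: "(\<lambda>N. ma_integral (G N) \<phi>) \<longlonglongrightarrow> (LINT x|\<nu>. \<phi> x)"
        using w[unfolded densities_converge_weakly_def, rule_format, OF t]
        unfolding ma_integral_eq[OF \<Omega> psh[OF G] t] .
      \<comment> \<open>Both sequences are subsequences of their interleaving, which is an approximating sequence too.\<close>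
      define H where "H N = (if even N then F (N div 2) else G (N div 2))" for N
      have "C2_psh_approximation \<Omega> f H"
        unfolding H_def[abs_def] by (rule C2_psh_approximation_interleave[OF F G])
      from ma_integral_convergent[OF \<Omega> f this t]
      obtain l where l: "(\<lambda>N. ma_integral (H N) \<phi>) \<longlonglongrightarrow> l" by (auto simp: convergent_def)
      have "(\<lambda>N. ma_integral (H (2 * N)) \<phi>) \<longlonglongrightarrow> l" "(\<lambda>N. ma_integral (H (2 * N + 1)) \<phi>) \<longlonglongrightarrow> l"
        using LIMSEQ_subseq_LIMSEQ[OF l, of "\<lambda>N. 2 * N"] LIMSEQ_subseq_LIMSEQ[OF l, of "\<lambda>N. 2 * N + 1"]
        by (auto simp: strict_mono_def comp_def)
      then have "(\<lambda>N. ma_integral (F N) \<phi>) \<longlonglongrightarrow> l" "(\<lambda>N. ma_integral (G N) \<phi>) \<longlonglongrightarrow> l"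
        by (simp_all add: H_def)
      from LIMSEQ_unique[OF limG this(2)] LIMSEQ_unique[OF lim[OF t] this(1)] rep[OF t]
      show "(LINT x|\<nu>. \<phi> x) = (LINT x|\<mu>. \<phi> x)" by simp
    qed
  qed
qed

end
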